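(* Let $f\in\mathcal{O}_{\rm norm}(\overline{\mathbb{D}})$. Then $g=f'$ is a rational function if and only if there exist finitely many points $\alpha_0=0,\alpha_1,\dots,\alpha_\ell\in\mathbb{D}$, arcs $\gamma_1,\dots,\gamma_r$ in $\mathbb{D}$, complex coefficients $c_j$, $a_{jk}$ and positive integers $n_j$ such that the quadrature identity $$\frac1\pi\int_{\mathbb{D}}h|g|^2\,dm=\sum_{j=1}^rc_j\int_{\gamma_j}h\,g\,d\zeta+\sum_{j=0}^{\ell}\sum_{k=1}^{n_j-1}a_{jk}\,h^{(k-1)}(\alpha_j)\qquad(\ast)$$ holds for all $h\in\mathcal{O}(\overline{\mathbb{D}})$. Here the end points of the $\gamma_j$ are the logarithmic poles of $f^*$ and the $\alpha_j$ are the ordinary poles of $f^*g$ in $\mathbb{D}$; in other words, with $g(\zeta)=b\,\prod_{i=1}^m(\zeta-\omega_i)/\prod_{j=1}^{\ell}(\zeta-\zeta_j)^{n_j}$, these points are from the set $\{\zeta_0^*,\zeta_1^*,\dots,\zeta_\ell^*\}$, where $\zeta_0=\infty$, $\zeta_0^*=0$. In addition, if $I\ni t\mapsto f(\cdot,t)\in\mathcal{O}_{\rm norm}(\overline{\mathbb{D}})$ (with $0$ the initial time of $I$) represents a weak solution of the Hele-Shaw problem, then the form $(\ast)$ is stable over time: if it holds initially, it holds for $g(\cdot,t)=f'(\cdot,t)$ for all $t\in I$, with $a_{jk}=a_{jk}(t)$, $\alpha_j=\alpha_j(t)$, $\gamma_j=\gamma_j(t)$ depending on time, with $\alpha_0=0$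 fixed and with $a_{01}(t)=a_{01}(0)+2Q(t)$.
   Context: $\mathbb{D}$ is the open unit disk and $m$ is area measure. $\mathcal{O}(\overline{\mathbb{D}})$: functions analytic in some neighborhood of $\overline{\mathbb{D}}$. $\mathcal{O}_{\rm norm}(\overline{\mathbb{D}})$: those $f\in\mathcal{O}(\overline{\mathbb{D}})$ with $f(0)=0$, $f'(0)>0$. For a point $\omega$, $\omega^*=1/\bar\omega$; for a function $h$, $h^*(\zeta)=\overline{h(1/\bar\zeta)}$. When $g=f'$ is rational, $f$ is an Abelian integral which may have logarithmic poles (at residues of $g\,d\zeta$), and $f^*$ is considered in $\mathbb{D}$ accordingly. $q(t)\ge0$ is a given source strength and $Q(t)=\int_0^tq(s)\,ds$. The family $f(\cdot,t)$ represents a weak solution if there are a Riemann surface $\mathcal{M}$, a nonconstant analytic $p:\mathcal{M}\to\mathbb{C}$, a point $\tilde 0$ with $p(\tilde0)=0$, and univalent analytic $\tilde f(\cdot,t):\mathbb{D}\to\mathcal{M}$ with $\tilde f(0,t)=\tilde0$, $f(\cdot,t)=p\circ\tilde f(\cdot,t)$, such that the sets $\tilde\Omega(t)=\tilde f(\mathbb{D},t)$ have compact closure in $\mathcal{M}$ and for $s<t$ satisfy $\tilde\Omega(s)\subset\tilde\Omega(t)$ and $$\int_{\tilde\Omega(t)}h\,d\tilde m-\int_{\tilde\Omega(s)}h\,d\tilde m\ge2\pi(Q(t)-Q(s))h(\tilde0)$$ for all $h$ subharmonic in $\tilde\Omega(t)$ and integrable with respect to $d\tilde m=\frac{1}{2\mathrm{i}}d\bar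 p\wedge dp$. *)

theory Defs
  imports
    "HOL-Complex_Analysis.Complex_Analysis"
    "HOL-Computational_Algebra.Computational_Algebra"
begin

section \<open>Normalized functions, rational functions, reflection in the unit circle\<close>

definition O_norm :: "(complex \<Rightarrow> complex) set" where
  "O_norm = {f. f analytic_on cball 0 1 \<and> f 0 = 0 \<and> deriv f 0 \<in> \<real> \<and> 0 < Re (deriv f 0)}"

text \<open>\<open>R\<close> is a rational function on the plane which agrees with \<open>g\<close> on the closed unit disk.
  At the zeros of the denominator the values of \<open>R\<close> are meaningless; below \<open>R\<close> is only used
  through notions that ignore isolated values.\<close>

definition rational_extension :: "(complex \<Rightarrow> complex) \<Rightarrow> (complex \<Rightarrow> complex) \<Rightarrow> bool" where
  "rational_extension g R \<longleftrightarrow>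
     (\<exists>P Q :: complex poly. (\<forall>z. R z = poly P z / poly Q z) \<and>
        (\<forall>z\<in>cball 0 1. poly Q z \<noteq> 0 \<and> g z = R z))"

definition is_rational :: "(complex \<Rightarrow> complex) \<Rightarrow> bool" where
  "is_rational g \<longleftrightarrow> (\<exists>R. rational_extension g R)"

definition star_pt :: "complex \<Rightarrow> complex" where
  "star_pt \<omega> = 1 / cnj \<omega>"

definition star_fun :: "(complex \<Rightarrow> complex) \<Rightarrow> complex \<Rightarrow> complex" where
  "star_fun h \<zeta> = cnj (h (1 / cnj \<zeta>))"

text \<open>If \<open>f\<close> is an Abelian integral of the rational function \<open>R\<close>, then \<open>f\<^sup>*\<close> is in general
  multivalued in the unit disk, but its derivative
  \<open>(f\<^sup>*)'(\<zeta>) = - R\<^sup>*(\<zeta>) / \<zeta>\<^sup>2\<close> is a rational function. A pole of \<open>f\<close> at infinity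
  corresponds to the point 0, at which the value given by the formula is irrelevant.\<close>

definition deriv_star :: "(complex \<Rightarrow> complex) \<Rightarrow> complex \<Rightarrow> complex" where
  "deriv_star R \<zeta> = - star_fun R \<zeta> / \<zeta>\<^sup>2"

definition log_poles_star :: "(complex \<Rightarrow> complex) \<Rightarrow> complex set" where
  "log_poles_star R = {w \<in> ball 0 1. residue (deriv_star R) w \<noteq> 0}"

text \<open>Near \<open>w\<close> one has \<open>f\<^sup>*(z) = \<lambda> log (z - w) + F z\<close> with \<open>\<lambda>\<close> the residue of \<open>(f\<^sup>*)'\<close>
  at \<open>w\<close> and with \<open>F\<close> meromorphic and unique up to an additive constant. The point \<open>w\<close> is an
  ordinary pole of \<open>f\<^sup>* g\<close> if \<open>F g\<close> has a pole there.\<close>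

definition ordinary_poles_star :: "(complex \<Rightarrow> complex) \<Rightarrow> complex set" where
  "ordinary_poles_star R = {w \<in> ball 0 1. \<exists>F.
     (\<forall>\<^sub>F z in at w. (F has_field_derivative
         (deriv_star R z - residue (deriv_star R) w / (z - w))) (at z)) \<and>
     is_pole (\<lambda>z. F z * R z) w}"


section \<open>The quadrature identity\<close>

definition quadrature_identity ::
  "(complex \<Rightarrow> complex) \<Rightarrow> nat \<Rightarrow> nat \<Rightarrow> (nat \<Rightarrow> complex) \<Rightarrow> (nat \<Rightarrow> real \<Rightarrow> complex) \<Rightarrow>
   (nat \<Rightarrow> complex) \<Rightarrow> (nat \<Rightarrow> nat) \<Rightarrow> (nat \<Rightarrow> nat \<Rightarrow> complex) \<Rightarrow> bool" where
  "quadrature_identity g l r \<alpha> \<gamma> c n a \<longleftrightarrow>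
     \<alpha> 0 = 0 \<and> inj_on \<alpha> {0..l} \<and> (\<forall>j\<in>{0..l}. \<alpha> j \<in> ball 0 1 \<and> 0 < n j) \<and>
     (\<forall>j\<in>{1..r}. valid_path (\<gamma> j) \<and> arc (\<gamma> j) \<and> path_image (\<gamma> j) \<subseteq> ball 0 1) \<and>
     (\<forall>h. h analytic_on cball 0 1 \<longrightarrow>
        complex_of_real (1 / pi) *
            set_lebesgue_integral lborel (ball 0 1) (\<lambda>z. h z * complex_of_real ((cmod (g z))\<^sup>2)) =
        (\<Sum>j=1..r. c j * contour_integral (\<gamma> j) (\<lambda>\<zeta>. h \<zeta> * g \<zeta>)) +
        (\<Sum>j=0..l. \<Sum>k=1..n j - 1. a j k * (deriv ^^ (k - 1)) h (\<alpha> j)))"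

text \<open>The location of the points in the identity when \<open>g\<close> is rational. Note that \<open>\<alpha> 0 = 0\<close> (the
  reflection of infinity) is always listed, whether or not it is a pole, and that \<open>n j\<close>, for
  \<open>j \<ge> 1\<close>, is the order of the pole of \<open>g\<close> at the reflected point of \<open>\<alpha> j\<close>.\<close>

definition pole_location ::
  "(complex \<Rightarrow> complex) \<Rightarrow> nat \<Rightarrow> nat \<Rightarrow> (nat \<Rightarrow> complex) \<Rightarrow> (nat \<Rightarrow> real \<Rightarrow> complex) \<Rightarrow>
   (nat \<Rightarrow> nat) \<Rightarrow> bool" where
  "pole_location g l r \<alpha> \<gamma> n \<longleftrightarrow>
     (\<exists>R. rational_extension g R \<and>
        (\<Union>j\<in>{1..r}. {pathstart (\<gamma> j), pathfinish (\<gamma> j)}) = log_poles_star R \<and>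
        \<alpha> ` {0..l} = insert 0 (ordinary_poles_star R) \<and>
        (\<Union>j\<in>{1..r}. {pathstart (\<gamma> j), pathfinish (\<gamma> j)}) \<union> \<alpha> ` {0..l}
           \<subseteq> insert 0 (star_pt ` {\<zeta>. is_pole R \<zeta>}) \<and>
        (\<forall>j\<in>{1..l}. is_pole R (star_pt (\<alpha> j)) \<and> zorder R (star_pt (\<alpha> j)) = - int (n j)))"


section \<open>Riemann surfaces\<close>

definition riemann_surface :: "'s topology \<Rightarrow> ('s set \<times> ('s \<Rightarrow> complex)) set \<Rightarrow> bool" where
  "riemann_surface X A \<longleftrightarrow>
     connected_space X \<and> Hausdorff_space X \<and> topspace X \<noteq> {} \<and>
     topspace X = (\<Union>(U, \<phi>)\<in>A. U) \<and>
     (\<forall>(U, \<phi>)\<in>A. openin X U \<and> open (\<phi> ` U) \<and>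
        homeomorphic_map (subtopology X U) (top_of_set (\<phi> ` U)) \<phi>) \<and>
     (\<forall>(U, \<phi>)\<in>A. \<forall>(V, \<psi>)\<in>A. (\<psi> \<circ> inv_into U \<phi>) holomorphic_on \<phi> ` (U \<inter> V))"

definition analytic_from_surface ::
  "('s set \<times> ('s \<Rightarrow> complex)) set \<Rightarrow> ('s \<Rightarrow> complex) \<Rightarrow> bool" where
  "analytic_from_surface A p \<longleftrightarrow> (\<forall>(U, \<phi>)\<in>A. (p \<circ> inv_into U \<phi>) holomorphic_on \<phi> ` U)"

definition analytic_to_surface ::
  "'s topology \<Rightarrow> ('s set \<times> ('s \<Rightarrow> complex)) set \<Rightarrow> complex set \<Rightarrow> (complex \<Rightarrow> 's) \<Rightarrow> bool" where
  "analytic_to_surface X A S F \<longleftrightarrow>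
     continuous_map (top_of_set S) X F \<and>
     (\<forall>(U, \<phi>)\<in>A. (\<phi> \<circ> F) holomorphic_on {z \<in> S. F z \<in> U})"

text \<open>The Borel measure \<open>(1/2i) d(cnj p) \<and> dp\<close>, which is \<open>|p'|\<^sup>2\<close> times area
  measure in each chart.\<close>

definition pullback_area ::
  "'s topology \<Rightarrow> ('s set \<times> ('s \<Rightarrow> complex)) set \<Rightarrow> ('s \<Rightarrow> complex) \<Rightarrow> 's measure \<Rightarrow> bool" where
  "pullback_area X A p \<mu> \<longleftrightarrow>
     space \<mu> = topspace X \<and> sets \<mu> = sigma_sets (topspace X) {U. openin X U} \<and>
     (\<forall>(U, \<phi>)\<in>A. \<forall>B\<in>sets \<mu>. B \<subseteq> U \<longrightarrow>
        emeasure \<mu> B =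
          (\<integral>\<^sup>+z\<in>\<phi> ` B. ennreal ((cmod (deriv (p \<circ> inv_into U \<phi>) z))\<^sup>2) \<partial>lborel))"

text \<open>Upper semicontinuous functions with values in \<open>[-\<infinity>, \<infinity>)\<close> and the sub-mean value
  property. The integral of \<open>u\<close> over a circle may be \<open>-\<infinity>\<close>; the inequality
  \<open>2 \<pi> u(a) \<le> \<integral> u\<close> is written as \<open>\<integral> (C - u) \<le> 2 \<pi> (C - u(a))\<close>, where \<open>C\<close> is any
  upper bound for \<open>u\<close> on the circle.\<close>

definition subharmonic_on :: "(complex \<Rightarrow> ereal) \<Rightarrow> complex set \<Rightarrow> bool" where
  "subharmonic_on u G \<longleftrightarrow>
     (\<forall>z\<in>G. u z < \<infinity>) \<and> (\<forall>c. openin (top_of_set G) {z \<in> G. u z < c}) \<and>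
     (\<forall>a r C. 0 < r \<and> cball a r \<subseteq> G \<and> (\<forall>z\<in>sphere a r. u z \<le> ereal C) \<longrightarrow>
        enn2ereal (\<integral>\<^sup>+\<theta>\<in>{0..2 * pi}.
            e2ennreal (ereal C - u (a + complex_of_real r * cis \<theta>)) \<partial>lborel)
        \<le> ereal (2 * pi) * (ereal C - u a))"

definition surface_subharmonic_on ::
  "('s set \<times> ('s \<Rightarrow> complex)) set \<Rightarrow> ('s \<Rightarrow> ereal) \<Rightarrow> 's set \<Rightarrow> bool" where
  "surface_subharmonic_on A h \<Omega> \<longleftrightarrow>
     (\<forall>(U, \<phi>)\<in>A. subharmonic_on (h \<circ> inv_into U \<phi>) (\<phi> ` (U \<inter> \<Omega>)))"


section \<open>Weak solutions\<close>

definition source_total :: "(real \<Rightarrow> real) \<Rightarrow> real \<Rightarrow> real" where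
  "source_total q t = integral {0..t} q"

definition integrable_ereal_on :: "'s measure \<Rightarrow> 's set \<Rightarrow> ('s \<Rightarrow> ereal) \<Rightarrow> bool" where
  "integrable_ereal_on \<mu> \<Omega> h \<longleftrightarrow>
     (AE x in \<mu>. x \<in> \<Omega> \<longrightarrow> \<bar>h x\<bar> \<noteq> \<infinity>) \<and> set_integrable \<mu> \<Omega> (\<lambda>x. real_of_ereal (h x))"

text \<open>HOL has no quantification over types, so the type of the points of the Riemann surface is
  a parameter. A theorem that assumes \<open>weak_solution TYPE('s) I q f\<close> for a type variable
  \<open>'s\<close> covers all Riemann surfaces.\<close>

definition weak_solution ::
  "'s itself \<Rightarrow> real set \<Rightarrow> (real \<Rightarrow> real) \<Rightarrow> (real \<Rightarrow> complex \<Rightarrow> complex) \<Rightarrow> bool" where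
  "weak_solution ty I q f \<longleftrightarrow>
     (\<exists>(X :: 's topology) A p o' F \<mu>.
        riemann_surface X A \<and>
        analytic_from_surface A p \<and> \<not> p constant_on topspace X \<and>
        o' \<in> topspace X \<and> p o' = 0 \<and>
        pullback_area X A p \<mu> \<and>
        (\<forall>t\<in>I. analytic_to_surface X A (ball 0 1) (F t) \<and> inj_on (F t) (ball 0 1) \<and>
           F t 0 = o' \<and> (\<forall>z\<in>ball 0 1. f t z = p (F t z)) \<and>
           compactin X (X closure_of (F t ` ball 0 1))) \<and>
        (\<forall>s\<in>I. \<forall>t\<in>I. s < t \<longrightarrow>
           F s ` ball 0 1 \<subseteq> F t ` ball 0 1 \<and>
           (\<forall>h. surface_subharmonic_on A h (F t ` ball 0 1) \<and>
                integrable_ereal_on \<mu> (F t ` ball 0 1) h \<longrightarrow>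
              ereal (set_lebesgue_integral \<mu> (F t ` ball 0 1) (\<lambda>x. real_of_ereal (h x)) -
                     set_lebesgue_integral \<mu> (F s ` ball 0 1) (\<lambda>x. real_of_ereal (h x)))
              \<ge> ereal (2 * pi * (source_total q t - source_total q s)) * h o')))"

end

theory Submission
  imports Defs
begin

text \<open>Let \<open>g = f'\<close>. Orthogonality of the monomials in the disk shows that
  \<open>(1/\<pi>) \<integral> P' cnj g dm = - \<Sum> Res (P (f\<^sup>*)')\<close> for \<open>P\<close> analytic on the closed disk whenever \<open>g\<close> is rational.
  With \<open>P' = h g\<close> this is the quadrature identity: simple poles of \<open>(f\<^sup>*)'\<close> contribute values of the
  primitive \<open>P\<close>, that is, integrals of \<open>h g\<close> along arcs, and poles of higher order contribute derivatives
  of \<open>h\<close>. Conversely, test functions that vanish to high order at the points \<open>\<alpha> j\<close> turn an identity into a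
  linear recurrence for the Taylor coefficients of \<open>g\<close>.

  A weak solution provides a conformal map \<open>\<Phi>\<close> of the disk into itself with \<open>f\<^sub>0 = f\<^sub>t \<circ> \<Phi>\<close>, and the
  subharmonic functions \<open>Re h\<close> and \<open>- Re h\<close> give
  \<open>\<integral> h \<bar>g\<^sub>t\<bar>\<^sup>2 dm = \<integral> (h \<circ> \<Phi>) \<bar>g\<^sub>0\<bar>\<^sup>2 dm + 2 \<pi> Q(t) h(0)\<close>. Hence the identity at time \<open>0\<close>, applied to \<open>h \<circ> \<Phi>\<close>,
  becomes one at time \<open>t\<close> with points \<open>\<Phi> (\<alpha> j)\<close> and arcs \<open>\<Phi> \<circ> \<gamma> j\<close>. The poles are where they should be
  because the functional determines the principal parts of \<open>(f\<^sub>t\<^sup>*)'\<close>, up to the terms killed by the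
  zeros of \<open>g\<^sub>t\<close>.\<close>

section \<open>Change of variables for injective holomorphic maps\<close>

text \<open>The reflected function is multivalued, so it never appears itself: everything is read
  off from the principal parts of its rational derivative. Their residues add up to zero because the
  circle integral of \<open>g\<close> vanishes; this is why the values of the primitive
  \<open>P\<close> combine into differences, hence into arcs. The functional sees only primitives
  with \<open>P' = h g\<close>, and \<open>P'\<close> vanishes wherever \<open>g\<close> does. At a
  zero \<open>w\<close> of order \<open>m\<close> the coefficients of \<open>(z - w)^-(k+1)\<close>
  with \<open>1 \<le> k \<le> m\<close> are therefore invisible; but these are exactly the ones that
  create no pole after multiplication by \<open>g\<close>, so the visible data and the ordinary
  poles match. At the origin the source disturbs the comparison, so no coefficient of positive index
  is compared there: \<open>0\<close> is listed among the points in any case, and \<open>n 0\<close>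
  is raised to at least \<open>2\<close> to give the source term a place. Since
  \<open>h \<circ> \<Phi>\<close> need not be analytic on the closed disk, the identities are
  extended to bounded holomorphic test functions before they are transported.\<close>

definition complex_of_vec :: "real ^ 2 \<Rightarrow> complex" where
  "complex_of_vec x = Complex (x $ 1) (x $ 2)"

definition vec_of_complex :: "complex \<Rightarrow> real ^ 2" where
  "vec_of_complex z = (\<chi> i. if i = 1 then Re z else Im z)"

lemma complex_of_vec_of_complex [simp]: "complex_of_vec (vec_of_complex z) = z"
  by (simp add: complex_of_vec_def vec_of_complex_def)

lemma vec_of_complex_of_vec [simp]: "vec_of_complex (complex_of_vec x) = x"
  by (simp add: complex_of_vec_def vec_of_complex_def vec_eq_iff forall_2)

lemma bounded_linear_complex_of_vec: "bounded_linear complex_of_vec"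
  by (intro linear_conv_bounded_linear[THEN iffD1] linearI)
     (auto simp: complex_of_vec_def complex_eq_iff)

lemma bounded_linear_vec_of_complex: "bounded_linear vec_of_complex"
  by (intro linear_conv_bounded_linear[THEN iffD1] linearI)
     (auto simp: vec_of_complex_def vec_eq_iff)

lemma measurable_complex_of_vec [measurable]: "complex_of_vec \<in> borel \<rightarrow>\<^sub>M borel"
  by (intro borel_measurable_continuous_onI bounded_linear.continuous_on[OF bounded_linear_complex_of_vec] continuous_intros)

text \<open>Lebesgue measure is determined by its values on boxes, and the identification of the
  plane with \<open>real ^ 2\<close> takes boxes to boxes. It moves the change of variables to a
  space of column vectors, where the Jacobian is a matrix determinant.\<close>

lemma lborel_complex_eq: "(lborel :: complex measure) = distr lborel borel complex_of_vec"
proof (rule lborel_eqI)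
  fix l u :: complex
  assume le: "\<And>b. b \<in> Basis \<Longrightarrow> l \<bullet> b \<le> u \<bullet> b"
  have le2: "Re l \<le> Re u" "Im l \<le> Im u"
    using le[of 1] le[of \<i>] by (auto simp: Basis_complex_def)
  have "complex_of_vec -` box l u = box (vec_of_complex l) (vec_of_complex u)"
    by (auto simp: complex_of_vec_def vec_of_complex_def in_box_complex_iff mem_box_cart forall_2)
  then have "emeasure (distr lborel borel complex_of_vec) (box l u)
      = emeasure lborel (box (vec_of_complex l) (vec_of_complex u))"
    by (subst emeasure_distr) auto
  also have "\<dots> = ennreal (\<Prod>b\<in>Basis. (vec_of_complex u - vec_of_complex l) \<bullet> b)"
    by (rule emeasure_lborel_box)
       (use le2 in \<open>auto simp: Basis_vec_def vec_of_complex_def inner_axis\<close>)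
  also have "(\<Prod>b\<in>Basis. (vec_of_complex u - vec_of_complex l) \<bullet> b) = (\<Prod>b\<in>Basis. (u - l) \<bullet> b)"
  proof -
    have B: "(Basis :: (real^2) set) = {axis 1 1, axis 2 1}"
      by (auto simp: Basis_vec_def UNIV_2)
    have "axis 1 (1::real) \<noteq> (axis 2 1 :: real^2)" by (simp add: axis_eq_axis)
    then show ?thesis
      unfolding B Basis_complex_def by (simp add: vec_of_complex_def inner_axis)
  qed
  finally show "emeasure (distr lborel borel complex_of_vec) (box l u) = ennreal (\<Prod>b\<in>Basis. (u - l) \<bullet> b)" .
qed simp

lemma emeasure_lborel_vec_of_complex:
  assumes [measurable]: "E \<in> sets borel"
  shows "emeasure lborel (vec_of_complex ` E) = emeasure lborel E"
proof -
  have "vec_of_complex ` E = complex_of_vec -` E"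
    by (auto simp: image_iff intro!: bexI[of _ "complex_of_vec _"])
  moreover have "emeasure lborel E = emeasure (distr lborel borel complex_of_vec) E"
    by (rule arg_cong[OF lborel_complex_eq])
  ultimately show ?thesis
    by (simp add: emeasure_distr)
qed

lemma vec_of_complex_in_borel:
  assumes [measurable]: "E \<in> sets borel"
  shows "vec_of_complex ` E \<in> sets borel"
proof -
  have "vec_of_complex ` E = complex_of_vec -` E"
    by (auto simp: image_iff intro!: bexI[of _ "complex_of_vec _"])
  then show ?thesis using measurable_sets[OF measurable_complex_of_vec, of E] by simp
qed

lemma nn_integral_vec_of_complex:
  assumes [measurable]: "u \<in> borel_measurable borel" "E \<in> sets borel"
  shows "(\<integral>\<^sup>+x\<in>vec_of_complex ` E. u (complex_of_vec x) \<partial>lborel) = (\<integral>\<^sup>+z\<in>E. u z \<partial>lborel)"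
proof -
  have "indicator (vec_of_complex ` E) x = (indicator E (complex_of_vec x) :: ennreal)" for x
    by (auto simp: indicator_def image_iff) (metis vec_of_complex_of_vec)
  moreover have "(\<integral>\<^sup>+z\<in>E. u z \<partial>lborel) = (\<integral>\<^sup>+z\<in>E. u z \<partial>(distr lborel borel complex_of_vec))"
    by (rule arg_cong[OF lborel_complex_eq])
  ultimately show ?thesis
    by (simp add: nn_integral_distr)
qed

text \<open>The inverse is holomorphic, hence continuous, on the open image, so the image of a Borel
  set is a preimage under a continuous map.\<close>

lemma holomorphic_image_borel:
  assumes \<psi>: "\<psi> holomorphic_on V" "open V" "inj_on \<psi> V" and E: "E \<in> sets borel" "E \<subseteq> V"
  shows "\<psi> ` E \<in> sets borel"
proof -
  obtain \<xi> where \<xi>: "\<xi> holomorphic_on (\<psi> ` V)" "\<And>z. z \<in> V \<Longrightarrow> \<xi> (\<psi> z) = z"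
    using holomorphic_has_inverse[OF \<psi>] by metis
  have "open (\<psi> ` V)"
    using \<psi> open_mapping_thm3 by blast
  then have "\<xi> -` E \<inter> \<psi> ` V \<in> sets borel"
    using measurable_sets[OF borel_measurable_continuous_on_restrict, OF holomorphic_on_imp_continuous_on[OF \<xi>(1)] E(1)]
    by (auto simp: space_restrict_space sets_restrict_space_iff)
  moreover have "\<xi> -` E \<inter> \<psi> ` V = \<psi> ` E"
    using E \<xi>(2) by auto
  ultimately show ?thesis by simp
qed

lemma deriv_borel_measurable_on:
  assumes "\<psi> holomorphic_on V" "open V"
  shows "(\<lambda>z. indicator V z *\<^sub>R (deriv \<psi> z)) \<in> borel_measurable borel"
  using assms by (intro borel_measurable_continuous_on_indicator holomorphic_on_imp_continuous_on holomorphic_deriv) auto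

lemma emeasure_holomorphic_image_compact:
  assumes \<psi>: "\<psi> holomorphic_on V" "open V" "inj_on \<psi> V"
    and K: "compact K" "K \<subseteq> V" and E: "E \<in> sets borel" "E \<subseteq> K"
  shows "emeasure lborel (\<psi> ` E) = (\<integral>\<^sup>+z\<in>E. ennreal ((cmod (deriv \<psi> z))\<^sup>2) \<partial>lborel)"
proof -
  define G where "G = vec_of_complex \<circ> \<psi> \<circ> complex_of_vec"
  define G' where "G' = (\<lambda>x. vec_of_complex \<circ> ((*) (deriv \<psi> (complex_of_vec x))) \<circ> complex_of_vec)"
  define S where "S = vec_of_complex ` E"
  have mE: "\<psi> ` E \<in> sets borel"
    using holomorphic_image_borel[OF \<psi>] E K by blast
  have S: "S \<in> sets borel" using vec_of_complex_in_borel E unfolding S_def by blast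
  have der: "(G has_derivative G' x) (at x within S)" if "x \<in> S" for x
  proof -
    have "complex_of_vec x \<in> V" using that E K unfolding S_def by auto
    then have "(\<psi> has_derivative ((*) (deriv \<psi> (complex_of_vec x)))) (at (complex_of_vec x))"
      using holomorphic_derivI[OF \<psi>(1,2)] by (simp add: has_field_derivative_def)
    then have "((\<psi> \<circ> complex_of_vec) has_derivative ((*) (deriv \<psi> (complex_of_vec x)) \<circ> complex_of_vec)) (at x)"
      by (rule diff_chain_at[OF bounded_linear_imp_has_derivative[OF bounded_linear_complex_of_vec]])
    then have "(vec_of_complex \<circ> (\<psi> \<circ> complex_of_vec) has_derivative
        vec_of_complex \<circ> ((*) (deriv \<psi> (complex_of_vec x)) \<circ> complex_of_vec)) (at x)"
      by (rule diff_chain_at[OF _ bounded_linear_imp_has_derivative[OF bounded_linear_vec_of_complex]])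
    then show ?thesis unfolding G_def G'_def comp_assoc
      by (rule has_derivative_at_withinI)
  qed
  have inj: "inj_on G S"
  proof (rule inj_onI)
    fix x y assume xy: "x \<in> S" "y \<in> S" "G x = G y"
    then have "\<psi> (complex_of_vec x) = \<psi> (complex_of_vec y)"
      unfolding G_def o_def by (metis complex_of_vec_of_complex)
    then have "\<psi> (complex_of_vec x) = \<psi> (complex_of_vec y)" and "complex_of_vec x \<in> V" "complex_of_vec y \<in> V"
      using xy E K unfolding S_def by auto
    then have "complex_of_vec x = complex_of_vec y"
      using \<psi>(3) by (auto dest: inj_onD)
    then show "x = y" by (metis vec_of_complex_of_vec)
  qed
  \<comment> \<open>Multiplication by \<open>a + i b\<close> has the rows \<open>(a, -b)\<close> and
    \<open>(b, a)\<close>, with determinant \<open>a^2 + b^2\<close>.\<close>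
  have det: "\<bar>det (matrix (G' x))\<bar> = (cmod (deriv \<psi> (complex_of_vec x)))\<^sup>2" for x
    by (simp add: det_2 matrix_def G'_def complex_of_vec_def vec_of_complex_def axis_def cmod_power2)
       (simp add: power2_eq_square)
  have cont: "continuous_on K (\<lambda>z. (cmod (deriv \<psi> z))\<^sup>2)"
    by (intro continuous_intros holomorphic_on_imp_continuous_on holomorphic_on_subset[OF holomorphic_deriv[OF \<psi>(1,2)] K(2)])
  have bK: "bounded K" using K compact_imp_bounded by blast
  have mfE: "emeasure lborel E < \<infinity>"
    using emeasure_bounded_finite[OF bounded_subset[OF bK E(2)]] by simp
  \<comment> \<open>Cutting the derivative off outside \<open>V\<close> makes it Borel measurable on
    the whole plane and leaves integrals over subsets of \<open>V\<close> unchanged.\<close>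
  define j where "j = (\<lambda>z. indicator V z *\<^sub>R deriv \<psi> z)"
  have jm [measurable]: "j \<in> borel_measurable borel"
    unfolding j_def by (rule deriv_borel_measurable_on[OF \<psi>(1,2)])
  have Em [measurable]: "E \<in> sets borel" and Sm [measurable]: "S \<in> sets borel" by fact+
  obtain B where B: "\<And>z. z \<in> K \<Longrightarrow> (cmod (deriv \<psi> z))\<^sup>2 \<le> B"
    using compact_imp_bounded[OF compact_continuous_image[OF cont K(1)]]
    unfolding bounded_iff by (auto simp: abs_le_iff)
  have nn: "(\<integral>\<^sup>+z\<in>E. ennreal ((cmod (deriv \<psi> z))\<^sup>2) \<partial>lborel) = (\<integral>\<^sup>+z\<in>E. ennreal ((cmod (j z))\<^sup>2) \<partial>lborel)"
    using E K by (intro nn_integral_cong) (auto simp: indicator_def j_def)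
  also have "\<dots> = (\<integral>\<^sup>+x\<in>S. ennreal ((cmod (j (complex_of_vec x)))\<^sup>2) \<partial>lborel)"
    unfolding S_def by (rule nn_integral_vec_of_complex[symmetric]) measurable
  finally have nn2: "(\<integral>\<^sup>+z\<in>E. ennreal ((cmod (deriv \<psi> z))\<^sup>2) \<partial>lborel) = (\<integral>\<^sup>+x\<in>S. ennreal ((cmod (j (complex_of_vec x)))\<^sup>2) \<partial>lborel)" .
  have jS: "cmod (j (complex_of_vec x)) = cmod (deriv \<psi> (complex_of_vec x))" if "x \<in> S" for x
    using that E K unfolding S_def j_def by auto
  have "(\<integral>\<^sup>+z\<in>E. ennreal ((cmod (j z))\<^sup>2) \<partial>lborel) \<le> (\<integral>\<^sup>+z\<in>E. ennreal B \<partial>lborel)"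
    using B E K by (intro nn_integral_mono) (auto simp: indicator_def j_def intro!: ennreal_leI)
  also have "\<dots> = ennreal B * emeasure lborel E"
    using E by (simp add: nn_integral_cmult)
  also have "\<dots> < \<infinity>" using mfE by (simp add: ennreal_mult_less_top)
  finally have fin: "(\<integral>\<^sup>+x\<in>S. ennreal ((cmod (j (complex_of_vec x)))\<^sup>2) \<partial>lborel) < \<infinity>"
    using nn nn2 by simp
  define m where "m = enn2real (\<integral>\<^sup>+x\<in>S. ennreal ((cmod (j (complex_of_vec x)))\<^sup>2) \<partial>lborel)"
  have m: "0 \<le> m" "(\<integral>\<^sup>+x\<in>S. ennreal ((cmod (j (complex_of_vec x)))\<^sup>2) \<partial>lborel) = ennreal m"
    using fin by (simp_all add: m_def)
  have "((\<lambda>x. (cmod (j (complex_of_vec x)))\<^sup>2 * indicator S x) has_integral m) UNIV"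
    using S m by (intro nn_integral_has_integral) (auto simp: ennreal_mult ennreal_indicator)
  then have "((\<lambda>x. (cmod (j (complex_of_vec x)))\<^sup>2) has_integral m) S"
    by (subst has_integral_restrict_UNIV[symmetric], elim has_integral_eq[rotated]) (simp add: indicator_def)
  then have "((\<lambda>x. \<bar>det (matrix (G' x))\<bar>) has_integral m) S"
    by (rule has_integral_eq[rotated]) (simp only: det jS)
  then have "G ` S \<in> lmeasurable \<and> measure lebesgue (G ` S) = m"
    using has_measure_differentiable_image[of S G G' m] S der inj by simp
  moreover have GS: "G ` S = vec_of_complex ` \<psi> ` E"
    unfolding G_def S_def by (auto simp: image_image)
  ultimately have "emeasure lebesgue (vec_of_complex ` \<psi> ` E) = ennreal m"
    using emeasure_eq_measure2[of "G ` S" lebesgue] by simp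
  then have "emeasure lborel (vec_of_complex ` \<psi> ` E) = ennreal m"
    using vec_of_complex_in_borel[OF mE] by simp
  then show ?thesis using emeasure_lborel_vec_of_complex[OF mE] m nn2 by simp
qed

text \<open>Both sides are continuous along increasing sequences of sets, so an exhaustion of
  \<open>V\<close> by compact sets reduces the claim to the compact case.\<close>

lemma emeasure_holomorphic_image:
  assumes \<psi>: "\<psi> holomorphic_on V" "open V" "inj_on \<psi> V" and E: "E \<in> sets borel" "E \<subseteq> V"
  shows "emeasure lborel (\<psi> ` E) = (\<integral>\<^sup>+z\<in>E. ennreal ((cmod (deriv \<psi> z))\<^sup>2) \<partial>lborel)"
proof -
  obtain C :: "nat \<Rightarrow> complex set" where C: "\<And>n. compact (C n)" "\<And>n. C n \<subseteq> V"
      "\<And>n. C n \<subseteq> interior (C (Suc n))" "\<Union>(range C) = V"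
    using open_Union_compact_subsets[OF \<psi>(2)] by metis
  have incC: "incseq C"
    using C(3) interior_subset by (intro incseq_SucI) blast
  have C_borel: "C n \<in> sets borel" for n using C(1) borel_compact by blast
  have EC: "E \<inter> C n \<in> sets borel" "E \<inter> C n \<subseteq> C n" for n using E C_borel by auto
  define j where "j = (\<lambda>z. indicator V z *\<^sub>R deriv \<psi> z)"
  define D where "D = density lborel (\<lambda>z. ennreal ((cmod (j z))\<^sup>2))"
  have [measurable]: "j \<in> borel_measurable borel"
    unfolding j_def by (rule deriv_borel_measurable_on[OF \<psi>(1,2)])
  have emD: "emeasure D A = (\<integral>\<^sup>+z\<in>A. ennreal ((cmod (deriv \<psi> z))\<^sup>2) \<partial>lborel)"
    if "A \<in> sets borel" "A \<subseteq> V" for A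
  proof -
    have "emeasure D A = (\<integral>\<^sup>+z\<in>A. ennreal ((cmod (j z))\<^sup>2) \<partial>lborel)"
      unfolding D_def using that(1) by (intro emeasure_density) auto
    also have "\<dots> = (\<integral>\<^sup>+z\<in>A. ennreal ((cmod (deriv \<psi> z))\<^sup>2) \<partial>lborel)"
      using that by (intro nn_integral_cong) (auto simp: indicator_def j_def)
    finally show ?thesis .
  qed
  have U: "(\<Union>n. E \<inter> C n) = E" using C(4) E by auto
  have "\<psi> ` E = (\<Union>n. \<psi> ` (E \<inter> C n))"
    using U by (simp only: image_UN[symmetric])
  then have "emeasure lborel (\<psi> ` E) = emeasure lborel (\<Union>n. \<psi> ` (E \<inter> C n))"
    by simp
  also have "\<dots> = (SUP n. emeasure lborel (\<psi> ` (E \<inter> C n)))"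
  proof (rule SUP_emeasure_incseq[symmetric])
    show "range (\<lambda>n. \<psi> ` (E \<inter> C n)) \<subseteq> sets lborel"
      using holomorphic_image_borel[OF \<psi> EC(1)] C(2) by auto
    show "incseq (\<lambda>n. \<psi> ` (E \<inter> C n))"
      using incC unfolding incseq_def by blast
  qed
  also have "\<dots> = (SUP n. emeasure D (E \<inter> C n))"
  proof (intro SUP_cong refl)
    fix n
    have "emeasure lborel (\<psi> ` (E \<inter> C n)) = (\<integral>\<^sup>+z\<in>(E \<inter> C n). ennreal ((cmod (deriv \<psi> z))\<^sup>2) \<partial>lborel)"
      using emeasure_holomorphic_image_compact[OF \<psi> C(1,2) EC] .
    then show "emeasure lborel (\<psi> ` (E \<inter> C n)) = emeasure D (E \<inter> C n)"
      using emD[OF EC(1)[of n]] E(2) by (metis Int_lower1 subset_trans)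
  qed
  also have "\<dots> = emeasure D (\<Union>n. E \<inter> C n)"
  proof (rule SUP_emeasure_incseq)
    show "range (\<lambda>n. E \<inter> C n) \<subseteq> sets D"
      using EC by (auto simp: D_def)
    show "incseq (\<lambda>n. E \<inter> C n)"
      using incC unfolding incseq_def by blast
  qed
  finally show ?thesis using emD[OF E] U by simp
qed

text \<open>The change of variables as an image measure, from which the formulas for integrals
  follow. The value \<open>0\<close> chosen outside \<open>V\<close> is harmless because the density
  vanishes there.\<close>

lemma distr_holomorphic_image:
  assumes \<psi>: "\<psi> holomorphic_on V" "open V" "inj_on \<psi> V"
  shows "distr (density lborel (\<lambda>z. ennreal (indicator V z * (cmod (deriv \<psi> z))\<^sup>2))) borel
           (\<lambda>z. if z \<in> V then \<psi> z else 0) = density lborel (indicator (\<psi> ` V))"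
    (is "distr (density lborel ?w) borel ?\<psi> = ?R")
proof (rule measure_eqI)
  have V [measurable]: "V \<in> sets borel" using \<psi> by auto
  have \<psi>V [measurable]: "\<psi> ` V \<in> sets borel" using open_mapping_thm3[OF \<psi>] by (rule borel_open)
  have \<psi>m [measurable]: "?\<psi> \<in> borel_measurable borel"
    by (intro borel_measurable_continuous_on_if holomorphic_on_imp_continuous_on \<psi>) auto
  define j where "j = (\<lambda>z. indicator V z *\<^sub>R deriv \<psi> z)"
  have [measurable]: "j \<in> borel_measurable borel"
    unfolding j_def by (rule deriv_borel_measurable_on[OF \<psi>(1,2)])
  have w_eq: "?w = (\<lambda>z. ennreal ((cmod (j z))\<^sup>2))"
    by (auto simp: indicator_def j_def)
  have wm [measurable]: "?w \<in> borel_measurable borel"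
    unfolding w_eq by measurable
  fix A assume "A \<in> sets (distr (density lborel ?w) borel ?\<psi>)"
  then have A [measurable]: "A \<in> sets borel" by simp
  define E where "E = ?\<psi> -` A \<inter> V"
  have E [measurable]: "E \<in> sets borel" unfolding E_def
    using measurable_sets[OF \<psi>m A] by auto
  have "emeasure (distr (density lborel ?w) borel ?\<psi>) A = emeasure (density lborel ?w) (?\<psi> -` A)"
    by (subst emeasure_distr) auto
  also have "\<dots> = (\<integral>\<^sup>+z\<in>(?\<psi> -` A). ?w z \<partial>lborel)"
    using measurable_sets[OF \<psi>m A] wm by (intro emeasure_density) simp_all
  also have "\<dots> = (\<integral>\<^sup>+z\<in>E. ennreal ((cmod (deriv \<psi> z))\<^sup>2) \<partial>lborel)"
    by (intro nn_integral_cong) (auto simp: E_def indicator_def)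
  also have "\<dots> = emeasure lborel (\<psi> ` E)"
    by (rule emeasure_holomorphic_image[OF \<psi> E, symmetric]) (auto simp: E_def)
  also have "\<psi> ` E = \<psi> ` V \<inter> A" by (auto simp: E_def)
  also have "emeasure lborel (\<psi> ` V \<inter> A) = emeasure ?R A"
    by (simp add: emeasure_density indicator_inter_arith[symmetric])
  finally show "emeasure (distr (density lborel ?w) borel ?\<psi>) A = emeasure ?R A" .
qed simp

lemma set_lebesgue_integral_holomorphic_image:
  fixes u :: "complex \<Rightarrow> 'b :: {banach, second_countable_topology}"
  assumes \<psi>: "\<psi> holomorphic_on V" "open V" "inj_on \<psi> V"
    and u: "(\<lambda>y. indicator (\<psi> ` V) y *\<^sub>R u y) \<in> borel_measurable borel"
  shows "(LINT y:\<psi> ` V|lborel. u y) = (LINT z:V|lborel. (cmod (deriv \<psi> z))\<^sup>2 *\<^sub>R u (\<psi> z))"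
proof -
  have V [measurable]: "V \<in> sets borel" using \<psi> by auto
  have \<psi>V [measurable]: "\<psi> ` V \<in> sets borel" using open_mapping_thm3[OF \<psi>] by (rule borel_open)
  have \<psi>m [measurable]: "(\<lambda>z. if z \<in> V then \<psi> z else 0) \<in> borel_measurable borel"
    by (intro borel_measurable_continuous_on_if holomorphic_on_imp_continuous_on \<psi>) auto
  define u' where "u' = (\<lambda>y. indicator (\<psi> ` V) y *\<^sub>R u y)"
  have [measurable]: "u' \<in> borel_measurable borel" using u by (simp add: u'_def)
  define j where "j = (\<lambda>z. indicator V z *\<^sub>R deriv \<psi> z)"
  have [measurable]: "j \<in> borel_measurable borel"
    unfolding j_def by (rule deriv_borel_measurable_on[OF \<psi>(1,2)])
  have w_eq: "(\<lambda>z. indicator V z * (cmod (deriv \<psi> z))\<^sup>2) = (\<lambda>z.  ((cmod (j z))\<^sup>2))"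
    by (auto simp: indicator_def j_def)
  have wm [measurable]: "(\<lambda>z. indicator V z * (cmod (deriv \<psi> z))\<^sup>2) \<in> borel_measurable borel"
    unfolding w_eq by measurable
  have "(LINT y:\<psi> ` V|lborel. u y) = (LINT y|lborel. indicator (\<psi> ` V) y *\<^sub>R u' y)"
    unfolding set_lebesgue_integral_def u'_def by (intro Bochner_Integration.integral_cong) (auto simp: indicator_def)
  also have "\<dots> = (LINT y|density lborel (indicator (\<psi> ` V)). u' y)"
    using integral_density[of u' lborel "indicator (\<psi> ` V)"] by (simp add: ennreal_indicator)
  also have "\<dots> = (LINT z|density lborel (\<lambda>z. ennreal (indicator V z * (cmod (deriv \<psi> z))\<^sup>2)). u' (if z \<in> V then \<psi> z else 0))"
    unfolding distr_holomorphic_image[OF \<psi>, symmetric] by (subst integral_distr) auto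
  also have "\<dots> = (LINT z|lborel. (indicator V z * (cmod (deriv \<psi> z))\<^sup>2) *\<^sub>R u' (if z \<in> V then \<psi> z else 0))"
    by (rule integral_density) auto
  also have "\<dots> = (LINT z:V|lborel. (cmod (deriv \<psi> z))\<^sup>2 *\<^sub>R u (\<psi> z))"
    unfolding set_lebesgue_integral_def u'_def by (intro Bochner_Integration.integral_cong) (auto simp: indicator_def)
  finally show ?thesis .
qed

text \<open>Applied with \<open>c\<close> on the unit circle it is invariance under rotations; with
  \<open>c\<close> real it relates concentric disks.\<close>

lemma set_lebesgue_integral_ball_scale:
  fixes u :: "complex \<Rightarrow> 'b :: {banach, second_countable_topology}"
  assumes c: "c \<noteq> 0" and u: "continuous_on (ball 0 (cmod c)) u"
  shows "(LINT y:ball 0 (cmod c)|lborel. u y) = (LINT z:ball 0 1|lborel. (cmod c)\<^sup>2 *\<^sub>R u (c * z))"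
proof -
  have im: "(*) c ` ball 0 1 = ball 0 (cmod c)"
    using c by (auto simp: image_iff norm_mult field_simps norm_divide intro!: bexI[of _ "_ / c"])
  have "(LINT y:(*) c ` ball 0 1|lborel. u y) = (LINT z:ball 0 1|lborel. (cmod (deriv ((*) c) z))\<^sup>2 *\<^sub>R u (c * z))"
    using c u im
    by (intro set_lebesgue_integral_holomorphic_image)
       (auto intro!: holomorphic_intros inj_onI borel_measurable_continuous_on_indicator)
  moreover have "deriv ((*) c) z = c" for z by (rule DERIV_imp_deriv) (auto intro!: derivative_eq_intros)
  ultimately show ?thesis using im by simp
qed


lemma set_integrable_ball_continuous:
  fixes u :: "complex \<Rightarrow> complex"
  assumes "continuous_on (ball 0 1) u" "\<And>z. z \<in> ball 0 1 \<Longrightarrow> cmod (u z) \<le> B"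
  shows "set_integrable lborel (ball 0 1) u"
proof -
  have fin: "emeasure lborel (ball 0 1 :: complex set) < \<infinity>"
    using emeasure_lborel_ball_finite by auto
  have m: "(\<lambda>z. indicator (ball 0 1) z *\<^sub>R u z) \<in> borel_measurable lborel"
    using borel_measurable_continuous_on_indicator[OF _ assms(1)] by simp
  show ?thesis unfolding set_integrable_def
    using assms(2) fin
    by (intro integrableI_bounded_set[of "ball 0 1" _ _ B] m) (auto intro!: AE_I2)
qed

section \<open>Moments of area measure on the unit disk\<close>

definition disk_moment :: "nat \<Rightarrow> nat \<Rightarrow> complex" where
  "disk_moment m n = (LINT z:ball 0 1|lborel. z ^ m * cnj z ^ n)"

lemma disk_moment_off_diagonal:
  assumes "m \<noteq> n"
  shows "disk_moment m n = 0"
proof -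
  \<comment> \<open>Rotation by \<open>\<theta>\<close> multiplies the moment by
    \<open>cis ((m - n) * \<theta>)\<close>; this choice makes the factor \<open>-1\<close>.\<close>
  define \<theta> where "\<theta> = pi / (real m - real n)"
  have "disk_moment m n = (LINT z:ball 0 (cmod (cis \<theta>))|lborel. z ^ m * cnj z ^ n)"
    by (simp add: disk_moment_def)
  also have "\<dots> = (LINT z:ball 0 1|lborel. (cmod (cis \<theta>))\<^sup>2 *\<^sub>R ((cis \<theta> * z) ^ m * cnj (cis \<theta> * z) ^ n))"
    by (rule set_lebesgue_integral_ball_scale) (auto intro!: continuous_intros)
  also have "\<dots> = (LINT z:ball 0 1|lborel. (cis \<theta> ^ m * cis (-\<theta>) ^ n) * (z ^ m * cnj z ^ n))"
    by (simp add: power_mult_distrib mult_ac cis_cnj)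
  also have "cis \<theta> ^ m * cis (-\<theta>) ^ n = cis (real m * \<theta> + real n * (-\<theta>))"
    unfolding Complex.DeMoivre cis_mult ..
  also have "real m * \<theta> + real n * (-\<theta>) = pi"
  proof -
    have "real m * \<theta> + real n * (-\<theta>) = (real m - real n) * \<theta>" by (simp add: algebra_simps)
    then show ?thesis using assms by (simp add: \<theta>_def)
  qed
  also have "(LINT z:ball 0 1|lborel. cis pi * (z ^ m * cnj z ^ n)) = - disk_moment m n"
    by (simp add: disk_moment_def set_lebesgue_integral_def)
  finally show ?thesis by simp
qed

text \<open>The integral over the annulus \<open>r < \<bar>z\<bar> < 1\<close> is computed by scaling and compared with the area as
  \<open>r \<rightarrow> 1\<close>.\<close>

lemma disk_moment_diagonal: "disk_moment n n = of_real (pi / (real n + 1))"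
proof -
  define B where "B = (LINT z:ball 0 (1::real)|lborel. cmod (z::complex) ^ (2 * n))"
  have cont: "continuous_on A (\<lambda>z. cmod (z::complex) ^ (2 * n))" for A
    by (intro continuous_intros)
  have int: "set_integrable lborel (ball 0 r) (\<lambda>z. cmod (z::complex) ^ (2 * n))" for r
  proof (rule set_integrable_subset)
    show "set_integrable lborel (cball 0 r) (\<lambda>z. cmod (z::complex) ^ (2 * n))"
      by (rule borel_integrable_compact[unfolded set_integrable_def[symmetric]]) (auto intro: cont)
  qed auto
  have area: "measure lborel (ball 0 r :: complex set) = pi * r\<^sup>2" if "r \<ge> 0" for r
    using that content_ball[of r "0::complex"] by (simp add: unit_ball_vol_2)
  \<comment> \<open>With \<open>s = r^2\<close>, dilation shows that the integral over the annulus
    is \<open>B (1 - s^(n+1))\<close>, while the integrand lies between \<open>s^n\<close> and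
    \<open>1\<close> there. Division by \<open>1 - s\<close> leaves a geometric sum, which tends to
    \<open>n + 1\<close> as \<open>s\<close> tends to \<open>1\<close>.\<close>
  have upper: "s ^ n * pi \<le> B * (\<Sum>i<Suc n. s ^ i) \<and> B * (\<Sum>i<Suc n. s ^ i) \<le> pi"
    if s: "0 < s" "s < 1" for s
  proof -
    define r where "r = sqrt s"
    have r: "0 < r" "r < 1" "r\<^sup>2 = s" using s by (auto simp: r_def)
    define A where "A = ball (0::complex) 1 - ball 0 r"
    have sub: "ball (0::complex) r \<subseteq> ball 0 1" using r by auto
    have mA: "measure lborel A = pi * (1 - s)"
      unfolding A_def using sub r
      by (subst measure_Diff) (auto simp: area right_diff_distrib emeasure_lborel_ball_finite[THEN less_imp_neq, simplified])
    have scale: "(LINT z:ball 0 r|lborel. cmod (z::complex) ^ (2 * n)) = s ^ Suc n * B"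
    proof -
      have "(LINT z:ball 0 (cmod (of_real r))|lborel. cmod (z::complex) ^ (2 * n))
         = (LINT z:ball 0 1|lborel. (cmod (of_real r))\<^sup>2 *\<^sub>R (cmod (of_real r * z) ^ (2 * n)))"
        using r by (intro set_lebesgue_integral_ball_scale cont) auto
      also have "\<dots> = (LINT z:ball 0 1|lborel. (r\<^sup>2) ^ Suc n * (cmod z ^ (2 * n)))"
      proof -
        have "(cmod (of_real r))\<^sup>2 *\<^sub>R (cmod (of_real r * z) ^ (2 * n)) = (r\<^sup>2) ^ Suc n * (cmod z ^ (2 * n))" for z
        proof -
          have "cmod (of_real r * z) ^ (2 * n) = (r\<^sup>2) ^ n * cmod z ^ (2 * n)"
            using r(1) by (simp add: norm_mult power_mult_distrib flip: power_mult)
          then show ?thesis using r(1) by simp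
        qed
        then show ?thesis by presburger
      qed
      finally show ?thesis unfolding r(3) using r by (simp add: B_def)
    qed
    have un: "ball (0::complex) 1 = ball 0 r \<union> A" "ball 0 r \<inter> A = {}" using sub by (auto simp: A_def)
    have intA: "set_integrable lborel A (\<lambda>z. cmod (z::complex) ^ (2 * n))"
      by (rule set_integrable_subset[OF int[of 1]]) (auto simp: A_def)
    have fA: "emeasure lborel A < \<infinity>"
      using emeasure_mono[of A "ball 0 1" lborel] emeasure_lborel_ball_finite[of "0::complex" 1]
      by (auto simp: A_def intro: le_less_trans)
    have ind: "set_integrable lborel A (\<lambda>z. c :: real)" for c
      unfolding set_integrable_def using fA
      by (intro integrable_scaleR_left integrable_real_indicator) (auto simp: A_def)
    have cA: "(LINT z:A|lborel. c :: real) = c * (pi * (1 - s))" for c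
      using fA mA by (simp add: set_lebesgue_integral_def mult.commute)
    have "B = s ^ Suc n * B + (LINT z:A|lborel. cmod (z::complex) ^ (2 * n))"
      unfolding scale[symmetric] unfolding B_def
      by (subst un(1), rule set_integral_Un[OF un(2) int intA])
    moreover have "(LINT z:A|lborel. s ^ n) \<le> (LINT z:A|lborel. cmod (z::complex) ^ (2 * n))"
    proof (rule set_integral_mono[OF ind intA])
      fix z assume "z \<in> A"
      then have "s \<le> (cmod z)\<^sup>2" using r by (auto simp: A_def simp flip: r(3) intro!: power_mono)
      then show "s ^ n \<le> cmod z ^ (2 * n)" using s by (simp add: power_mult power_mono)
    qed
    moreover have "(LINT z:A|lborel. cmod (z::complex) ^ (2 * n)) \<le> (LINT z:A|lborel. 1)"
      by (rule set_integral_mono[OF intA ind]) (auto simp: A_def power_le_one)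
    ultimately have *: "s ^ n * (pi * (1 - s)) \<le> B * (1 - s ^ Suc n)" "B * (1 - s ^ Suc n) \<le> pi * (1 - s)"
      unfolding cA by (auto simp: algebra_simps)
    have g: "1 - s ^ Suc n = (1 - s) * (\<Sum>i<Suc n. s ^ i)"
      by (rule one_diff_power_eq)
    have "(1 - s) * (s ^ n * pi) \<le> (1 - s) * (B * (\<Sum>i<Suc n. s ^ i))"
         "(1 - s) * (B * (\<Sum>i<Suc n. s ^ i)) \<le> (1 - s) * pi"
      using * unfolding g by (simp_all only: mult_ac)
    then show ?thesis using s by (simp only: mult_le_cancel_left_pos diff_gt_0_iff_gt)
  qed
  have ev: "eventually (\<lambda>s::real. 0 < s \<and> s < 1) (at_left 1)"
    using eventually_at_left_real[of 0 1] by (auto elim: eventually_mono)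
  have "((\<lambda>s. s ^ n * pi) \<longlongrightarrow> 1 ^ n * pi) (at_left 1)"
    by (intro tendsto_intros)
  moreover have lim: "((\<lambda>s. B * (\<Sum>i<Suc n. s ^ i)) \<longlongrightarrow> B * (\<Sum>i<Suc n. 1 ^ i)) (at_left 1)"
    by (intro tendsto_intros)
  ultimately have "1 ^ n * pi \<le> B * (\<Sum>i<Suc n. 1 ^ i)"
    using upper by (intro tendsto_le[OF trivial_limit_at_left_real]) (auto intro: eventually_mono[OF ev])
  moreover have "B * (\<Sum>i<Suc n. 1 ^ i) \<le> pi"
    using upper by (intro tendsto_upperbound[OF lim _ trivial_limit_at_left_real]) (auto intro: eventually_mono[OF ev])
  ultimately have B: "B = pi / (real n + 1)"
    by (simp add: field_simps)
  have "disk_moment n n = (LINT z:ball 0 1|lborel. complex_of_real (cmod z ^ (2 * n)))"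
    unfolding disk_moment_def
    by (intro set_lebesgue_integral_cong)
       (auto simp: power_mult_distrib[symmetric] complex_mult_cnj cmod_power2 power_mult)
  also have "\<dots> = of_real B" unfolding B_def
    by (simp only: set_integral_complex_of_real)
  finally show ?thesis using B by simp
qed

section \<open>Jets of analytic functions\<close>

text \<open>Taylor coefficients instead of derivatives: products and compositions then follow the
  rules of formal power series, without binomial factors.\<close>

definition jet :: "(complex \<Rightarrow> complex) \<Rightarrow> complex \<Rightarrow> nat \<Rightarrow> complex" where
  "jet f w k = (deriv ^^ k) f w / fact k"

lemma jet_eq_fps: "jet f w k = fps_nth (fps_expansion f w) k"
  by (simp add: jet_def fps_expansion_def)

lemma higher_deriv_eq_jet: "(deriv ^^ k) f w = fact k * jet f w k"
  by (simp add: jet_def)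

lemma jet_0 [simp]: "jet f w 0 = f w"
  by (simp add: jet_def)

lemma jet_1: "jet f w (Suc 0) = deriv f w"
  by (simp add: jet_def)

lemma jet_deriv: "jet (deriv f) w k = of_nat (Suc k) * jet f w (Suc k)"
proof -
  have "(deriv ^^ k) (deriv f) w = (deriv ^^ Suc k) f w"
    by (simp only: funpow_Suc_right o_def)
  then show ?thesis by (simp add: jet_def fact_Suc del: of_nat_Suc)
qed

lemma jet_cong: "f analytic_on {w} \<Longrightarrow> eventually (\<lambda>z. f z = g z) (nhds w) \<Longrightarrow> jet f w k = jet g w k"
  unfolding jet_eq_fps by (subst fps_expansion_cong) auto

lemma jet_eqI:
  assumes "(\<lambda>x. f (w + x)) has_fps_expansion F"
  shows "jet f w k = fps_nth F k"
proof -
  have "f analytic_on {w}"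
    using has_fps_expansion_imp_analytic[OF assms] by simp
  then show ?thesis
    using fps_expansion_unique_complex[OF assms analytic_at_imp_has_fps_expansion] by (simp add: jet_eq_fps)
qed

lemma jet_mult:
  assumes "f analytic_on {w}" "g analytic_on {w}"
  shows "jet (\<lambda>z. f z * g z) w k = (\<Sum>i\<le>k. jet f w i * jet g w (k - i))"
proof -
  have "(\<lambda>x. f (w + x) * g (w + x)) has_fps_expansion fps_expansion f w * fps_expansion g w"
    using assms by (intro has_fps_expansion_mult analytic_at_imp_has_fps_expansion)
  from jet_eqI[OF this] show ?thesis
    by (simp add: fps_mult_nth jet_eq_fps atLeast0AtMost)
qed

text \<open>The coefficient of \<open>x^k\<close> in \<open>(\<phi> (w + x) - \<phi> w)^i\<close>,
  an entry of the Carleman matrix of \<open>\<phi>\<close> at \<open>w\<close>. The matrix is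
  triangular with the powers of \<open>\<phi>'(w)\<close> on the diagonal; this is what later
  preserves the top coefficients of principal parts.\<close>

definition comp_coeff :: "(complex \<Rightarrow> complex) \<Rightarrow> complex \<Rightarrow> nat \<Rightarrow> nat \<Rightarrow> complex" where
  "comp_coeff \<phi> w i k = fps_nth ((fps_expansion \<phi> w - fps_const (\<phi> w)) ^ i) k"

lemma comp_coeff_0: "comp_coeff \<phi> w 0 k = (if k = 0 then 1 else 0)"
  by (simp add: comp_coeff_def)

lemma comp_coeff_same: "comp_coeff \<phi> w i i = deriv \<phi> w ^ i"
  unfolding comp_coeff_def
  by (subst startsby_zero_power_nth_same) (simp_all add: fps_expansion_def)

lemma jet_comp:
  assumes "\<phi> analytic_on {w}" "h analytic_on {\<phi> w}"
  shows "jet (\<lambda>z. h (\<phi> z)) w k = (\<Sum>i\<le>k. jet h (\<phi> w) i * comp_coeff \<phi> w i k)"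
proof -
  have "(\<lambda>x. \<phi> (w + x) - \<phi> w) has_fps_expansion fps_expansion \<phi> w - fps_const (\<phi> w)"
    using assms by (intro has_fps_expansion_diff analytic_at_imp_has_fps_expansion) auto
  then have "((\<lambda>x. h (\<phi> w + x)) \<circ> (\<lambda>x. \<phi> (w + x) - \<phi> w)) has_fps_expansion
      (fps_expansion h (\<phi> w) oo (fps_expansion \<phi> w - fps_const (\<phi> w)))"
    using assms by (intro has_fps_expansion_compose analytic_at_imp_has_fps_expansion)
      (auto simp: fps_expansion_def)
  then have "(\<lambda>x. h (\<phi> (w + x))) has_fps_expansion
      (fps_expansion h (\<phi> w) oo (fps_expansion \<phi> w - fps_const (\<phi> w)))"
    by (simp add: o_def)
  from jet_eqI[OF this] show ?thesis
    by (simp add: fps_compose_nth jet_eq_fps comp_coeff_def atLeast0AtMost)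
qed

lemma jet_power_diff: "jet (\<lambda>z. (z - w) ^ j) w k = (if k = j then 1 else 0)"
proof -
  have "(\<lambda>x. (w + x - w) ^ j) has_fps_expansion fps_X ^ j"
    by (simp add: has_fps_expansion_fps_X_power)
  from jet_eqI[OF this] show ?thesis by (simp add: fps_X_power_nth)
qed

lemma analytic_on_cball_holomorphic:
  assumes "f analytic_on cball 0 (1::real)"
  obtains \<rho> where "\<rho> > 1" "f holomorphic_on ball (0::complex) \<rho>"
proof -
  obtain U where U: "open U" "cball 0 1 \<subseteq> U" "f holomorphic_on U"
    using assms analytic_on_holomorphic by blast
  obtain e where e: "e > 0" "(\<Union>x\<in>cball 0 1. ball x e) \<subseteq> U"
    using compact_subset_open_imp_ball_epsilon_subset[OF compact_cball U(1,2)] by metis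
  have "ball (0::complex) (1 + e) \<subseteq> (\<Union>x\<in>cball 0 1. ball x e)"
  proof
    fix z :: complex assume z: "z \<in> ball 0 (1 + e)"
    show "z \<in> (\<Union>x\<in>cball 0 1. ball x e)"
    proof (cases "cmod z \<le> 1")
      case False
      \<comment> \<open>The radial projection \<open>z / \<bar>z\<bar>\<close> is the nearest point
        of the closed disk.\<close>
      then have "dist (z / of_real (cmod z)) z < e"
      proof -
        have "z / of_real (cmod z) - z = (z / of_real (cmod z)) * of_real (1 - cmod z)"
          using False by (auto simp: right_diff_distrib)
        then have "dist (z / of_real (cmod z)) z = \<bar>1 - cmod z\<bar>"
          using False by (auto simp: dist_norm norm_mult norm_divide simp del: of_real_diff)
        then show ?thesis using z False by auto
      qed
      moreover have "z / of_real (cmod z) \<in> cball 0 1" using False by (auto simp: norm_divide)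
      ultimately show ?thesis by auto
    qed (use e in \<open>auto intro!: bexI[of _ z]\<close>)
  qed
  then have "f holomorphic_on ball 0 (1 + e)" using U(3) e(2) by (meson holomorphic_on_subset subset_trans)
  then show ?thesis using that[of "1 + e"] e by simp
qed

lemma holomorphic_ball_imp_analytic_cball:
  assumes "\<rho> > 1" "f holomorphic_on ball (0::complex) \<rho>"
  shows "f analytic_on cball 0 1"
  using assms analytic_on_open[of "ball 0 \<rho>" f] by (auto elim!: analytic_on_subset)

lemma analytic_on_cball_bounded:
  assumes "f analytic_on cball 0 (1::real)"
  obtains B where "B > 0" "\<And>z::complex. z \<in> cball 0 1 \<Longrightarrow> cmod (f z) \<le> B"
proof -
  have "compact (f ` cball 0 1)"
    by (intro compact_continuous_image holomorphic_on_imp_continuous_on analytic_imp_holomorphic assms) auto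
  then show ?thesis using that by (auto dest!: compact_imp_bounded simp: bounded_pos)
qed

text \<open>The Taylor series converges at some radius beyond \<open>1\<close>, hence absolutely at
  \<open>1\<close>, and the M-test applies on the closed disk.\<close>

lemma uniform_limit_taylor:
  assumes "f analytic_on cball 0 (1::real)"
  shows "uniform_limit (cball 0 1) (\<lambda>N z. \<Sum>n<N. jet f 0 n * z ^ n) f sequentially"
proof -
  obtain \<rho> where \<rho>: "\<rho> > 1" "f holomorphic_on ball (0::complex) \<rho>"
    using analytic_on_cball_holomorphic[OF assms] .
  have sums: "(\<lambda>n. jet f 0 n * z ^ n) sums f z" if "z \<in> ball 0 \<rho>" for z
    using holomorphic_power_series[OF \<rho>(2) that] by (simp add: jet_def)
  define r where "r = (1 + \<rho>) / 2"
  have r: "1 < r" "r < \<rho>" using \<rho> by (auto simp: r_def)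
  have "summable (\<lambda>n. jet f 0 n * of_real r ^ n)"
    using sums[of "of_real r"] r by (auto simp: sums_iff)
  then have sm: "summable (\<lambda>n. norm (jet f 0 n))"
    using powser_insidea[of "jet f 0" "of_real r" 1] r by simp
  have "uniform_limit (cball 0 1) (\<lambda>N z. \<Sum>n<N. jet f 0 n * z ^ n) (\<lambda>z. \<Sum>n. jet f 0 n * z ^ n) sequentially"
    by (rule Weierstrass_m_test[OF _ sm]) (auto simp: norm_mult norm_power mult_left_le power_le_one)
  then show ?thesis
    by (rule uniform_limit_cong'[THEN iffD1, rotated -1]) (use sums \<rho> in \<open>auto simp: sums_iff\<close>)
qed

section \<open>The area pairing on the disk\<close>

definition disk_pairing :: "(complex \<Rightarrow> complex) \<Rightarrow> (complex \<Rightarrow> complex) \<Rightarrow> complex" where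
  "disk_pairing H G = (LINT z:ball 0 1|lborel. H z * cnj (G z))"

lemma disk_pairing_integrable:
  assumes "H analytic_on cball 0 1" "G analytic_on cball 0 1"
  shows "set_integrable lborel (ball 0 1) (\<lambda>z. H z * cnj (G z))"
proof -
  obtain A where A: "A > 0" "\<And>z. z \<in> cball 0 1 \<Longrightarrow> cmod (H z) \<le> A"
    using analytic_on_cball_bounded[OF assms(1)] by blast
  obtain B where B: "B > 0" "\<And>z. z \<in> cball 0 1 \<Longrightarrow> cmod (G z) \<le> B"
    using analytic_on_cball_bounded[OF assms(2)] by blast
  show ?thesis
  proof (rule set_integrable_ball_continuous)
    show "continuous_on (ball 0 1) (\<lambda>z. H z * cnj (G z))"
      using assms[THEN analytic_imp_holomorphic, THEN holomorphic_on_imp_continuous_on]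
      by (intro continuous_intros) (auto elim: continuous_on_subset)
    show "cmod (H z * cnj (G z)) \<le> A * B" if "z \<in> ball 0 1" for z
      using A B that by (auto simp: norm_mult intro!: mult_mono less_imp_le[OF A(1)])
  qed
qed

lemma disk_pairing_cnj: "disk_pairing G H = cnj (disk_pairing H G)"
  unfolding disk_pairing_def set_lebesgue_integral_def
  by (rule trans[OF _ Bochner_Integration.integral_cnj]) (simp add: mult.commute)

lemma disk_pairing_diff_bound:
  assumes "H analytic_on cball 0 1" "K analytic_on cball 0 1" "G analytic_on cball 0 1"
    and "\<And>z. z \<in> ball 0 1 \<Longrightarrow> cmod (H z - K z) \<le> e" "\<And>z. z \<in> ball 0 1 \<Longrightarrow> cmod (G z) \<le> B" "0 \<le> e"
  shows "cmod (disk_pairing H G - disk_pairing K G) \<le> pi * (e * B)"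
proof -
  have "disk_pairing H G - disk_pairing K G = (LINT z:ball 0 1|lborel. H z * cnj (G z) - K z * cnj (G z))"
    unfolding disk_pairing_def by (rule set_integral_diff(2)[symmetric]; intro disk_pairing_integrable assms)
  also have "cmod \<dots> \<le> (LINT z:ball 0 1|lborel. cmod (H z * cnj (G z) - K z * cnj (G z)))"
    by (intro set_integral_norm_bound set_integral_diff disk_pairing_integrable assms)
  also have "\<dots> \<le> (LINT z:ball (0::complex) 1|lborel. e * B)"
  proof (rule set_integral_mono)
    show "set_integrable lborel (ball 0 1) (\<lambda>z. cmod (H z * cnj (G z) - K z * cnj (G z)))"
      by (intro set_integrable_norm set_integral_diff disk_pairing_integrable assms)
    show "set_integrable lborel (ball (0::complex) 1) (\<lambda>z. e * B)"
      unfolding set_integrable_def using emeasure_lborel_ball_finite[of "0::complex" 1]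
      by (intro integrable_scaleR_left integrable_real_indicator) auto
    show "cmod (H z * cnj (G z) - K z * cnj (G z)) \<le> e * B" if "z \<in> ball 0 1" for z
    proof -
      have "cmod (H z * cnj (G z) - K z * cnj (G z)) = cmod (H z - K z) * cmod (G z)"
        by (simp add: left_diff_distrib[symmetric] norm_mult)
      also have "\<dots> \<le> e * B" using assms(4)[OF that] assms(5)[OF that] assms(6) by (intro mult_mono) auto
      finally show ?thesis .
    qed
  qed
  also have "\<dots> = pi * (e * B)"
    using content_ball[of 1 "0::complex"] by (simp add: set_lebesgue_integral_def unit_ball_vol_2)
  finally show ?thesis .
qed

lemma disk_pairing_tendsto:
  assumes "\<And>N. H N analytic_on cball 0 1" "K analytic_on cball 0 1" "G analytic_on cball 0 1"
    and "uniform_limit (ball 0 1) H K sequentially"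
  shows "(\<lambda>N. disk_pairing (H N) G) \<longlonglongrightarrow> disk_pairing K G"
proof -
  obtain B where B: "B > 0" "\<And>z. z \<in> cball 0 1 \<Longrightarrow> cmod (G z) \<le> B"
    using analytic_on_cball_bounded[OF assms(3)] by blast
  show ?thesis
  proof (rule tendstoI)
    fix e :: real assume e: "e > 0"
    define d where "d = e / (2 * pi * B)"
    have d: "d > 0" using e B by (simp add: d_def)
    show "\<forall>\<^sub>F N in sequentially. dist (disk_pairing (H N) G) (disk_pairing K G) < e"
      using uniform_limitD[OF assms(4) d]
    proof eventually_elim
      case (elim N)
      have "cmod (disk_pairing (H N) G - disk_pairing K G) \<le> pi * (d * B)"
        by (rule disk_pairing_diff_bound) (use assms B d elim in \<open>auto simp: dist_norm less_imp_le\<close>)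
      also have "\<dots> = e / 2" using B by (simp add: d_def)
      also have "\<dots> < e" using e by simp
      finally show ?case by (simp add: dist_norm)
    qed
  qed
qed

lemma disk_pairing_sum_left:
  assumes "\<And>i. i \<in> I \<Longrightarrow> H i analytic_on cball 0 1" "G analytic_on cball 0 1"
  shows "disk_pairing (\<lambda>z. \<Sum>i\<in>I. c i * H i z) G = (\<Sum>i\<in>I. c i * disk_pairing (H i) G)"
proof -
  have "disk_pairing (\<lambda>z. \<Sum>i\<in>I. c i * H i z) G
      = (LINT z|lborel. (\<Sum>i\<in>I. c i * (indicator (ball 0 1) z *\<^sub>R (H i z * cnj (G z)))))"
    unfolding disk_pairing_def set_lebesgue_integral_def
    by (intro Bochner_Integration.integral_cong refl)
       (simp add: sum_distrib_left sum_distrib_right scaleR_sum_right mult_ac)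
  also have "\<dots> = (\<Sum>i\<in>I. c i * disk_pairing (H i) G)"
    unfolding disk_pairing_def set_lebesgue_integral_def
    using disk_pairing_integrable[OF assms(1) assms(2)]
    by (subst Bochner_Integration.integral_sum) (auto simp: set_integrable_def simp del: mult_scaleR_right)
  finally show ?thesis .
qed

text \<open>The pairing with \<open>z^m\<close> keeps a single term of each Taylor polynomial of
  degree at least \<open>m\<close>; uniform convergence carries this to the limit.\<close>

lemma disk_pairing_power_right:
  assumes g: "g analytic_on cball 0 1"
  shows "disk_pairing g (\<lambda>z. z ^ m) = of_real pi * jet g 0 m / of_nat (Suc m)"
proof -
  have eq: "disk_pairing (\<lambda>z. \<Sum>n<N. jet g 0 n * z ^ n) (\<lambda>z. z ^ m) = of_real pi * jet g 0 m / of_nat (Suc m)"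
    if "N > m" for N
  proof -
    have "disk_pairing (\<lambda>z. \<Sum>n<N. jet g 0 n * z ^ n) (\<lambda>z. z ^ m) = (\<Sum>n<N. jet g 0 n * disk_pairing (\<lambda>z. z ^ n) (\<lambda>z. z ^ m))"
      by (intro disk_pairing_sum_left analytic_intros)
    also have "\<dots> = (\<Sum>n<N. if n = m then jet g 0 m * of_real (pi / (real m + 1)) else 0)"
      by (intro sum.cong refl)
         (auto simp: disk_pairing_def disk_moment_diagonal disk_moment_off_diagonal simp flip: disk_moment_def)
    also have "\<dots> = of_real pi * jet g 0 m / of_nat (Suc m)" using that by (simp add: field_simps)
    finally show ?thesis .
  qed
  have "(\<lambda>N. disk_pairing (\<lambda>z. \<Sum>n<N. jet g 0 n * z ^ n) (\<lambda>z. z ^ m)) \<longlonglongrightarrow> disk_pairing g (\<lambda>z. z ^ m)"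
    using uniform_limit_taylor[OF g]
    by (intro disk_pairing_tendsto g analytic_intros) (auto elim: uniform_limit_on_subset)
  moreover have "(\<lambda>N. disk_pairing (\<lambda>z. \<Sum>n<N. jet g 0 n * z ^ n) (\<lambda>z. z ^ m)) \<longlonglongrightarrow> of_real pi * jet g 0 m / of_nat (Suc m)"
    by (rule tendsto_eventually) (use eq in \<open>auto simp: eventually_sequentially intro!: exI[of _ "Suc m"]\<close>)
  ultimately show ?thesis by (rule LIMSEQ_unique)
qed

lemma disk_pairing_power_left:
  assumes g: "g analytic_on cball 0 1"
  shows "disk_pairing (\<lambda>z. z ^ m) g = of_real pi * cnj (jet g 0 m) / of_nat (Suc m)"
  using disk_pairing_power_right[OF g, of m] by (subst disk_pairing_cnj) simp

text \<open>If \<open>e w k\<close> is the coefficient of \<open>(z - w)^-(k+1)\<close> in a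
  principal part, this is the sum over \<open>S\<close> of the residues of \<open>P\<close> times
  that principal part.\<close>

definition jet_functional :: "complex set \<Rightarrow> nat \<Rightarrow> (complex \<Rightarrow> nat \<Rightarrow> complex) \<Rightarrow> (complex \<Rightarrow> complex) \<Rightarrow> complex" where
  "jet_functional S N e P = (\<Sum>w\<in>S. \<Sum>k<N. e w k * jet P w k)"

lemma jet_sum:
  assumes "\<And>i. i \<in> I \<Longrightarrow> f i analytic_on {w}"
  shows "jet (\<lambda>z. \<Sum>i\<in>I. c i * f i z) w k = (\<Sum>i\<in>I. c i * jet (f i) w k)"
proof -
  have "(\<lambda>x. \<Sum>i\<in>I. c i * f i (w + x)) has_fps_expansion (\<Sum>i\<in>I. fps_const (c i) * fps_expansion (f i) w)"
    by (intro has_fps_expansion_sum has_fps_expansion_cmult_left analytic_at_imp_has_fps_expansion assms)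
  from jet_eqI[OF this] show ?thesis by (simp add: fps_sum_nth jet_eq_fps)
qed

lemma jet_functional_sum:
  assumes "S \<subseteq> ball 0 1" "\<And>i. i \<in> I \<Longrightarrow> f i analytic_on ball 0 1"
  shows "jet_functional S N e (\<lambda>z. \<Sum>i\<in>I. c i * f i z) = (\<Sum>i\<in>I. c i * jet_functional S N e (f i))"
proof -
  have "jet_functional S N e (\<lambda>z. \<Sum>i\<in>I. c i * f i z) = (\<Sum>w\<in>S. \<Sum>k<N. \<Sum>i\<in>I. c i * (e w k * jet (f i) w k))"
    unfolding jet_functional_def
  proof (intro sum.cong refl)
    fix w k assume w: "w \<in> S"
    have "jet (\<lambda>z. \<Sum>i\<in>I. c i * f i z) w k = (\<Sum>i\<in>I. c i * jet (f i) w k)"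
      using assms(1) w by (intro jet_sum analytic_on_subset[OF assms(2)]) auto
    then show "e w k * jet (\<lambda>z. \<Sum>i\<in>I. c i * f i z) w k = (\<Sum>i\<in>I. c i * (e w k * jet (f i) w k))"
      by (simp add: sum_distrib_left mult_ac)
  qed
  also have "\<dots> = (\<Sum>w\<in>S. \<Sum>i\<in>I. \<Sum>k<N. c i * (e w k * jet (f i) w k))"
    by (intro sum.cong refl sum.swap)
  also have "\<dots> = (\<Sum>i\<in>I. \<Sum>w\<in>S. \<Sum>k<N. c i * (e w k * jet (f i) w k))"
    by (rule sum.swap)
  also have "\<dots> = (\<Sum>i\<in>I. c i * jet_functional S N e (f i))"
    by (simp add: jet_functional_def sum_distrib_left)
  finally show ?thesis .
qed

lemma jet_functional_tendsto:
  assumes "S \<subseteq> ball 0 1" "\<And>n. P n holomorphic_on ball 0 1" "uniform_limit (ball 0 1) P Q sequentially"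
  shows "(\<lambda>n. jet_functional S N e (P n)) \<longlonglongrightarrow> jet_functional S N e Q"
  unfolding jet_functional_def jet_def
  using assms by (intro tendsto_sum tendsto_mult tendsto_const tendsto_divide higher_deriv_complex_uniform_limit[where A = "ball 0 1"]) auto

text \<open>Both sides are continuous in \<open>P\<close>, so it suffices to compare them on monomials.\<close>

lemma disk_pairing_eq_jet_functional:
  assumes g: "g analytic_on cball 0 1" and S: "S \<subseteq> ball 0 1"
    and mono: "\<And>m. jet_functional S N e (\<lambda>z. z ^ m) = (if m = 0 then 0 else cnj (jet g 0 (m - 1)))"
    and P: "P analytic_on cball 0 1"
  shows "disk_pairing (deriv P) g = of_real pi * jet_functional S N e P"
proof -
  \<comment> \<open>\<open>PN\<close> has one term more than \<open>DN\<close>, so that the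
    derivative of \<open>PN M\<close> is \<open>DN M\<close>.\<close>
  define PN where "PN = (\<lambda>M z. \<Sum>m<Suc M. jet P 0 m * z ^ m)"
  define DN where "DN = (\<lambda>M z. \<Sum>m<M. jet (deriv P) 0 m * z ^ m)"
  have P': "deriv P analytic_on cball 0 1" by (rule analytic_deriv[OF P])
  have lP: "(\<lambda>M. jet_functional S N e (PN M)) \<longlonglongrightarrow> jet_functional S N e P"
  proof (rule jet_functional_tendsto[OF S])
    show "uniform_limit (ball 0 1) PN P sequentially"
    proof -
      have "uniform_limit (ball 0 1) (\<lambda>M z. \<Sum>m<M. jet P 0 m * z ^ m) P sequentially"
        using uniform_limit_taylor[OF P] by (rule uniform_limit_on_subset) auto
      then show ?thesis unfolding PN_def
        by (rule filterlim_compose[OF _ filterlim_Suc])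
    qed
  qed (auto simp: PN_def intro!: holomorphic_intros)
  have lD: "(\<lambda>M. disk_pairing (DN M) g) \<longlonglongrightarrow> disk_pairing (deriv P) g"
    unfolding DN_def using uniform_limit_taylor[OF P']
    by (intro disk_pairing_tendsto g P' analytic_intros) (auto elim: uniform_limit_on_subset)
  have "disk_pairing (DN M) g = of_real pi * jet_functional S N e (PN M)" for M
  proof -
    have "jet_functional S N e (PN M) = (\<Sum>m<Suc M. jet P 0 m * jet_functional S N e (\<lambda>z. z ^ m))"
      unfolding PN_def by (intro jet_functional_sum S analytic_intros)
    also have "\<dots> = (\<Sum>m<M. jet P 0 (Suc m) * cnj (jet g 0 m))"
      by (subst sum.lessThan_Suc_shift) (simp only: mono, simp)
    finally have 1: "jet_functional S N e (PN M) = (\<Sum>m<M. jet P 0 (Suc m) * cnj (jet g 0 m))" .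
    have "disk_pairing (DN M) g = (\<Sum>m<M. jet (deriv P) 0 m * disk_pairing (\<lambda>z. z ^ m) g)"
      unfolding DN_def by (intro disk_pairing_sum_left g analytic_intros)
    also have "\<dots> = (\<Sum>m<M. of_real pi * (jet P 0 (Suc m) * cnj (jet g 0 m)))"
      by (intro sum.cong refl) (simp add: disk_pairing_power_left[OF g] jet_deriv del: of_nat_Suc)
    finally show ?thesis unfolding 1 by (simp add: sum_distrib_left)
  qed
  then have "(\<lambda>M. disk_pairing (DN M) g) \<longlonglongrightarrow> of_real pi * jet_functional S N e P"
    using tendsto_mult[OF tendsto_const lP] by simp
  then show ?thesis using lD LIMSEQ_unique by blast
qed

section \<open>Principal parts of the reflected derivative\<close>

text \<open>At a root \<open>w\<close> of order \<open>m\<close> of the denominator, subtracting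
  \<open>c / (z - w)^m\<close> with a suitable \<open>c\<close> cancels one factor
  \<open>z - w\<close>. \<open>S\<close> and \<open>N\<close> merely bound the roots and the degree,
  so they stay the same throughout the induction.\<close>

lemma partial_fractions_aux:
  fixes P Q :: "complex poly"
  assumes "finite S" "Q \<noteq> 0" "\<And>z. poly Q z = 0 \<Longrightarrow> z \<in> S" "degree Q \<le> N"
  shows "\<exists>A e. \<forall>z. z \<notin> S \<longrightarrow> poly P z / poly Q z = poly A z + (\<Sum>w\<in>S. \<Sum>k<N. e w k / (z - w) ^ Suc k)"
  using assms(2-)
proof (induction "degree Q" arbitrary: P Q)
  case 0
  then obtain c where c: "Q = [:c:]" "c \<noteq> 0" by (metis degree_eq_zeroE pCons_0_0)
  show ?case
    by (rule exI[of _ "smult (1 / c) P"], rule exI[of _ "\<lambda>_ _. 0"]) (simp add: c)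
next
  case (Suc n)
  obtain w where w: "poly Q w = 0"
    using fundamental_theorem_of_algebra[of Q] Suc.hyps(2) constant_degree[of Q] by auto
  define m where "m = order w Q"
  have m: "m > 0" using w Suc.prems order_root by (auto simp: m_def)
  obtain Q2 where Q2: "Q = [:- w, 1:] ^ m * Q2" "\<not> [:- w, 1:] dvd Q2"
    using order_decomp[OF Suc.prems(1), of w] by (auto simp: m_def)
  have Q2w: "poly Q2 w \<noteq> 0" using Q2(2) by (simp add: poly_eq_0_iff_dvd)
  \<comment> \<open>With this \<open>c\<close> the numerator of
    \<open>P / Q - c / (z - w)^m\<close>, which is \<open>P - c Q2\<close> over \<open>Q\<close>,
    vanishes at \<open>w\<close>.\<close>
  define c where "c = poly P w / poly Q2 w"
  have "poly (P - smult c Q2) w = 0" using Q2w by (simp add: c_def)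
  then obtain P1 where P1: "P - smult c Q2 = [:- w, 1:] * P1"
    by (metis poly_eq_0_iff_dvd dvdE)
  define Q' where "Q' = [:- w, 1:] ^ (m - 1) * Q2"
  have QQ': "Q = [:- w, 1:] * Q'" using m by (cases m) (auto simp: Q2(1) Q'_def mult_ac)
  have Q'0: "Q' \<noteq> 0" using Suc.prems(1) QQ' by auto
  then have deg: "degree Q = Suc (degree Q')" unfolding QQ' by (subst degree_mult_eq) auto
  have roots: "z \<in> S" if "poly Q' z = 0" for z using Suc.prems(2)[of z] that QQ' by simp
  obtain A e where Ae: "\<And>z. z \<notin> S \<Longrightarrow> poly P1 z / poly Q' z = poly A z + (\<Sum>w\<in>S. \<Sum>k<N. e w k / (z - w) ^ Suc k)"
    using Suc.hyps(1)[of Q' P1] deg Suc.hyps(2) Q'0 roots Suc.prems(3) by auto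
  have wS: "w \<in> S" using Suc.prems(2) w by blast
  have mN: "m - 1 < N"
    using order_degree[OF Suc.prems(1), of w] Suc.prems(3) m by (auto simp: m_def)
  define e' where "e' = (\<lambda>v k. e v k + (if v = w \<and> k = m - 1 then c else 0))"
  have "poly P z / poly Q z = poly A z + (\<Sum>w\<in>S. \<Sum>k<N. e' w k / (z - w) ^ Suc k)" if z: "z \<notin> S" for z
  proof -
    have zw: "z - w \<noteq> 0" using z wS by auto
    have Q'z: "poly Q' z \<noteq> 0" using roots z by blast
    have Pz: "poly P z = c * poly Q2 z + (z - w) * poly P1 z"
      using arg_cong[OF P1, of "\<lambda>p. poly p z"] by (simp add: algebra_simps)
    have Q'2: "poly Q' z = (z - w) ^ (m - 1) * poly Q2 z" by (simp add: Q'_def poly_power)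
    have "poly P z / poly Q z = c * poly Q2 z / ((z - w) * poly Q' z) + poly P1 z / poly Q' z"
      using zw Q'z unfolding Pz QQ' by (simp add: field_simps)
    also have "c * poly Q2 z / ((z - w) * poly Q' z) = c / (z - w) ^ Suc (m - 1)"
      using zw Q'z unfolding Q'2 by (simp add: field_simps)
    also have "c / (z - w) ^ Suc (m - 1) = (\<Sum>v\<in>S. \<Sum>k<N. (if v = w \<and> k = m - 1 then c else 0) / (z - v) ^ Suc k)"
    proof -
      have "(\<Sum>v\<in>S. \<Sum>k<N. (if v = w \<and> k = m - 1 then c else 0) / (z - v) ^ Suc k)
          = (\<Sum>k<N. (if k = m - 1 then c else 0) / (z - w) ^ Suc k)"
        using wS assms(1) by (simp add: sum.remove[of S w] del: power_Suc)
      also have "\<dots> = c / (z - w) ^ Suc (m - 1)"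
        using mN by (simp add: sum.remove[of "{..<N}" "m - 1"] del: power_Suc)
      finally show ?thesis ..
    qed
    finally show ?thesis unfolding Ae[OF z] e'_def
      by (simp add: sum.distrib add_divide_distrib)
  qed
  then show ?case by blast
qed

text \<open>The coefficients describe the principal parts of \<open>- (f\<^sup>*)'\<close>, so that \<open>e w 0\<close> belongs to a
  logarithmic pole of \<open>f\<^sup>*\<close>.\<close>

definition star_expansion :: "(complex \<Rightarrow> complex) \<Rightarrow> complex set \<Rightarrow> nat \<Rightarrow> (complex \<Rightarrow> nat \<Rightarrow> complex) \<Rightarrow> bool" where
  "star_expansion R S N e \<longleftrightarrow> finite S \<and> S \<subseteq> ball 0 1 \<and> 0 \<in> S \<and>
     (\<forall>w k. w \<notin> S \<or> N \<le> k \<longrightarrow> e w k = 0) \<and>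
     (\<exists>A. \<forall>z. z \<notin> S \<longrightarrow> deriv_star R z = poly A z - (\<Sum>w\<in>S. \<Sum>k<N. e w k / (z - w) ^ Suc k))"

lemma star_expansion_exists:
  assumes "rational_extension g R"
  shows "\<exists>S N e. star_expansion R S N e"
proof -
  obtain P Q :: "complex poly" where R: "\<And>z. R z = poly P z / poly Q z"
      and Q: "\<And>z. z \<in> cball 0 1 \<Longrightarrow> poly Q z \<noteq> 0"
    using assms unfolding rational_extension_def by blast
  define P' where "P' = reflect_poly (map_poly cnj P)"
  define Q' where "Q' = reflect_poly (map_poly cnj Q)"
  \<comment> \<open>Reversing the conjugated polynomials gives \<open>P' = z^(degree P)\<close>
    times the reflection of \<open>P\<close>, and likewise for \<open>Q\<close>. Clearing these
    powers in \<open>- star_fun R z / z^2\<close> puts \<open>z^(degree Q)\<close> into the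
    numerator and \<open>z^(degree P + 2)\<close> into the denominator.\<close>
  define num where "num = - monom 1 (degree Q) * P'"
  define den where "den = monom 1 (degree P + 2) * Q'"
  have Q0: "Q \<noteq> 0" using Q[of 0] by auto
  have cQ: "map_poly cnj Q \<noteq> 0" using Q0 by (auto simp: poly_eq_iff coeff_map_poly)
  then have den0: "den \<noteq> 0" by (auto simp: den_def Q'_def)
  have P'z: "poly P' z = z ^ degree P * cnj (poly P (1 / cnj z))" if "z \<noteq> 0" for z
  proof -
    have "degree (map_poly cnj P) = degree P" by (rule degree_map_poly) simp
    then have "poly P' z = z ^ degree P * poly (map_poly cnj P) (inverse z)"
      using that by (simp only: P'_def poly_reflect_poly_nz not_False_eq_True)
    moreover have "cnj (1 / cnj z) = inverse z" by (simp add: field_simps)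
    ultimately show ?thesis using poly_cnj[of P "1 / cnj z"] by metis
  qed
  have Q'z: "poly Q' z = z ^ degree Q * cnj (poly Q (1 / cnj z))" if "z \<noteq> 0" for z
  proof -
    have "degree (map_poly cnj Q) = degree Q" by (rule degree_map_poly) simp
    then have "poly Q' z = z ^ degree Q * poly (map_poly cnj Q) (inverse z)"
      using that by (simp only: Q'_def poly_reflect_poly_nz not_False_eq_True)
    moreover have "cnj (1 / cnj z) = inverse z" by (simp add: field_simps)
    ultimately show ?thesis using poly_cnj[of Q "1 / cnj z"] by metis
  qed
  define S where "S = {z. poly den z = 0}"
  have finS: "finite S" unfolding S_def by (rule poly_roots_finite[OF den0])
  have S0: "0 \<in> S" by (simp add: S_def den_def poly_monom)
  \<comment> \<open>Apart from \<open>0\<close>, the roots of \<open>den\<close> are reflections of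
    roots of \<open>Q\<close>, and those lie outside the closed disk.\<close>
  have Sball: "S \<subseteq> ball 0 1"
  proof
    fix z assume z: "z \<in> S"
    show "z \<in> ball 0 1"
    proof (cases "z = 0")
      case False
      then have "poly Q (1 / cnj z) = 0" using z Q'z[OF False] by (simp add: S_def den_def poly_monom)
      then have "1 / cnj z \<notin> cball 0 1" using Q by blast
      then show ?thesis using False by (simp add: norm_divide field_simps)
    qed simp
  qed
  obtain A e where Ae: "\<And>z. z \<notin> S \<Longrightarrow> poly num z / poly den z
      = poly A z + (\<Sum>w\<in>S. \<Sum>k<degree den. e w k / (z - w) ^ Suc k)"
    using partial_fractions_aux[OF finS den0 _ order_refl, of num] unfolding S_def by blast
  \<comment> \<open>The sign passes to the negative of the reflected derivative; the default
    \<open>0\<close> provides the vanishing outside \<open>S\<close> and from the index bound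
    on.\<close>
  define e' where "e' = (\<lambda>w k. if w \<in> S \<and> k < degree den then - e w k else 0)"
  have "deriv_star R z = poly A z - (\<Sum>w\<in>S. \<Sum>k<degree den. e' w k / (z - w) ^ Suc k)" if z: "z \<notin> S" for z
  proof -
    have z0: "z \<noteq> 0" using z S0 by auto
    have "deriv_star R z = poly num z / poly den z"
    proof -
      let ?p = "cnj (poly P (1 / cnj z))" and ?q = "cnj (poly Q (1 / cnj z))"
      let ?a = "z ^ degree Q * z ^ degree P"
      have "poly num z / poly den z = (?a * (- ?p)) / (?a * (z\<^sup>2 * ?q))"
        by (simp add: num_def den_def poly_monom P'z[OF z0] Q'z[OF z0] power_add mult_ac power2_eq_square)
      also have "\<dots> = (- ?p) / (z\<^sup>2 * ?q)"
        using z0 by (intro mult_divide_mult_cancel_left) simp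
      also have "\<dots> = deriv_star R z"
        by (simp add: deriv_star_def star_fun_def R mult.commute)
      finally show ?thesis ..
    qed
    also have "\<dots> = poly A z + (\<Sum>w\<in>S. \<Sum>k<degree den. e w k / (z - w) ^ Suc k)" by (rule Ae[OF z])
    also have "(\<Sum>w\<in>S. \<Sum>k<degree den. e w k / (z - w) ^ Suc k) = - (\<Sum>w\<in>S. \<Sum>k<degree den. e' w k / (z - w) ^ Suc k)"
      unfolding sum_negf[symmetric] by (intro sum.cong refl) (simp add: e'_def)
    finally show ?thesis by simp
  qed
  then have "star_expansion R S (degree den) e'"
    unfolding star_expansion_def using finS Sball S0 by (auto simp: e'_def)
  then show ?thesis by blast
qed

text \<open>On the unit circle \<open>1 / cnj z = z\<close>, so the integral of \<open>z\<^sup>m (f\<^sup>*)'\<close> is conjugate to a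
  Cauchy integral of \<open>g\<close>.\<close>

lemma star_expansion_moment:
  assumes g: "g analytic_on cball 0 1" and ext: "rational_extension g R" and se: "star_expansion R S N e"
  shows "jet_functional S N e (\<lambda>z. z ^ m) = (if m = 0 then 0 else cnj (jet g 0 (m - 1)))"
proof -
  obtain A where S: "finite S" "S \<subseteq> ball 0 1" "0 \<in> S" and
    A: "\<And>z. z \<notin> S \<Longrightarrow> deriv_star R z = poly A z - (\<Sum>w\<in>S. \<Sum>k<N. e w k / (z - w) ^ Suc k)"
    using se unfolding star_expansion_def by blast
  let ?c = "circlepath 0 1"
  have holo: "g holomorphic_on cball 0 1" using g analytic_imp_holomorphic by blast
  have gR: "g z = R z" if "z \<in> cball 0 1" for z using ext that unfolding rational_extension_def by blast
  have D: "deriv_star R z = - cnj (g z) / z\<^sup>2" if "cmod z = 1" for z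
  proof -
    have "z * cnj z = 1" using that by (simp add: complex_norm_square[symmetric])
    then have "1 / cnj z = z" by (cases "z = 0") (simp_all add: divide_eq_eq)
    then show ?thesis using gR[of z] that by (simp add: deriv_star_def star_fun_def)
  qed
  \<comment> \<open>The circle integral of \<open>g / z^m\<close>: zero by Cauchy's theorem for
    \<open>m = 0\<close>, and otherwise Cauchy's formula for the derivative of order
    \<open>m - 1\<close>.\<close>
  define V where "V = (if m = 0 then 0 else 2 * of_real pi * \<i> * jet g 0 (m - 1))"
  have I1: "((\<lambda>z. g z / z ^ m) has_contour_integral V) ?c"
  proof (cases m)
    case 0
    have "(g has_contour_integral 0) ?c"
      by (rule Cauchy_theorem_convex_simple[where S = "cball 0 1"]) (use holo in auto)
    then show ?thesis using 0 by (simp add: V_def)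
  next
    case (Suc n)
    show ?thesis
      using Cauchy_has_contour_integral_higher_derivative_circlepath[of 0 1 g 0 n] holo
        holomorphic_on_imp_continuous_on[OF holo] holomorphic_on_subset[OF holo, of "ball 0 1"]
      by (simp add: Suc V_def jet_def)
  qed
  have I2: "((\<lambda>z. z ^ m * deriv_star R z) has_contour_integral cnj V) ?c"
  proof -
    let ?f1 = "\<lambda>t. g (?c t) / (?c t) ^ m * vector_derivative ?c (at t within {0..1})"
    let ?f2 = "\<lambda>t. (?c t) ^ m * deriv_star R (?c t) * vector_derivative ?c (at t within {0..1})"
    have "(?f1 has_integral V) {0..1}" using I1 by (simp add: has_contour_integral_def)
    then have "(cnj \<circ> ?f1 has_integral cnj V) {0..1}" by (simp add: has_integral_cnj)
    moreover have "(cnj \<circ> ?f1) t = ?f2 t" if t: "t \<in> {0..1}" for t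
    proof -
      define u where "u = exp (2 * of_real pi * \<i> * of_real t)"
      have u1: "cmod u = 1" by (simp add: u_def)
      have u0: "u \<noteq> 0" by (simp add: u_def)
      have cu: "cnj u = 1 / u" using u1 u0 by (simp add: field_simps complex_norm_square[symmetric] mult.commute)
      have ct: "?c t = u" by (simp add: circlepath_def part_circlepath_def linepath_def u_def field_simps)
      have vd: "vector_derivative ?c (at t within {0..1}) = 2 * of_real pi * \<i> * u"
        using t by (simp add: vector_derivative_circlepath01 u_def)
      show ?thesis unfolding o_def ct vd D[OF u1] using u0 by (simp add: cu field_simps power2_eq_square)
    qed
    ultimately have "(?f2 has_integral cnj V) {0..1}"
      by (rule has_integral_eq[rotated]) auto
    then show ?thesis by (simp add: has_contour_integral_def)
  qed
  have I3: "((\<lambda>z. z ^ m * deriv_star R z) has_contour_integral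
      (0 - (\<Sum>w\<in>S. \<Sum>k<N. e w k * (2 * of_real pi * \<i> * jet (\<lambda>z. z ^ m) w k)))) ?c"
  proof -
    have a: "((\<lambda>z. z ^ m * poly A z) has_contour_integral 0) ?c"
      by (rule Cauchy_theorem_convex_simple[where S = UNIV]) (auto intro!: holomorphic_intros)
    have b: "((\<lambda>z. e w k * (z ^ m / (z - w) ^ Suc k)) has_contour_integral (e w k * (2 * of_real pi * \<i> * jet (\<lambda>z. z ^ m) w k))) ?c"
      if "w \<in> S" for w k
    proof (rule has_contour_integral_lmul)
      have "w \<in> ball 0 1" using that S by blast
      then show "((\<lambda>z. z ^ m / (z - w) ^ Suc k) has_contour_integral (2 * of_real pi * \<i> * jet (\<lambda>z. z ^ m) w k)) ?c"
        using Cauchy_has_contour_integral_higher_derivative_circlepath[of 0 1 "\<lambda>z. z ^ m" w k]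
        by (simp add: jet_def continuous_intros holomorphic_intros)
    qed
    have "((\<lambda>z. z ^ m * poly A z - (\<Sum>w\<in>S. \<Sum>k<N. e w k * (z ^ m / (z - w) ^ Suc k))) has_contour_integral
      (0 - (\<Sum>w\<in>S. \<Sum>k<N. e w k * (2 * of_real pi * \<i> * jet (\<lambda>z. z ^ m) w k)))) ?c"
      by (intro has_contour_integral_diff a has_contour_integral_sum b S) auto
    then show ?thesis
    proof (rule has_contour_integral_eq)
      fix z assume "z \<in> path_image ?c"
      then have "z \<notin> S" using S by auto
      then show "z ^ m * poly A z - (\<Sum>w\<in>S. \<Sum>k<N. e w k * (z ^ m / (z - w) ^ Suc k)) = z ^ m * deriv_star R z"
        by (simp add: A right_diff_distrib sum_distrib_left mult_ac)
    qed
  qed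
  have "cnj V = 0 - (\<Sum>w\<in>S. \<Sum>k<N. e w k * (2 * of_real pi * \<i> * jet (\<lambda>z. z ^ m) w k))"
    using I2 I3 has_contour_integral_unique by blast
  also have "\<dots> = - (2 * of_real pi * \<i>) * jet_functional S N e (\<lambda>z. z ^ m)"
    by (simp add: jet_functional_def sum_distrib_left sum_negf mult_ac)
  finally have "- (2 * of_real pi * \<i>) * jet_functional S N e (\<lambda>z. z ^ m) = cnj V" by simp
  also have "cnj V = - (2 * of_real pi * \<i>) * (if m = 0 then 0 else cnj (jet g 0 (m - 1)))"
    by (simp add: V_def)
  finally show ?thesis by simp
qed

lemma star_expansion_pairing:
  assumes "g analytic_on cball 0 1" "rational_extension g R" "star_expansion R S N e" "P analytic_on cball 0 1"
  shows "disk_pairing (deriv P) g = of_real pi * jet_functional S N e P"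
  using assms star_expansion_moment[OF assms(1-3)]
  by (intro disk_pairing_eq_jet_functional) (auto simp: star_expansion_def)

text \<open>This is the moment with \<open>m = 0\<close>: up to conjugation and sign the sum is the
  circle integral of \<open>g\<close>, divided by \<open>2 \<pi> i\<close>. It makes the functional
  blind to the additive constant of a primitive.\<close>

lemma star_expansion_residues_sum:
  assumes "g analytic_on cball 0 1" "rational_extension g R" "star_expansion R S N e"
  shows "(\<Sum>w\<in>S. e w 0) = 0"
proof (cases N)
  case 0
  then have "e w 0 = 0" for w using assms(3) by (simp add: star_expansion_def)
  then show ?thesis by simp
next
  case (Suc N')
  have one: "jet (\<lambda>z. z ^ 0) w k = (if k = 0 then 1 else 0)" for w k
    using jet_power_diff[of w 0 k] by simp
  have "(\<Sum>w\<in>S. e w 0) = jet_functional S N e (\<lambda>z. z ^ 0)"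
    unfolding jet_functional_def one using Suc by (intro sum.cong refl) (simp add: if_distrib cong: if_cong)
  then show ?thesis using star_expansion_moment[OF assms, of 0] by simp
qed

lemma star_expansion_local:
  assumes se: "star_expansion R S N e" and w: "w \<in> ball 0 1"
  obtains r a where "r > 0" "ball w r \<subseteq> ball 0 1" "a holomorphic_on ball w r"
    "\<And>z. z \<in> ball w r - {w} \<Longrightarrow> deriv_star R z = a z - (\<Sum>k<N. e w k / (z - w) ^ Suc k)"
proof -
  obtain A where S: "finite S" "S \<subseteq> ball 0 1" "0 \<in> S" and e0: "\<And>w k. w \<notin> S \<Longrightarrow> e w k = 0" and
    A: "\<And>z. z \<notin> S \<Longrightarrow> deriv_star R z = poly A z - (\<Sum>w\<in>S. \<Sum>k<N. e w k / (z - w) ^ Suc k)"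
    using se unfolding star_expansion_def by blast
  have "open (ball 0 1 - (S - {w}))" using S by (intro open_Diff finite_imp_closed) auto
  then obtain r where r: "r > 0" "ball w r \<subseteq> ball 0 1 - (S - {w})"
    using w open_contains_ball_eq by blast
  define a where "a = (\<lambda>z. poly A z - (\<Sum>v\<in>S - {w}. \<Sum>k<N. e v k / (z - v) ^ Suc k))"
  have "deriv_star R z = a z - (\<Sum>k<N. e w k / (z - w) ^ Suc k)" if z: "z \<in> ball w r - {w}" for z
  proof -
    have zS: "z \<notin> S" using z r by auto
    have "(\<Sum>v\<in>S. \<Sum>k<N. e v k / (z - v) ^ Suc k)
        = (\<Sum>k<N. e w k / (z - w) ^ Suc k) + (\<Sum>v\<in>S - {w}. \<Sum>k<N. e v k / (z - v) ^ Suc k)"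
    proof (cases "w \<in> S")
      case True then show ?thesis using S by (simp add: sum.remove)
    next
      case False then show ?thesis using e0 by simp
    qed
    then show ?thesis using A[OF zS] by (simp add: a_def)
  qed
  moreover have "a holomorphic_on ball w r"
    unfolding a_def using r by (intro holomorphic_intros) auto
  ultimately show ?thesis using that r by blast
qed

lemma jet_diff:
  assumes "f analytic_on {w}" "g analytic_on {w}"
  shows "jet (\<lambda>z. f z - g z) w k = jet f w k - jet g w k"
proof -
  have "(\<lambda>x. f (w + x) - g (w + x)) has_fps_expansion fps_expansion f w - fps_expansion g w"
    using assms by (intro has_fps_expansion_diff analytic_at_imp_has_fps_expansion)
  from jet_eqI[OF this] show ?thesis by (simp add: jet_eq_fps)
qed

lemma holomorphic_ball_analytic_at: "f holomorphic_on ball w r \<Longrightarrow> r > 0 \<Longrightarrow> f analytic_on {w}"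
  using analytic_at[of f w] by (metis centre_in_ball open_ball)

lemma eventually_at_ball_punctured: "r > 0 \<Longrightarrow> \<forall>\<^sub>F z in at (w::complex). z \<in> ball w r - {w}"
  by (rule eventually_at_in_open) auto

lemma star_expansion_eq_0: "star_expansion R S N e \<Longrightarrow> N \<le> k \<Longrightarrow> e w k = 0"
  unfolding star_expansion_def by blast

lemma star_expansion_residue:
  assumes se: "star_expansion R S N e" and w: "w \<in> ball 0 1"
  shows "residue (deriv_star R) w = - e w 0"
proof -
  obtain r a where r: "r > 0" "a holomorphic_on ball w r"
    and D: "\<And>z. z \<in> ball w r - {w} \<Longrightarrow> deriv_star R z = a z - (\<Sum>k<N. e w k / (z - w) ^ Suc k)"
    using star_expansion_local[OF se w] by metis
  \<comment> \<open>Clearing denominators with exponent \<open>Suc N\<close> makes the residue the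
    Taylor coefficient of \<open>f\<close> of index \<open>N\<close>, also in the case
    \<open>N = 0\<close>.\<close>
  define f where "f = (\<lambda>z. (z - w) ^ Suc N * a z - (\<Sum>k<N. e w k * (z - w) ^ (N - k)))"
  have "residue (deriv_star R) w = residue (\<lambda>z. f z / (z - w) ^ Suc N) w"
  proof (rule residue_cong[OF _ refl])
    show "\<forall>\<^sub>F z in at w. deriv_star R z = f z / (z - w) ^ Suc N"
      using eventually_at_ball_punctured[OF r(1), of w]
    proof eventually_elim
      case (elim z)
      then have zw: "z - w \<noteq> 0" by auto
      have "(\<Sum>k<N. e w k / (z - w) ^ Suc k) = (\<Sum>k<N. e w k * (z - w) ^ (N - k)) / (z - w) ^ Suc N"
        unfolding sum_divide_distrib
      proof (intro sum.cong refl)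
        fix k assume "k \<in> {..<N}"
        then have "(z - w) ^ Suc N = (z - w) ^ (N - k) * (z - w) ^ Suc k"
          by (simp flip: power_add)
        then show "e w k / (z - w) ^ Suc k = e w k * (z - w) ^ (N - k) / (z - w) ^ Suc N"
          using zw by simp
      qed
      then show ?case unfolding D[OF elim] f_def diff_divide_distrib using zw by simp
    qed
  qed
  also have "\<dots> = jet f w N"
    unfolding jet_def
    by (rule residue_holomorphic_over_power[of "ball w r"])
       (use r in \<open>auto simp: f_def intro!: holomorphic_intros\<close>)
  also have "\<dots> = - (\<Sum>k<N. e w k * (if N = N - k then 1 else 0))"
  proof -
    have an: "a analytic_on {w}" using holomorphic_ball_analytic_at r by blast
    have "jet f w N = jet (\<lambda>z. (z - w) ^ Suc N * a z) w N - jet (\<lambda>z. \<Sum>k<N. e w k * (z - w) ^ (N - k)) w N"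
      unfolding f_def by (intro jet_diff analytic_intros an)
    also have "jet (\<lambda>z. (z - w) ^ Suc N * a z) w N = 0"
      by (subst jet_mult) (auto intro!: analytic_intros an simp: jet_power_diff simp del: power_Suc)
    also have "jet (\<lambda>z. \<Sum>k<N. e w k * (z - w) ^ (N - k)) w N = (\<Sum>k<N. e w k * (if N = N - k then 1 else 0))"
      by (subst jet_sum) (auto intro!: analytic_intros simp: jet_power_diff)
    finally show ?thesis by simp
  qed
  also have "(\<Sum>k<N. e w k * (if N = N - k then 1 else 0)) = (\<Sum>k<N. if k = 0 then e w 0 else 0)"
    by (intro sum.cong) auto
  also have "\<dots> = e w 0" using se by (auto simp: star_expansion_def)
  finally show ?thesis .
qed

lemma log_poles_star_eq:
  assumes "star_expansion R S N e"
  shows "log_poles_star R = {w. e w 0 \<noteq> 0}"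
proof -
  have "w \<in> ball 0 1" if "e w 0 \<noteq> 0" for w
    using assms that unfolding star_expansion_def by blast
  then show ?thesis
    using star_expansion_residue[OF assms] unfolding log_poles_star_def by auto
qed

section \<open>Orders of zeros and poles, and their reflection\<close>

definition has_zero_order :: "(complex \<Rightarrow> complex) \<Rightarrow> complex \<Rightarrow> nat \<Rightarrow> bool" where
  "has_zero_order g w m \<longleftrightarrow> (\<exists>r u. r > 0 \<and> u holomorphic_on ball w r \<and> u w \<noteq> 0 \<and>
     (\<forall>z\<in>ball w r. g z = (z - w) ^ m * u z))"

text \<open>Integrating a principal part lowers every exponent by one: without the logarithm the
  singular terms are multiples of \<open>e w k / (z - w)^k\<close> with \<open>k \<ge> 1\<close>.
  The zero of order \<open>m\<close> of \<open>g\<close> absorbs those with \<open>k \<le> m\<close>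
  and leaves a pole for the others.\<close>

lemma ordinary_pole_iff:
  assumes ext: "rational_extension g R" and se: "star_expansion R S N e"
    and w: "w \<in> ball 0 1" and m: "has_zero_order g w m"
  shows "w \<in> ordinary_poles_star R \<longleftrightarrow> (\<exists>k>m. e w k \<noteq> 0)"
proof -
  obtain r1 a where r1: "r1 > 0" "ball w r1 \<subseteq> ball 0 1" "a holomorphic_on ball w r1"
    and D: "\<And>z. z \<in> ball w r1 - {w} \<Longrightarrow> deriv_star R z = a z - (\<Sum>k<N. e w k / (z - w) ^ Suc k)"
    using star_expansion_local[OF se w] by metis
  obtain r2 u where r2: "r2 > 0" "u holomorphic_on ball w r2" "u w \<noteq> 0"
    and g: "\<And>z. z \<in> ball w r2 \<Longrightarrow> g z = (z - w) ^ m * u z"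
    using m unfolding has_zero_order_def by metis
  define r where "r = min r1 r2"
  have r: "r > 0" "ball w r \<subseteq> ball w r1" "ball w r \<subseteq> ball w r2" using r1 r2 by (auto simp: r_def)
  have u: "u holomorphic_on ball w r" using r2 r holomorphic_on_subset by blast
  have R: "R z = (z - w) ^ m * u z" if "z \<in> ball w r" for z
  proof -
    have "z \<in> cball 0 1" using that r r1 by force
    then have "g z = R z" using ext unfolding rational_extension_def by blast
    then show ?thesis using g[of z] that r by auto
  qed
  have holR: "R holomorphic_on ball w r"
    by (subst holomorphic_cong[OF refl R]) (auto intro!: holomorphic_intros u)
  have ha: "a holomorphic_on ball w r" using r1 r holomorphic_on_subset by blast
  obtain A where A: "\<And>z. z \<in> ball w r \<Longrightarrow> (A has_field_derivative a z) (at z within ball w r)"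
    using holomorphic_convex_primitive'[OF convex_ball open_ball ha] by blast
  have A': "(A has_field_derivative a z) (at z)" if "z \<in> ball w r" for z
    using A[OF that] at_within_open[OF that open_ball] by simp
  have holA: "A holomorphic_on ball w r" using A holomorphic_on_def field_differentiable_def by blast
  \<comment> \<open>An explicit antiderivative of the reflected derivative near \<open>w\<close>
    after removal of its residue term; the factor \<open>1 / k\<close> comes from integrating
    \<open>(z - w)^-(k+1)\<close>.\<close>
  define F0 where "F0 = (\<lambda>z. A z + (\<Sum>k\<in>{1..<N}. e w k / (of_nat k * (z - w) ^ k)))"
  have res: "residue (deriv_star R) w = - e w 0" by (rule star_expansion_residue[OF se w])
  define D' where "D' = (\<lambda>z. deriv_star R z - residue (deriv_star R) w / (z - w))"
  have D': "D' z = a z - (\<Sum>k\<in>{1..<N}. e w k / (z - w) ^ Suc k)" if "z \<in> ball w r - {w}" for z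
  proof (cases "N = 0")
    case True
    then have "e w 0 = 0" using se by (auto simp: star_expansion_def)
    then show ?thesis using D[of z] that r True by (auto simp: D'_def res)
  next
    case False
    then have "{..<N} = insert 0 {1..<N}" by auto
    then have "(\<Sum>k<N. e w k / (z - w) ^ Suc k) = e w 0 / (z - w) + (\<Sum>k\<in>{1..<N}. e w k / (z - w) ^ Suc k)"
      by simp
    then show ?thesis using D[of z] that r by (auto simp: D'_def res)
  qed
  have F0: "(F0 has_field_derivative D' z) (at z)" if z: "z \<in> ball w r - {w}" for z
  proof -
    have zw: "z - w \<noteq> 0" using z by auto
    have "((\<lambda>z. e w k / (of_nat k * (z - w) ^ k)) has_field_derivative - (e w k / (z - w) ^ Suc k)) (at z)"
      if k: "k \<in> {1..<N}" for k
    proof -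
      obtain j where j: "k = Suc j" using k by (cases k) auto
      have eq: "(z - w) ^ j + of_nat j * (z - w) ^ (j - Suc 0) * (z - w) = of_nat (Suc j) * (z - w) ^ j"
        by (cases j) (auto simp: algebra_simps)
      show ?thesis using zw eq unfolding j
        by (auto intro!: derivative_eq_intros simp: divide_simps power2_eq_square simp del: of_nat_Suc)
    qed
    then have "(F0 has_field_derivative (a z + (\<Sum>k\<in>{1..<N}. - (e w k / (z - w) ^ Suc k)))) (at z)"
      unfolding F0_def using z by (intro DERIV_add A' DERIV_sum) auto
    then show ?thesis using D'[OF z] by (simp add: sum_negf)
  qed
  have prod: "F0 z * R z = A z * R z + (\<Sum>k\<in>{1..<N}. e w k / of_nat k * ((z - w) ^ m / (z - w) ^ k) * u z)"
    if z: "z \<in> ball w r" for z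
    by (simp add: F0_def R[OF z] distrib_right sum_distrib_right) (simp add: mult_ac)
  show ?thesis
  proof
    assume "\<exists>k>m. e w k \<noteq> 0"
    define T where "T = {k. e w k \<noteq> 0 \<and> k > m}"
    have "T \<subseteq> {..<N}" using star_expansion_eq_0[OF se] by (force simp: T_def not_le[symmetric])
    then have T: "finite T" "T \<noteq> {}"
      using finite_subset \<open>\<exists>k>m. e w k \<noteq> 0\<close> by (auto simp: T_def)
    define K where "K = Max T"
    have "K \<in> T" using Max_in[OF T] by (simp add: K_def)
    then have K: "e w K \<noteq> 0" "K > m" "\<And>k. e w k \<noteq> 0 \<Longrightarrow> k > m \<Longrightarrow> k \<le> K"
      using Max_ge[OF T(1)] by (auto simp: T_def K_def)
    have KN: "K < N" using K(1) star_expansion_eq_0[OF se] by (metis not_le)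
    \<comment> \<open>\<open>K\<close> is the largest index with a nonzero coefficient. After
      multiplication by \<open>(z - w)^(K - m)\<close> only the term with \<open>k = K\<close>
      survives at \<open>w\<close>, so the pole has order \<open>K - m\<close>.\<close>
    define G where "G = (\<lambda>z. (z - w) ^ (K - m) * (A z * R z) + (\<Sum>k\<in>{1..K}. e w k / of_nat k * (z - w) ^ (K - k) * u z))"
    have "is_pole (\<lambda>z. G z / (z - w) ^ (K - m)) w"
    proof (rule is_pole_basic[of _ "ball w r"])
      show "G holomorphic_on ball w r"
        unfolding G_def by (intro holomorphic_intros u holA holR)
      have "(\<Sum>k\<in>{1..K}. e w k / of_nat k * (w - w) ^ (K - k) * u w) = (\<Sum>k\<in>{1..K}. if k = K then e w K / of_nat K * u w else 0)"
        by (intro sum.cong) auto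
      moreover obtain d where "K - m = Suc d" using K(2) by (metis Suc_diff_Suc)
      ultimately show "G w \<noteq> 0" using K r2 by (simp add: G_def)
    qed (use r K in auto)
    moreover have "\<forall>\<^sub>F z in at w. F0 z * R z = G z / (z - w) ^ (K - m)"
      using eventually_at_ball_punctured[OF r(1), of w]
    proof eventually_elim
      case (elim z)
      then have zw: "z - w \<noteq> 0" by auto
      have "(\<Sum>k\<in>{1..<N}. e w k / of_nat k * ((z - w) ^ m / (z - w) ^ k) * u z)
          = (\<Sum>k\<in>{1..K}. e w k / of_nat k * ((z - w) ^ m / (z - w) ^ k) * u z)"
        using KN K by (intro sum.mono_neutral_right) force+
      also have "\<dots> = (\<Sum>k\<in>{1..K}. e w k / of_nat k * (z - w) ^ (K - k) * u z) / (z - w) ^ (K - m)"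
        unfolding sum_divide_distrib
      proof (intro sum.cong refl)
        fix k assume k: "k \<in> {1..K}"
        have "(z - w) ^ m * (z - w) ^ (K - m) = (z - w) ^ (K - k) * (z - w) ^ k"
          using k K(2) by (simp flip: power_add)
        then have "(z - w) ^ m / (z - w) ^ k = (z - w) ^ (K - k) / (z - w) ^ (K - m)"
          using zw by (simp add: frac_eq_eq)
        then show "e w k / of_nat k * ((z - w) ^ m / (z - w) ^ k) * u z
           = e w k / of_nat k * (z - w) ^ (K - k) * u z / (z - w) ^ (K - m)" by simp
      qed
      finally show ?case using prod[of z] elim zw by (simp add: G_def add_divide_distrib)
    qed
    ultimately have "is_pole (\<lambda>z. F0 z * R z) w"
      by (subst is_pole_cong) auto
    moreover have "\<forall>\<^sub>F z in at w. (F0 has_field_derivative D' z) (at z)"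
      using eventually_at_ball_punctured[OF r(1), of w] by eventually_elim (rule F0)
    ultimately show "w \<in> ordinary_poles_star R"
      using w unfolding ordinary_poles_star_def D'_def by blast
  next
    assume "w \<in> ordinary_poles_star R"
    then obtain F where F: "\<forall>\<^sub>F z in at w. (F has_field_derivative D' z) (at z)"
      and pole: "is_pole (\<lambda>z. F z * R z) w"
      unfolding ordinary_poles_star_def D'_def by blast
    obtain d where d: "d > 0" "\<And>z. z \<noteq> w \<Longrightarrow> dist z w < d \<Longrightarrow> (F has_field_derivative D' z) (at z)"
      using F unfolding eventually_at by auto
    define s where "s = min d r"
    have s: "s > 0" using d r by (simp add: s_def)
    \<comment> \<open>The punctured disk is connected, so any admissible \<open>F\<close> differs
      from \<open>F0\<close> by a constant.\<close>
    have conn: "connected (ball w s - {w})" by (intro connected_punctured_ball) simp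
    have der0: "((\<lambda>z. F z - F0 z) has_field_derivative 0) (at z)" if "z \<in> ball w s - {w}" for z
      using DERIV_diff[OF d(2)[of z] F0[of z]] that by (auto simp: s_def dist_commute)
    then have "continuous_on (ball w s - {w}) (\<lambda>z. F z - F0 z)"
      by (intro continuous_at_imp_continuous_on ballI DERIV_isCont) blast
    then obtain c where c: "\<And>z. z \<in> ball w s - {w} \<Longrightarrow> F z - F0 z = c"
      using DERIV_zero_connected_constant[OF conn _ finite.emptyI, of "\<lambda>z. F z - F0 z"] der0 by auto
    show "\<exists>k>m. e w k \<noteq> 0"
    proof (rule ccontr)
      assume "\<not> (\<exists>k>m. e w k \<noteq> 0)"
      then have e0: "e w k = 0" if "k > m" for k using that by blast
      \<comment> \<open>For \<open>k > m\<close> the truncated exponent \<open>m - k\<close> is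
        \<open>0\<close>, but there the coefficient vanishes; every other denominator is absorbed by
        the zero of \<open>g\<close>. So \<open>H\<close> is holomorphic at \<open>w\<close> and the
        product stays bounded.\<close>
      define H where "H = (\<lambda>z. (A z + c) * R z + (\<Sum>k\<in>{1..<N}. e w k / of_nat k * (z - w) ^ (m - k) * u z))"
      have "H holomorphic_on ball w r"
        unfolding H_def by (intro holomorphic_intros u holA holR)
      then have "isCont H w" using r
        by (meson centre_in_ball continuous_on_eq_continuous_at holomorphic_on_imp_continuous_on open_ball)
      then have lim: "H \<midarrow>w\<rightarrow> H w" by (simp add: isCont_def)
      have "\<forall>\<^sub>F z in at w. H z = F z * R z"
        using eventually_at_ball_punctured[OF s, of w]
      proof eventually_elim
        case (elim z)
        then have zw: "z - w \<noteq> 0" and zr: "z \<in> ball w r" by (auto simp: s_def)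
        have "(\<Sum>k\<in>{1..<N}. e w k / of_nat k * ((z - w) ^ m / (z - w) ^ k) * u z)
          = (\<Sum>k\<in>{1..<N}. e w k / of_nat k * (z - w) ^ (m - k) * u z)"
        proof (intro sum.cong refl)
          fix k
          show "e w k / of_nat k * ((z - w) ^ m / (z - w) ^ k) * u z = e w k / of_nat k * (z - w) ^ (m - k) * u z"
            using zw e0[of k] by (cases "k \<le> m") (auto simp: power_diff)
        qed
        moreover have "F z = F0 z + c" using c[OF elim] by (simp add: algebra_simps)
        ultimately show ?case using prod[OF zr] by (simp add: H_def distrib_right)
      qed
      then have "(\<lambda>z. F z * R z) \<midarrow>w\<rightarrow> H w"
        using lim by (rule Lim_transform_eventually[rotated])
      then show False using pole not_tendsto_and_filterlim_at_infinity[of "at w"]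
        unfolding is_pole_def by (auto simp: trivial_limit_at)
    qed
  qed
qed

text \<open>The reflected derivative has a pole of order \<open>K + 1\<close> at \<open>w\<close>.
  Away from the origin, reflection is a conjugated conformal map and the factor
  \<open>\<zeta>^2\<close> is a unit, so \<open>R\<close> has a pole of the same order at the
  reflected point.\<close>

lemma star_expansion_pole_order:
  assumes se: "star_expansion R S N e" and w: "w \<in> ball 0 1" "w \<noteq> 0"
    and K: "e w K \<noteq> 0" "\<And>k. k > K \<Longrightarrow> e w k = 0"
  shows "is_pole R (star_pt w)" "zorder R (star_pt w) = - int (Suc K)"
proof -
  obtain r a where r: "r > 0" "ball w r \<subseteq> ball 0 1" "a holomorphic_on ball w r"
    and D: "\<And>z. z \<in> ball w r - {w} \<Longrightarrow> deriv_star R z = a z - (\<Sum>k<N. e w k / (z - w) ^ Suc k)"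
    using star_expansion_local[OF se w(1)] by metis
  have KN: "K < N" using K(1) star_expansion_eq_0[OF se] by (metis not_le)
  \<comment> \<open>The reflected derivative times \<open>(z - w)^(K+1)\<close>; its value at
    \<open>w\<close> is \<open>- e w K\<close>, which is not zero.\<close>
  define v where "v = (\<lambda>z. (z - w) ^ Suc K * a z - (\<Sum>k\<le>K. e w k * (z - w) ^ (K - k)))"
  have hv: "v holomorphic_on ball w r" unfolding v_def by (intro holomorphic_intros r)
  have "(\<Sum>k\<le>K. e w k * (w - w) ^ (K - k)) = (\<Sum>k\<le>K. if k = K then e w K else 0)"
    by (intro sum.cong) auto
  then have vw: "v w = - e w K" by (simp add: v_def)
  have Dv: "deriv_star R z = v z / (z - w) ^ Suc K" if z: "z \<in> ball w r - {w}" for z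
  proof -
    have zw: "z - w \<noteq> 0" using z by auto
    have "(\<Sum>k<N. e w k / (z - w) ^ Suc k) = (\<Sum>k\<le>K. e w k / (z - w) ^ Suc k)"
      using KN K(2) by (intro sum.mono_neutral_right) auto
    also have "\<dots> = (\<Sum>k\<le>K. e w k * (z - w) ^ (K - k)) / (z - w) ^ Suc K"
      unfolding sum_divide_distrib
    proof (intro sum.cong refl)
      fix k assume "k \<in> {..K}"
      then have "(z - w) ^ Suc K = (z - w) ^ (K - k) * (z - w) ^ Suc k"
        by (simp flip: power_add)
      then show "e w k / (z - w) ^ Suc k = e w k * (z - w) ^ (K - k) / (z - w) ^ Suc K"
        using zw by simp
    qed
    finally show ?thesis unfolding D[OF z] v_def diff_divide_distrib using zw by simp
  qed
  define z0 where "z0 = star_pt w"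
  have z0: "z0 \<noteq> 0" "1 / z0 = cnj w" "1 / cnj z0 = w" using w by (auto simp: z0_def star_pt_def)
  define T where "T = {z. z \<noteq> 0 \<and> 1 / z \<in> ball (cnj w) r}"
  have T: "open T"
  proof -
    have "open ((- {0}) \<inter> (\<lambda>z. 1 / z) -` ball (cnj w) r)"
      by (intro continuous_open_preimage continuous_intros) auto
    also have "(- {0}) \<inter> (\<lambda>z. 1 / z) -` ball (cnj w) r = T" by (auto simp: T_def)
    finally show ?thesis .
  qed
  have z0T: "z0 \<in> T" using z0 r by (simp add: T_def)
  \<comment> \<open>Obtained by solving the definition of the reflected derivative for
    \<open>R\<close> and using \<open>1/z - 1/z0 = (z - z0) / (- (z z0))\<close>. The conjugations
    around \<open>v\<close> keep the result holomorphic.\<close>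
  define u where "u = (\<lambda>z. - (1 / z\<^sup>2) * ((cnj \<circ> v \<circ> cnj) (1 / z)) * (- (z * z0)) ^ Suc K)"
  have "cnj ` ball (cnj w) r = ball w r"
    by (auto simp: image_iff dist_norm simp flip: complex_cnj_diff intro!: bexI[of _ "cnj _"])
       (metis complex_cnj_cnj complex_cnj_diff complex_mod_cnj)+
  then have "cnj \<circ> v \<circ> cnj holomorphic_on ball (cnj w) r"
    using hv by (intro holomorphic_on_compose_cnj_cnj) auto
  then have "(\<lambda>z. (cnj \<circ> v \<circ> cnj) (1 / z)) holomorphic_on T"
    by (rule holomorphic_on_compose_gen[unfolded o_def, rotated]) (auto simp: T_def intro!: holomorphic_intros)
  then have hu: "u holomorphic_on T" unfolding u_def
    by (intro holomorphic_intros) (auto simp: T_def)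
  have u0: "u z0 \<noteq> 0"
    using z0(1,3) K(1) by (simp add: u_def vw)
  have Ru: "R z = u z / (z - z0) ^ Suc K" if z: "z \<in> T" "z \<noteq> z0" for z
  proof -
    define \<zeta> where "\<zeta> = 1 / cnj z"
    have zn: "z \<noteq> 0" using z by (simp add: T_def)
    have c\<zeta>: "cnj \<zeta> = 1 / z" by (simp add: \<zeta>_def)
    have \<zeta>0: "\<zeta> \<noteq> 0" using zn by (simp add: \<zeta>_def)
    have "dist w \<zeta> = dist (cnj w) (1 / z)"
      unfolding dist_norm c\<zeta>[symmetric] by (metis complex_cnj_diff complex_mod_cnj)
    then have "\<zeta> \<in> ball w r" using z by (simp add: T_def)
    moreover have "\<zeta> \<noteq> w"
    proof
      assume "\<zeta> = w"
      then have "1 / z = 1 / z0" using c\<zeta> z0 by simp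
      then show False using z(2) by simp
    qed
    ultimately have D\<zeta>: "deriv_star R \<zeta> = v \<zeta> / (\<zeta> - w) ^ Suc K" using Dv by simp
    have "R z = cnj (star_fun R \<zeta>)" by (simp add: star_fun_def c\<zeta>)
    also have "star_fun R \<zeta> = - \<zeta>\<^sup>2 * deriv_star R \<zeta>" using \<zeta>0 by (simp add: deriv_star_def)
    finally have "R z = - (1 / z)\<^sup>2 * (cnj (v \<zeta>) / (1 / z - 1 / z0) ^ Suc K)"
      by (simp add: D\<zeta> c\<zeta> z0(2) del: power_Suc)
    also have "1 / z - 1 / z0 = (z - z0) / (- (z * z0))" using zn z0 by (simp add: field_simps)
    also have "cnj (v \<zeta>) = (cnj \<circ> v \<circ> cnj) (1 / z)" by (simp add: \<zeta>_def)
    finally show ?thesis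
      by (simp only: u_def power_divide power_one divide_divide_eq_right times_divide_eq_right mult.assoc)
  qed
  show "zorder R (star_pt w) = - int (Suc K)"
    unfolding z0_def[symmetric]
  proof (rule zorder_eqI[OF T z0T hu u0])
    fix z assume "z \<in> T" "z \<noteq> z0"
    then show "R z = u z * (z - z0) powi - int (Suc K)"
      using Ru[of z] by (simp add: power_int_minus field_simps del: power_Suc of_nat_Suc)
  qed
  have "is_pole (\<lambda>z. u z / (z - z0) ^ Suc K) z0"
    by (rule is_pole_basic[OF hu T z0T u0]) simp
  moreover have "\<forall>\<^sub>F z in at z0. z \<in> T \<and> z \<noteq> z0"
    using eventually_at_in_open[OF T z0T] by (auto elim: eventually_mono)
  then have "\<forall>\<^sub>F z in at z0. R z = u z / (z - z0) ^ Suc K"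
    by eventually_elim (auto simp: Ru)
  ultimately show "is_pole R (star_pt w)"
    unfolding z0_def[symmetric] by (subst is_pole_cong) auto
qed

section \<open>Quadrature identities of rational functions\<close>

lemma has_zero_order_jet:
  assumes "has_zero_order g w m"
  shows "i < m \<Longrightarrow> jet g w i = 0" "jet g w m \<noteq> 0"
proof -
  obtain r u where r: "r > 0" "u holomorphic_on ball w r" "u w \<noteq> 0"
    and g: "\<And>z. z \<in> ball w r \<Longrightarrow> g z = (z - w) ^ m * u z"
    using assms unfolding has_zero_order_def by blast
  have u: "u analytic_on {w}" using holomorphic_ball_analytic_at r by blast
  have "jet (\<lambda>z. (z - w) ^ m * u z) w i = jet g w i" for i
  proof (rule jet_cong)
    show "(\<lambda>z. (z - w) ^ m * u z) analytic_on {w}" by (intro analytic_intros u)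
    show "\<forall>\<^sub>F z in nhds w. (z - w) ^ m * u z = g z"
      using eventually_nhds_in_open[of "ball w r" w] r g by (auto elim!: eventually_mono)
  qed
  then have j: "jet g w i = (\<Sum>k\<le>i. (if k = m then 1 else 0) * jet u w (i - k))" for i
    by (subst (asm) jet_mult) (auto intro!: analytic_intros u simp: jet_power_diff)
  show "jet g w i = 0" if "i < m"
    unfolding j using that by (intro sum.neutral) auto
  have "jet g w m = (\<Sum>k\<le>m. if k = m then u w else 0)"
    unfolding j by (intro sum.cong) auto
  then show "jet g w m \<noteq> 0" using r by simp
qed

text \<open>A nonzero value at the origin excludes the zero function, so every zero has finite
  order.\<close>

lemma has_zero_order_exists:
  assumes g: "g analytic_on cball 0 1" "g 0 \<noteq> 0" and w: "w \<in> cball 0 1"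
  obtains m where "has_zero_order g w m"
proof -
  obtain \<rho> where \<rho>: "\<rho> > 1" "g holomorphic_on ball 0 \<rho>"
    using analytic_on_cball_holomorphic[OF g(1)] .
  obtain r where r: "r > 0" "cball w r \<subseteq> ball 0 \<rho>" "zor_poly g w holomorphic_on cball w r"
    "\<And>z. z \<in> cball w r \<Longrightarrow> g z = zor_poly g w z * (z - w) ^ nat (zorder g w) \<and> zor_poly g w z \<noteq> 0"
  proof -
    have "w \<in> ball 0 \<rho>" "\<exists>z\<in>ball 0 \<rho>. g z \<noteq> 0" using w \<rho>(1) g(2) by (auto intro!: bexI[of _ 0])
    from zorder_exist_zero[OF \<rho>(2) open_ball connected_ball this] show ?thesis using that by blast
  qed
  have "has_zero_order g w (nat (zorder g w))"
    unfolding has_zero_order_def using r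
    by (intro exI[of _ r] exI[of _ "zor_poly g w"]) (auto simp: mult.commute elim: holomorphic_on_subset)
  then show ?thesis using that by blast
qed

lemma primitive_on_cball:
  assumes "H analytic_on cball 0 (1::real)"
  obtains \<rho> P where "\<rho> > 1" "P holomorphic_on ball (0::complex) \<rho>" "P analytic_on cball 0 1"
    "\<And>z. z \<in> ball 0 \<rho> \<Longrightarrow> (P has_field_derivative H z) (at z)"
    "\<And>z. z \<in> ball 0 \<rho> \<Longrightarrow> deriv P z = H z"
proof -
  obtain \<rho> where \<rho>: "\<rho> > 1" "H holomorphic_on ball (0::complex) \<rho>"
    using analytic_on_cball_holomorphic[OF assms] .
  obtain P where P: "\<And>z. z \<in> ball 0 \<rho> \<Longrightarrow> (P has_field_derivative H z) (at z within ball 0 \<rho>)"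
    using holomorphic_convex_primitive'[OF convex_ball open_ball \<rho>(2)] by blast
  have P': "(P has_field_derivative H z) (at z)" if "z \<in> ball 0 \<rho>" for z
    using P[OF that] at_within_open[OF that open_ball] by simp
  have "P holomorphic_on ball 0 \<rho>" using P holomorphic_on_def field_differentiable_def by blast
  then show ?thesis
    using that[OF \<rho>(1)] P' holomorphic_ball_imp_analytic_cball[OF \<rho>(1)] DERIV_imp_deriv by blast
qed

lemma disk_pairing_cong:
  assumes "\<And>z. z \<in> ball 0 1 \<Longrightarrow> H z = H' z" "\<And>z. z \<in> ball 0 1 \<Longrightarrow> G z = G' z"
  shows "disk_pairing H G = disk_pairing H' G'"
  unfolding disk_pairing_def using assms by (intro set_lebesgue_integral_cong) auto

lemma weighted_integral_eq_disk_pairing: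
  "(LINT z:ball 0 1|lborel. h z * complex_of_real ((cmod (g z))\<^sup>2)) = disk_pairing (\<lambda>z. h z * g z) g"
  unfolding disk_pairing_def
  by (intro set_lebesgue_integral_cong) (auto simp: complex_norm_square mult_ac simp flip: of_real_power)

lemma star_expansion_top:
  assumes "star_expansion R S N e" "e w k \<noteq> 0"
  obtains K where "k \<le> K" "e w K \<noteq> 0" "\<And>i. i > K \<Longrightarrow> e w i = 0"
proof -
  define T where "T = {i. e w i \<noteq> 0}"
  have "T \<subseteq> {..<N}" using star_expansion_eq_0[OF assms(1)] by (force simp: T_def not_le[symmetric])
  then have T: "finite T" "k \<in> T" using finite_subset assms(2) by (auto simp: T_def)
  have top: "e w i = 0" if i: "i > Max T" for i
    using Max_ge[OF T(1), of i] i by (auto simp: T_def)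
  have "Max T \<in> T" using Max_in[OF T(1)] T(2) by blast
  then have ne: "e w (Max T) \<noteq> 0" by (simp add: T_def)
  show ?thesis by (rule that[OF Max_ge[OF T] ne top])
qed

lemma star_pt_star_pt [simp]: "star_pt (star_pt w) = w"
  by (simp add: star_pt_def)

lemma star_expansion_pole:
  assumes "star_expansion R S N e" "e w k \<noteq> 0" "w \<noteq> 0"
  shows "is_pole R (star_pt w)"
proof -
  obtain K where "e w K \<noteq> 0" "\<And>i. i > K \<Longrightarrow> e w i = 0" using star_expansion_top[OF assms(1,2)] by blast
  moreover have "w \<in> ball 0 1" using assms(1,2) unfolding star_expansion_def by blast
  ultimately show ?thesis using star_expansion_pole_order(1)[OF assms(1) _ assms(3)] by blast
qed

text \<open>For \<open>P' = h g\<close> the Leibniz rule turns the jets of \<open>P\<close> at \<open>w\<close>, apart from the value \<open>P w\<close>,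
  into derivatives of \<open>h\<close>; these are the resulting coefficients.\<close>

definition point_coeff :: "(complex \<Rightarrow> complex) \<Rightarrow> nat \<Rightarrow> (complex \<Rightarrow> nat \<Rightarrow> complex) \<Rightarrow> complex \<Rightarrow> nat \<Rightarrow> complex" where
  "point_coeff g N e w k = (\<Sum>i\<in>{k..<N}. e w i / of_nat i * jet g w (i - k)) / fact (k - 1)"

lemma jet_functional_point_coeff:
  assumes h: "h analytic_on ball 0 1" and g: "g analytic_on ball 0 1" and S: "S \<subseteq> ball 0 1"
    and N: "\<And>w k. N \<le> k \<Longrightarrow> e w k = 0"
    and P: "\<And>z. z \<in> ball 0 1 \<Longrightarrow> deriv P z = h z * g z"
  shows "jet_functional S N e P = (\<Sum>w\<in>S. e w 0 * P w) +
    (\<Sum>w\<in>S. \<Sum>k=1..<N. point_coeff g N e w k * (deriv ^^ (k - 1)) h w)"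
proof -
  have "(\<Sum>k<N. e w k * jet P w k) = e w 0 * P w + (\<Sum>k=1..<N. point_coeff g N e w k * (deriv ^^ (k - 1)) h w)"
    if w: "w \<in> S" for w
  proof -
    have wb: "w \<in> ball 0 1" using S w by blast
    have hw: "h analytic_on {w}" "g analytic_on {w}" using h g wb by (auto elim!: analytic_on_subset)
    \<comment> \<open>Comparing Taylor coefficients in \<open>P' = h g\<close> expresses all jets of
      positive index; only the value \<open>P w\<close> is not determined by \<open>h\<close> and
      \<open>g\<close> near \<open>w\<close>.\<close>
    have jP: "jet P w (Suc i) = (\<Sum>k\<le>i. jet h w k * jet g w (i - k)) / of_nat (Suc i)" for i
    proof -
      have "jet (\<lambda>z. h z * g z) w i = jet (deriv P) w i"
      proof (rule jet_cong)
        show "(\<lambda>z. h z * g z) analytic_on {w}" by (intro analytic_intros hw)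
        show "\<forall>\<^sub>F z in nhds w. h z * g z = deriv P z"
          using eventually_nhds_in_open[OF open_ball wb] P by (auto elim!: eventually_mono)
      qed
      then show ?thesis by (simp add: jet_deriv jet_mult[OF hw] del: of_nat_Suc)
    qed
    have "(\<Sum>k<N. e w k * jet P w k) = e w 0 * P w + (\<Sum>i=1..<N. e w i * jet P w i)"
    proof (cases "N = 0")
      case False
      then have "{..<N} = insert 0 {1..<N}" by auto
      then show ?thesis by simp
    qed (use N in auto)
    also have "(\<Sum>i=1..<N. e w i * jet P w i)
        = (\<Sum>i=1..<N. \<Sum>k=1..<N. if k \<le> i then e w i / of_nat i * jet g w (i - k) * jet h w (k - 1) else 0)"
    proof (intro sum.cong refl)
      fix i assume i: "i \<in> {1..<N}"
      then obtain i' where i': "i = Suc i'" by (cases i) auto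
      have "e w i * jet P w i = (\<Sum>k\<le>i'. e w i / of_nat i * jet g w (i' - k) * jet h w k)"
        by (simp add: i' jP sum_distrib_left sum_divide_distrib mult_ac del: of_nat_Suc)
      also have "\<dots> = (\<Sum>k\<in>{1..i}. e w i / of_nat i * jet g w (i - k) * jet h w (k - 1))"
        by (rule sum.reindex_bij_witness[of _ "\<lambda>k. k - 1" Suc]) (auto simp: i')
      also have "\<dots> = (\<Sum>k=1..<N. if k \<le> i then e w i / of_nat i * jet g w (i - k) * jet h w (k - 1) else 0)"
        using i by (intro sum.mono_neutral_cong_left) auto
      finally show "e w i * jet P w i = \<dots>" .
    qed
    also have "\<dots> = (\<Sum>k=1..<N. \<Sum>i=1..<N. if k \<le> i then e w i / of_nat i * jet g w (i - k) * jet h w (k - 1) else 0)"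
      by (rule sum.swap)
    also have "\<dots> = (\<Sum>k=1..<N. point_coeff g N e w k * (deriv ^^ (k - 1)) h w)"
    proof (intro sum.cong refl)
      fix k assume k: "k \<in> {1..<N}"
      have "(\<Sum>i=1..<N. if k \<le> i then e w i / of_nat i * jet g w (i - k) * jet h w (k - 1) else 0)
          = (\<Sum>i\<in>{k..<N}. e w i / of_nat i * jet g w (i - k) * jet h w (k - 1))"
        using k by (intro sum.mono_neutral_cong_right) auto
      then show "(\<Sum>i=1..<N. if k \<le> i then e w i / of_nat i * jet g w (i - k) * jet h w (k - 1) else 0)
          = point_coeff g N e w k * (deriv ^^ (k - 1)) h w"
        by (simp add: point_coeff_def jet_def[of h] sum_distrib_right sum_divide_distrib)
    qed
    finally show ?thesis .
  qed
  then show ?thesis unfolding jet_functional_def by (simp add: sum.distrib)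
qed

text \<open>Since the residues add up to zero, their contribution is a combination of differences of
  \<open>P\<close> between one logarithmic pole and each of the others, hence of integrals of
  \<open>h g\<close> along segments. The remaining terms are point evaluations, and they vanish at
  points that are not ordinary poles.\<close>

lemma quadrature_of_rational:
  assumes g: "g analytic_on cball 0 1" "g 0 \<noteq> 0" and ext: "rational_extension g R"
  shows "\<exists>l r \<alpha> \<gamma> c n a. quadrature_identity g l r \<alpha> \<gamma> c n a \<and> pole_location g l r \<alpha> \<gamma> n"
proof -
  obtain S N e where se: "star_expansion R S N e" using star_expansion_exists[OF ext] by blast
  have S: "finite S" "S \<subseteq> ball 0 1" "0 \<in> S" and e0: "\<And>w k. w \<notin> S \<or> N \<le> k \<Longrightarrow> e w k = 0"
    using se unfolding star_expansion_def by auto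
  have "\<exists>m. has_zero_order g w m" if "w \<in> ball 0 1" for w
    using has_zero_order_exists[OF g, of w] that by (metis ball_subset_cball subsetD)
  then obtain ord where ord: "\<And>w. w \<in> ball 0 1 \<Longrightarrow> has_zero_order g w (ord w)" by metis
  have gb: "g analytic_on ball 0 1" using g(1) by (rule analytic_on_subset) auto
  define L where "L = {w. e w 0 \<noteq> 0}"
  have LS: "L \<subseteq> S" using e0 by (auto simp: L_def)
  have L: "finite L" "L \<subseteq> ball 0 1" using LS S finite_subset by auto
  have Llog: "log_poles_star R = L" unfolding L_def by (rule log_poles_star_eq[OF se])
  have Lsum: "(\<Sum>w\<in>L. e w 0) = 0"
    using star_expansion_residues_sum[OF g(1) ext se] sum.mono_neutral_right[OF S(1) LS, of "\<lambda>w. e w 0"]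
    by (simp add: L_def)
  define r where "r = card L - 1"
  obtain f where f: "bij_betw f {0..<card L} L" using ex_bij_betw_nat_finite[OF L(1)] by blast
  \<comment> \<open>A single logarithmic pole would have residue zero, since the residues add up to
    zero. So either there are no arcs at all, or every pole is an end point of one.\<close>
  have card2: "card L \<ge> 2" if "L \<noteq> {}"
  proof (rule ccontr)
    assume "\<not> card L \<ge> 2"
    then have "card L = 1" using that L(1) by (metis card_0_eq less_2_cases_iff not_le One_nat_def)
    then obtain w where "L = {w}" using card_1_singletonE by blast
    then show False using Lsum by (auto simp: L_def)
  qed
  have fL: "f j \<in> L" if "j < card L" for j using f that by (auto simp: bij_betw_def)
  have r_less: "j < card L" if "j \<in> {0..r}" "r > 0" for j using that by (auto simp: r_def)
  \<comment> \<open>All segments start at the pole \<open>f 0\<close>; index \<open>0\<close> is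
    kept out of \<open>{1..r}\<close> because its segment would be degenerate.\<close>
  define \<gamma> where "\<gamma> = (\<lambda>j. linepath (f 0) (f j))"
  define c where "c = (\<lambda>j. e (f j) 0)"
  have ends: "(\<Union>j\<in>{1..r}. {pathstart (\<gamma> j), pathfinish (\<gamma> j)}) = L"
  proof (cases "L = {}")
    case True then show ?thesis by (simp add: r_def)
  next
    case False
    then have r: "r > 0" "card L = Suc r" using card2 by (auto simp: r_def)
    have "L = f ` {0..r}" using f r by (auto simp: bij_betw_def atLeastLessThanSuc_atLeastAtMost)
    also have "{0..r} = insert 0 {1..r}" by auto
    finally have LL: "L = insert (f 0) (f ` {1..r})" by simp
    moreover have "1 \<in> {1..r}" using r by auto
    ultimately show ?thesis by (auto simp: \<gamma>_def)
  qed
  have \<gamma>: "valid_path (\<gamma> j) \<and> arc (\<gamma> j) \<and> path_image (\<gamma> j) \<subseteq> ball 0 1" if j: "j \<in> {1..r}" for j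
  proof -
    have j0: "j < card L" "0 < card L" "j \<noteq> 0" using j r_less[of j] by auto
    then have "f 0 \<noteq> f j" using bij_betw_imp_inj_on[OF f] by (auto dest!: inj_onD)
    moreover have "closed_segment (f 0) (f j) \<subseteq> ball 0 1"
      using fL[OF j0(1)] fL[OF j0(2)] L(2) by (intro closed_segment_subset) auto
    ultimately show ?thesis by (simp add: \<gamma>_def arc_linepath)
  qed
  define Or where "Or = ordinary_poles_star R"
  have Or: "w \<in> Or \<longleftrightarrow> (\<exists>k>ord w. e w k \<noteq> 0)" if "w \<in> ball 0 1" for w
    unfolding Or_def by (rule ordinary_pole_iff[OF ext se that ord[OF that]])
  have Orb: "Or \<subseteq> ball 0 1" by (auto simp: Or_def ordinary_poles_star_def)
  have OrS: "Or \<subseteq> S" using Or Orb e0 by blast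
  define l where "l = card (Or - {0})"
  obtain f' where f': "bij_betw f' {0..<l} (Or - {0})"
    using ex_bij_betw_nat_finite[of "Or - {0}"] OrS S(1) finite_subset unfolding l_def by blast
  \<comment> \<open>Slot \<open>0\<close> is reserved for the origin, whether or not it is a pole;
    the other slots enumerate the nonzero ordinary poles.\<close>
  define \<alpha> where "\<alpha> = (\<lambda>j. if j = 0 then 0 else f' (j - 1))"
  have \<alpha>_or: "\<alpha> j \<in> Or - {0}" if "j \<in> {1..l}" for j
  proof -
    have "j - 1 \<in> {0..<l}" using that by auto
    then show ?thesis using f' that by (auto simp: \<alpha>_def bij_betw_def)
  qed
  have \<alpha>_im: "\<alpha> ` {0..l} = insert 0 Or"
  proof -
    have "Or - {0} = f' ` {0..<l}" using f' by (auto simp: bij_betw_def)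
    also have "\<dots> = \<alpha> ` {1..l}"
    proof -
      have "{1..l} = Suc ` {0..<l}" by (simp add: image_Suc_atLeastLessThan atLeastLessThanSuc_atLeastAtMost)
      then show ?thesis by (simp only: image_image) (simp add: \<alpha>_def)
    qed
    finally have "\<alpha> ` {1..l} = Or - {0}" ..
    moreover have "{0..l} = insert 0 {1..l}" by auto
    moreover have "\<alpha> 0 = 0" by (simp add: \<alpha>_def)
    ultimately show ?thesis by (simp only: image_insert) auto
  qed
  have \<alpha>_inj: "inj_on \<alpha> {0..l}"
  proof (rule inj_onI)
    fix i j assume ij: "i \<in> {0..l}" "j \<in> {0..l}" "\<alpha> i = \<alpha> j"
    have inj: "inj_on f' {0..<l}" using f' by (simp add: bij_betw_def)
    show "i = j"
    proof (cases "i = 0 \<or> j = 0")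
      case True
      then show ?thesis using ij \<alpha>_or[of i] \<alpha>_or[of j] by (auto simp: \<alpha>_def split: if_splits)
    next
      case False
      then have "f' (i - 1) = f' (j - 1)" using ij by (simp add: \<alpha>_def)
      then have "i - 1 = j - 1" using inj ij False by (auto dest!: inj_onD)
      then show ?thesis using False by linarith
    qed
  qed
  define K where "K = (\<lambda>w. SOME K. e w K \<noteq> 0 \<and> (\<forall>i>K. e w i = 0))"
  have K: "e w (K w) \<noteq> 0 \<and> (\<forall>i>K w. e w i = 0)" if w: "w \<in> Or" for w
  proof -
    obtain k where "e w k \<noteq> 0" using Or w Orb by blast
    from star_expansion_top[OF se this] have "\<exists>K. e w K \<noteq> 0 \<and> (\<forall>i>K. e w i = 0)" by metis
    then show ?thesis unfolding K_def by (rule someI_ex)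
  qed
  \<comment> \<open>For \<open>j \<ge> 1\<close> this is the pole order of \<open>g\<close> at the
    reflected point, one more than the top index. At the origin \<open>Suc N\<close> leaves room for
    all derivative indices below \<open>N\<close>.\<close>
  define n where "n = (\<lambda>j. if j = 0 then Suc N else Suc (K (\<alpha> j)))"
  define a where "a = (\<lambda>j. point_coeff g N e (\<alpha> j))"
  have pc0: "a j k = 0" if "j \<in> {0..l}" "k \<ge> n j \<or> k \<ge> N" for j k
  proof -
    have "e (\<alpha> j) i = 0" if i: "i \<ge> k" "i < N" for i
      using \<alpha>_or[of j] \<open>j \<in> {0..l}\<close> \<open>k \<ge> n j \<or> k \<ge> N\<close> i K[of "\<alpha> j"]
      by (cases "j = 0") (auto simp: n_def)
    then show ?thesis unfolding a_def point_coeff_def by (simp add: sum.neutral)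
  qed
  \<comment> \<open>Where there is no ordinary pole, a nonzero \<open>e w i\<close> has
    \<open>i \<le> ord w\<close>; then \<open>i - k < ord w\<close> because
    \<open>k \<ge> 1\<close>, and the jet of \<open>g\<close> vanishes.\<close>
  have pc1: "point_coeff g N e w k = 0" if w: "w \<in> ball 0 1" "w \<notin> Or" and k: "k \<ge> 1" for w k
  proof -
    have "e w i / of_nat i * jet g w (i - k) = 0" if i: "i \<in> {k..<N}" for i
    proof (cases "e w i = 0")
      case False
      then have "i \<le> ord w" using Or[OF w(1)] w(2) by (meson not_le)
      then have "i - k < ord w" using k i by auto
      then show ?thesis using has_zero_order_jet(1)[OF ord[OF w(1)]] by simp
    qed simp
    then show ?thesis unfolding point_coeff_def by (simp add: sum.neutral)
  qed
  have QI: "quadrature_identity g l r \<alpha> \<gamma> c n a"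
    unfolding quadrature_identity_def
  proof (intro conjI allI impI ballI \<alpha>_inj)
    show "\<alpha> 0 = 0" by (simp add: \<alpha>_def)
    show "\<alpha> j \<in> ball 0 1" "0 < n j" if "j \<in> {0..l}" for j
    proof -
      have "\<alpha> j \<in> insert 0 Or" using \<alpha>_im that by blast
      then show "\<alpha> j \<in> ball 0 1" "0 < n j" using Orb by (auto simp: n_def)
    qed
    show "valid_path (\<gamma> j)" "arc (\<gamma> j)" "path_image (\<gamma> j) \<subseteq> ball 0 1" if "j \<in> {1..r}" for j
      using \<gamma>[OF that] by auto
    fix h assume h: "h analytic_on cball 0 (1::real)"
    have hb: "h analytic_on ball 0 1" using h by (rule analytic_on_subset) auto
    have "(\<lambda>z. h z * g z) analytic_on cball 0 1" using h g by (intro analytic_intros)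
    then obtain \<rho> P where P: "\<rho> > 1" "P holomorphic_on ball 0 \<rho>" "P analytic_on cball 0 1"
      "\<And>z. z \<in> ball 0 \<rho> \<Longrightarrow> (P has_field_derivative h z * g z) (at z)"
      "\<And>z. z \<in> ball 0 \<rho> \<Longrightarrow> deriv P z = h z * g z"
      using primitive_on_cball by blast
    have sub: "ball (0::complex) 1 \<subseteq> ball 0 \<rho>" using P(1) by auto
    have "complex_of_real (1 / pi) * (LINT z:ball 0 1|lborel. h z * complex_of_real ((cmod (g z))\<^sup>2))
        = complex_of_real (1 / pi) * disk_pairing (deriv P) g"
      unfolding weighted_integral_eq_disk_pairing
      by (intro arg_cong[of _ _ "(*) _"] disk_pairing_cong) (use P(5) sub in auto)
    also have "\<dots> = jet_functional S N e P"
      using star_expansion_pairing[OF g(1) ext se P(3)] by simp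
    also have "\<dots> = (\<Sum>w\<in>S. e w 0 * P w) +
        (\<Sum>w\<in>S. \<Sum>k=1..<N. point_coeff g N e w k * (deriv ^^ (k - 1)) h w)"
      using e0 sub P(5) by (intro jet_functional_point_coeff hb gb S) auto
    also have "(\<Sum>w\<in>S. e w 0 * P w) = (\<Sum>j=1..r. c j * contour_integral (\<gamma> j) (\<lambda>\<zeta>. h \<zeta> * g \<zeta>))"
    proof -
      have "(\<Sum>w\<in>S. e w 0 * P w) = (\<Sum>w\<in>L. e w 0 * P w)"
        using LS S by (intro sum.mono_neutral_right) (auto simp: L_def)
      also have "\<dots> = (\<Sum>w\<in>L. e w 0 * P w) - (\<Sum>w\<in>L. e w 0) * P (f 0)" by (simp add: Lsum)
      also have "\<dots> = (\<Sum>w\<in>L. e w 0 * (P w - P (f 0)))"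
        by (simp add: sum_subtractf sum_distrib_right right_diff_distrib)
      also have "\<dots> = (\<Sum>j\<in>{0..<card L}. c j * (P (f j) - P (f 0)))"
        unfolding c_def by (rule sum.reindex_bij_betw[OF f, symmetric])
      also have "\<dots> = (\<Sum>j=1..r. c j * (P (f j) - P (f 0)))"
      proof (rule sum.mono_neutral_right)
        show "{1..r} \<subseteq> {0..<card L}" by (auto simp: r_def)
        show "\<forall>i\<in>{0..<card L} - {1..r}. c i * (P (f i) - P (f 0)) = 0"
        proof
          fix i assume "i \<in> {0..<card L} - {1..r}"
          then have "i = 0" by (auto simp: r_def)
          then show "c i * (P (f i) - P (f 0)) = 0" by simp
        qed
      qed simp
      also have "\<dots> = (\<Sum>j=1..r. c j * contour_integral (\<gamma> j) (\<lambda>\<zeta>. h \<zeta> * g \<zeta>))"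
      proof (intro sum.cong refl)
        fix j assume j: "j \<in> {1..r}"
        have "((\<lambda>\<zeta>. h \<zeta> * g \<zeta>) has_contour_integral (P (pathfinish (\<gamma> j)) - P (pathstart (\<gamma> j)))) (\<gamma> j)"
        proof (rule contour_integral_primitive[where S = "ball 0 1"])
          fix z :: complex assume "z \<in> ball 0 1"
          then show "(P has_field_derivative h z * g z) (at z within ball 0 1)"
            using P(4) sub by (blast intro: has_field_derivative_at_within)
        qed (use \<gamma>[OF j] in auto)
        then show "c j * (P (f j) - P (f 0)) = c j * contour_integral (\<gamma> j) (\<lambda>\<zeta>. h \<zeta> * g \<zeta>)"
          by (simp add: contour_integral_unique \<gamma>_def)
      qed
      finally show ?thesis .
    qed
    also have "(\<Sum>w\<in>S. \<Sum>k=1..<N. point_coeff g N e w k * (deriv ^^ (k - 1)) h w)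
       = (\<Sum>w\<in>\<alpha> ` {0..l}. \<Sum>k=1..<N. point_coeff g N e w k * (deriv ^^ (k - 1)) h w)"
    proof (rule sum.mono_neutral_right[OF S(1)])
      show "\<alpha> ` {0..l} \<subseteq> S" unfolding \<alpha>_im using OrS S by auto
      show "\<forall>w\<in>S - \<alpha> ` {0..l}. (\<Sum>k=1..<N. point_coeff g N e w k * (deriv ^^ (k - 1)) h w) = 0"
        unfolding \<alpha>_im using S(2) by (intro ballI sum.neutral) (auto simp: pc1)
    qed
    also have "\<dots> = (\<Sum>j=0..l. \<Sum>k=1..<N. a j k * (deriv ^^ (k - 1)) h (\<alpha> j))"
      unfolding a_def by (subst sum.reindex[OF \<alpha>_inj]) simp
    also have "\<dots> = (\<Sum>j=0..l. \<Sum>k=1..n j - 1. a j k * (deriv ^^ (k - 1)) h (\<alpha> j))"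
    proof (rule sum.cong[OF refl])
      fix j assume j: "j \<in> {0..l}"
      have n0: "n j > 0" by (simp add: n_def)
      show "(\<Sum>k=1..<N. a j k * (deriv ^^ (k - 1)) h (\<alpha> j)) = (\<Sum>k=1..n j - 1. a j k * (deriv ^^ (k - 1)) h (\<alpha> j))"
        using pc0[OF j] n0 by (intro sum.mono_neutral_cong) auto
    qed
    finally show "complex_of_real (1 / pi) * (LINT z:ball 0 1|lborel. h z * complex_of_real ((cmod (g z))\<^sup>2))
      = (\<Sum>j=1..r. c j * contour_integral (\<gamma> j) (\<lambda>\<zeta>. h \<zeta> * g \<zeta>)) +
        (\<Sum>j=0..l. \<Sum>k=1..n j - 1. a j k * (deriv ^^ (k - 1)) h (\<alpha> j))" .
  qed
  have "pole_location g l r \<alpha> \<gamma> n"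
    unfolding pole_location_def
  proof (intro exI[of _ R] conjI ext ballI)
    show "(\<Union>j\<in>{1..r}. {pathstart (\<gamma> j), pathfinish (\<gamma> j)}) = log_poles_star R"
      using ends Llog by simp
    show "\<alpha> ` {0..l} = insert 0 (ordinary_poles_star R)" using \<alpha>_im by (simp add: Or_def)
    have "w \<in> insert 0 (star_pt ` {\<zeta>. is_pole R \<zeta>})" if "w \<in> L \<union> Or" for w
    proof (cases "w = 0")
      case False
      obtain k where "e w k \<noteq> 0" using \<open>w \<in> L \<union> Or\<close> K unfolding L_def by blast
      then have "is_pole R (star_pt w)" using star_expansion_pole[OF se] False by blast
      then show ?thesis by (metis image_eqI insertI2 mem_Collect_eq star_pt_star_pt)
    qed simp
    then show "(\<Union>j\<in>{1..r}. {pathstart (\<gamma> j), pathfinish (\<gamma> j)}) \<union> \<alpha> ` {0..l} \<subseteq> insert 0 (star_pt ` {\<zeta>. is_pole R \<zeta>})"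
      unfolding ends \<alpha>_im by blast
    fix j assume j: "j \<in> {1..l}"
    have w: "\<alpha> j \<in> ball 0 1" "\<alpha> j \<noteq> 0" "\<alpha> j \<in> Or" using \<alpha>_or[OF j] Orb by auto
    show "is_pole R (star_pt (\<alpha> j))" "zorder R (star_pt (\<alpha> j)) = - int (n j)"
      using star_expansion_pole_order[OF se w(1,2), of "K (\<alpha> j)"] K[OF w(3)] j by (auto simp: n_def)
  qed
  then show ?thesis using QI by blast
qed

section \<open>Rationality from a quadrature identity\<close>

text \<open>By compactness there are finitely many zeros in the closed disk; the induction divides
  out one zero, with its full order, at a time.\<close>

lemma factor_out_zeros:
  assumes "f analytic_on cball 0 (1::real)" "f (0::complex) \<noteq> 0"
  shows "\<exists>p g. p \<noteq> 0 \<and> g analytic_on cball 0 1 \<and> (\<forall>z\<in>cball 0 1. g z \<noteq> 0) \<and> (\<forall>z. f z = poly p z * g z)"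
proof -
  have fin: "finite {z \<in> cball 0 1. f z = 0}" if f: "f analytic_on cball 0 1" "f 0 \<noteq> 0" for f :: "complex \<Rightarrow> complex"
  proof -
    obtain \<rho> where \<rho>: "\<rho> > 1" "f holomorphic_on ball (0::complex) \<rho>"
      using analytic_on_cball_holomorphic[OF f(1)] .
    show ?thesis
    proof (cases "f constant_on ball 0 \<rho>")
      case True
      then obtain c where c: "\<And>z. z \<in> ball 0 \<rho> \<Longrightarrow> f z = c" unfolding constant_on_def by blast
      have "c \<noteq> 0" using c[of 0] f(2) \<rho>(1) by simp
      moreover have "f z = c" if "z \<in> cball 0 1" for z using that \<rho>(1) by (intro c) auto
      ultimately have "{z \<in> cball 0 1. f z = 0} = {}" by auto
      then show ?thesis by (simp only: finite.emptyI)
    next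
      case False
      then show ?thesis using \<rho> by (intro holomorphic_compact_finite_zeros[of f "ball 0 \<rho>"]) auto
    qed
  qed
  show ?thesis
    using assms
  proof (induction "card {z \<in> cball 0 1. f z = 0}" arbitrary: f)
    case 0
    then have "{z \<in> cball 0 1. f z = 0} = {}" using fin[of f] by simp
    then show ?case using 0 by (intro exI[of _ 1] exI[of _ f]) auto
  next
    case (Suc n)
    then obtain u where u: "u \<in> cball 0 1" "f u = 0"
      by (metis (mono_tags, lifting) card.empty empty_Collect_eq nat.distinct(1))
    obtain m where "has_zero_order f u m" using has_zero_order_exists[OF Suc.prems u(1)] .
    then obtain r v where r: "r > 0" "v holomorphic_on ball u r" "v u \<noteq> 0"
      and v: "\<And>z. z \<in> ball u r \<Longrightarrow> f z = (z - u) ^ m * v z"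
      unfolding has_zero_order_def by blast
    have m: "m > 0" using v[of u] u r by (cases m) auto
    \<comment> \<open>The quotient with its removable singularity filled in. Since
      \<open>m > 0\<close>, the factorisation holds at \<open>u\<close> too, where both sides are
      zero.\<close>
    define g where "g = (\<lambda>z. if z = u then v u else f z / (z - u) ^ m)"
    have fg: "f z = (z - u) ^ m * g z" for z using u m by (simp add: g_def)
    have "g analytic_on {z}" if z: "z \<in> cball 0 1" for z
    proof (cases "z = u")
      case True
      have "v analytic_on {u}" using r holomorphic_ball_analytic_at by blast
      moreover have "\<forall>\<^sub>F z in nhds u. v z = g z"
        using eventually_nhds_in_open[of "ball u r" u] r v by (auto elim!: eventually_mono simp: g_def)
      ultimately show ?thesis using True by (simp add: analytic_at_cong)
    next
      case False
      have fz: "f analytic_on {z}" using Suc.prems(1) z by (auto elim: analytic_on_subset)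
      have "(\<lambda>z. f z / (z - u) ^ m) analytic_on {z}" using False by (intro analytic_intros fz) auto
      moreover have "\<forall>\<^sub>F z in nhds z. f z / (z - u) ^ m = g z"
      proof -
        have "\<forall>\<^sub>F y in nhds z. y \<in> - {u}" using False by (intro eventually_nhds_in_open) auto
        then show ?thesis by eventually_elim (simp add: g_def)
      qed
      ultimately show ?thesis by (simp add: analytic_at_cong)
    qed
    then have g: "g analytic_on cball 0 1" using analytic_on_analytic_at by blast
    have g0: "g 0 \<noteq> 0" using fg[of 0] Suc.prems(2) by auto
    have "{z \<in> cball 0 1. g z = 0} = {z \<in> cball 0 1. f z = 0} - {u}"
      using fg r by (auto simp: g_def)
    then have "card {z \<in> cball 0 1. g z = 0} = n"
      using Suc.hyps(2) u fin[OF Suc.prems] by (simp add: card_Diff_singleton)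
    then obtain p k where "p \<noteq> 0" "k analytic_on cball 0 1" "\<forall>z\<in>cball 0 1. k z \<noteq> 0" "\<forall>z. g z = poly p z * k z"
      using Suc.hyps(1)[OF _ g g0] by blast
    then show ?case
      by (intro exI[of _ "[:- u, 1:] ^ m * p"] exI[of _ k]) (auto simp: fg poly_power)
  qed
qed

text \<open>A root of \<open>B\<close> in the closed disk is also a root of \<open>A\<close>,
  because \<open>g\<close> is finite there. The common factor cancels, and continuity of
  \<open>g\<close> restores the relation at the cancelled point; the degree drops until
  \<open>B\<close> has no root in the closed disk.\<close>

lemma rational_extension_exists:
  fixes g :: "complex \<Rightarrow> complex"
  assumes \<rho>: "\<rho> > 1" "continuous_on (ball 0 \<rho>) g"
    and "B \<noteq> 0" "\<And>z. z \<in> ball 0 \<rho> \<Longrightarrow> poly B z * g z = poly A z"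
  shows "is_rational g"
  using assms(3,4)
proof (induction "degree B" arbitrary: A B rule: less_induct)
  case less
  show ?case
  proof (cases "\<exists>u\<in>cball 0 1. poly B u = 0")
    case False
    have sub: "cball (0::complex) 1 \<subseteq> ball 0 \<rho>" using \<rho>(1) by auto
    have "g z = poly A z / poly B z" if "z \<in> cball 0 1" for z
    proof -
      have "poly B z \<noteq> 0" "poly B z * g z = poly A z" using that False less.prems(2) sub by auto
      then show ?thesis by (metis nonzero_mult_div_cancel_left)
    qed
    then show ?thesis using False unfolding is_rational_def rational_extension_def
      by (intro exI[of _ "\<lambda>z. poly A z / poly B z"] exI[of _ A] exI[of _ B]) auto
  next
    case True
    then obtain u where u: "u \<in> cball 0 1" "poly B u = 0" by blast
    have ub: "u \<in> ball 0 \<rho>" using u \<rho> by auto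
    have "poly A u = 0" using less.prems(2)[OF ub] u by simp
    then obtain A1 B1 where AB: "A = [:- u, 1:] * A1" "B = [:- u, 1:] * B1"
      using u(2) by (metis poly_eq_0_iff_dvd dvdE)
    have B1: "B1 \<noteq> 0" using less.prems(1) AB by auto
    then have deg: "degree B1 < degree B" unfolding AB by (subst degree_mult_eq) auto
    define d where "d = (\<lambda>z. poly B1 z * g z - poly A1 z)"
    have d0: "d z = 0" if "z \<in> ball 0 \<rho>" "z \<noteq> u" for z
    proof -
      have "(z - u) * d z = 0" using less.prems(2)[OF that(1)] by (simp add: AB d_def algebra_simps)
      then show ?thesis using that by simp
    qed
    have "continuous_on (ball 0 \<rho>) d" unfolding d_def by (intro continuous_intros \<rho>)
    then have "isCont d u" using ub by (simp add: continuous_on_eq_continuous_at)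
    then have "d \<midarrow>u\<rightarrow> d u" by (simp add: isCont_def)
    moreover have "d \<midarrow>u\<rightarrow> 0"
    proof (rule tendsto_eventually)
      have "\<forall>\<^sub>F z in at u. z \<in> ball 0 \<rho> - {u}" using ub by (intro eventually_at_in_open) auto
      then show "\<forall>\<^sub>F z in at u. d z = 0" by eventually_elim (auto simp: d0)
    qed
    ultimately have "d u = 0" using LIM_unique by blast
    then have "poly B1 z * g z = poly A1 z" if "z \<in> ball 0 \<rho>" for z
      using d0[OF that] by (cases "z = u") (auto simp: d_def)
    then show ?thesis using less.hyps[OF deg B1] by blast
  qed
qed

section \<open>Rational formal power series\<close>

definition rational_fps :: "complex fps \<Rightarrow> bool" where
  "rational_fps F \<longleftrightarrow> (\<exists>A B. coeff B 0 \<noteq> 0 \<and> F * fps_of_poly B = fps_of_poly A)"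

lemma rational_fps_of_poly: "rational_fps (fps_of_poly A)"
  unfolding rational_fps_def by (intro exI[of _ A] exI[of _ 1]) simp

lemma rational_fps_add:
  assumes "rational_fps F" "rational_fps G"
  shows "rational_fps (F + G)"
proof -
  obtain A B C D where "coeff B 0 \<noteq> 0" "F * fps_of_poly B = fps_of_poly A"
    "coeff D 0 \<noteq> 0" "G * fps_of_poly D = fps_of_poly C"
    using assms unfolding rational_fps_def by blast
  then have "coeff (B * D) 0 \<noteq> 0"
    "(F + G) * fps_of_poly (B * D) = fps_of_poly (A * D + C * B)"
    by (simp_all add: coeff_mult fps_of_poly_mult fps_of_poly_add)
       (metis (no_types, opaque_lifting) distrib_right mult.assoc mult.commute)
  then show ?thesis unfolding rational_fps_def by blast
qed

lemma rational_fps_mult: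
  assumes "rational_fps F" "rational_fps G"
  shows "rational_fps (F * G)"
proof -
  obtain A B C D where "coeff B 0 \<noteq> 0" "F * fps_of_poly B = fps_of_poly A"
    "coeff D 0 \<noteq> 0" "G * fps_of_poly D = fps_of_poly C"
    using assms unfolding rational_fps_def by blast
  then have "coeff (B * D) 0 \<noteq> 0"
    "(F * G) * fps_of_poly (B * D) = fps_of_poly (A * C)"
    by (simp_all add: coeff_mult fps_of_poly_mult)
       (metis (no_types, opaque_lifting) mult.assoc mult.commute)
  then show ?thesis unfolding rational_fps_def by blast
qed

lemma rational_fps_const: "rational_fps (fps_const c)"
  using rational_fps_of_poly[of "[:c:]"] by (simp add: fps_of_poly_const)

lemma rational_fps_sum:
  "(\<And>i. i \<in> I \<Longrightarrow> rational_fps (F i)) \<Longrightarrow> rational_fps (\<Sum>i\<in>I. F i)"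
  by (induction I rule: infinite_finite_induct)
     (auto intro: rational_fps_add simp: rational_fps_const[of 0, simplified])

lemma fps_deriv_of_poly: "fps_deriv (fps_of_poly A) = fps_of_poly (pderiv A)"
  by (rule fps_ext) (simp add: coeff_pderiv)

lemma rational_fps_deriv:
  assumes "rational_fps F"
  shows "rational_fps (fps_deriv F)"
proof -
  obtain A B where AB: "coeff B 0 \<noteq> 0" "F * fps_of_poly B = fps_of_poly A"
    using assms unfolding rational_fps_def by blast
  have "fps_deriv F * fps_of_poly B + F * fps_of_poly (pderiv B) = fps_of_poly (pderiv A)"
    using arg_cong[OF AB(2), of fps_deriv] by (simp add: fps_deriv_of_poly algebra_simps)
  then have "(fps_deriv F * fps_of_poly B + F * fps_of_poly (pderiv B)) * fps_of_poly B = fps_of_poly (pderiv A) * fps_of_poly B"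
    by simp
  then have "fps_deriv F * fps_of_poly (B * B) + fps_of_poly (pderiv B) * (F * fps_of_poly B) = fps_of_poly (pderiv A * B)"
    by (simp add: fps_of_poly_mult algebra_simps)
  then have "fps_deriv F * fps_of_poly (B * B) = fps_of_poly (pderiv A * B - pderiv B * A)"
    unfolding AB(2) by (simp add: fps_of_poly_mult fps_of_poly_diff algebra_simps)
  moreover have "coeff (B * B) 0 \<noteq> 0" using AB by (simp add: coeff_mult)
  ultimately show ?thesis unfolding rational_fps_def by blast
qed

lemma rational_fps_cnj:
  assumes "rational_fps F"
  shows "rational_fps (Abs_fps (\<lambda>n. cnj (fps_nth F n)))"
proof -
  obtain A B where AB: "coeff B 0 \<noteq> 0" "F * fps_of_poly B = fps_of_poly A"
    using assms unfolding rational_fps_def by blast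
  have "Abs_fps (\<lambda>n. cnj (fps_nth F n)) * fps_of_poly (map_poly cnj B) = fps_of_poly (map_poly cnj A)"
  proof (rule fps_ext)
    fix n
    have "fps_nth (Abs_fps (\<lambda>n. cnj (fps_nth F n)) * fps_of_poly (map_poly cnj B)) n = cnj (fps_nth (F * fps_of_poly B) n)"
      by (simp add: fps_mult_nth coeff_map_poly)
    then show "fps_nth (Abs_fps (\<lambda>n. cnj (fps_nth F n)) * fps_of_poly (map_poly cnj B)) n = fps_nth (fps_of_poly (map_poly cnj A)) n"
      by (simp add: AB(2) coeff_map_poly)
  qed
  moreover have "coeff (map_poly cnj B) 0 \<noteq> 0" using AB by (simp add: coeff_map_poly)
  ultimately show ?thesis unfolding rational_fps_def by blast
qed

lemma rational_fps_geometric: "rational_fps (Abs_fps (\<lambda>n. b ^ Suc n))"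
  unfolding rational_fps_def
proof (intro exI conjI)
  show "Abs_fps (\<lambda>n. b ^ Suc n) * fps_of_poly [:1, - b:] = fps_of_poly [:b:]"
  proof (rule fps_ext)
    fix n
    show "fps_nth (Abs_fps (\<lambda>n. b ^ Suc n) * fps_of_poly [:1, - b:]) n = fps_nth (fps_of_poly [:b:]) n"
      by (cases n) (simp_all add: fps_of_poly_pCons fps_of_poly_const distrib_left mult.assoc[symmetric])
  qed
qed simp

text \<open>Multiplication by the reversed polynomial turns the recurrence into the vanishing of all
  coefficients of index at least \<open>degree q\<close>, so the product is a polynomial. The
  constant term of the reversed polynomial is the leading coefficient of \<open>q\<close>, hence not
  zero.\<close>

lemma rational_fps_of_recurrence:
  assumes q: "q \<noteq> 0" and rec: "\<And>n. (\<Sum>k\<le>degree q. coeff q k * U (n + k)) = 0"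
  shows "rational_fps (Abs_fps U)"
proof -
  let ?B = "reflect_poly q"
  let ?F = "Abs_fps U * fps_of_poly ?B"
  have high: "fps_nth ?F N = 0" if N: "N \<ge> degree q" for N
  proof -
    have "fps_nth ?F N = (\<Sum>i\<le>N. coeff ?B i * U (N - i))"
      by (subst mult.commute) (simp add: fps_mult_nth atLeast0AtMost)
    also have "\<dots> = (\<Sum>i\<le>degree q. coeff q (degree q - i) * U (N - i))"
      using N by (intro sum.mono_neutral_cong_right) (auto simp: coeff_reflect_poly)
    also have "\<dots> = (\<Sum>k\<le>degree q. coeff q k * U ((N - degree q) + k))"
      by (rule sum.reindex_bij_witness[of _ "\<lambda>k. degree q - k" "\<lambda>k. degree q - k"]) (use N in auto)
    finally show ?thesis using rec by simp
  qed
  define A where "A = (\<Sum>i<degree q. monom (fps_nth ?F i) i)"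
  have "?F = fps_of_poly A"
    by (rule fps_ext) (auto simp: A_def coeff_sum high not_less)
  moreover have "coeff ?B 0 \<noteq> 0" using q by simp
  ultimately show ?thesis unfolding rational_fps_def by blast
qed

lemma poly_analytic_on: "poly p analytic_on (S :: complex set)"
proof -
  have "(\<lambda>z. poly p z) analytic_on UNIV"
    by (subst analytic_on_open) (auto intro!: holomorphic_intros)
  then show ?thesis by (rule analytic_on_subset) simp
qed

lemma has_fps_expansion_poly: "poly (p :: complex poly) has_fps_expansion fps_of_poly p"
proof (induction p)
  case 0
  have "poly (0 :: complex poly) = (\<lambda>x. 0)" by auto
  then show ?case by simp
next
  case (pCons a p)
  have "(\<lambda>x. a + x * poly p x) has_fps_expansion fps_const a + fps_X * fps_of_poly p"
    by (rule has_fps_expansion_add[OF has_fps_expansion_const has_fps_expansion_mult[OF has_fps_expansion_fps_X pCons.IH]])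
  moreover have "(\<lambda>x. a + x * poly p x) = poly (pCons a p)" by auto
  ultimately show ?case by (simp add: fps_of_poly_pCons mult.commute)
qed

text \<open>The relation between the power series holds near the origin and by analytic continuation
  on a disk of radius larger than \<open>1\<close>; there the common roots can be cancelled.\<close>

lemma is_rational_of_fps:
  assumes g: "g analytic_on cball 0 1" and r: "rational_fps (fps_expansion g 0)"
  shows "is_rational g"
proof -
  obtain \<rho> where \<rho>: "\<rho> > 1" "g holomorphic_on ball 0 \<rho>"
    using analytic_on_cball_holomorphic[OF g] .
  obtain A B where AB: "coeff B 0 \<noteq> 0" "fps_expansion g 0 * fps_of_poly B = fps_of_poly A"
    using r unfolding rational_fps_def by blast
  have "g analytic_on {0}" using g by (rule analytic_on_subset) auto
  then have "g has_fps_expansion fps_expansion g 0" using analytic_at_imp_has_fps_expansion by force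
  then have "(\<lambda>z. g z * poly B z - poly A z) has_fps_expansion fps_expansion g 0 * fps_of_poly B - fps_of_poly A"
    by (intro has_fps_expansion_diff has_fps_expansion_mult has_fps_expansion_poly)
  then have "(\<lambda>z. g z * poly B z - poly A z) has_fps_expansion 0" by (simp add: AB(2))
  then have "g z * poly B z - poly A z = 0" if "z \<in> ball 0 \<rho>" for z
    using that \<rho> by (rule_tac has_fps_expansion_0_analytic_continuation[of _ "ball 0 \<rho>"]) (auto intro!: holomorphic_intros)
  moreover have "B \<noteq> 0" using AB(1) by auto
  ultimately show ?thesis
    using rational_extension_exists[OF \<rho>(1) holomorphic_on_imp_continuous_on[OF \<rho>(2)], of B A]
    by (auto simp: mult.commute)
qed

text \<open>Testing the identity with \<open>h = z\<^sup>n M / g\<^sub>0\<close>, where \<open>g = p g\<^sub>0\<close> with \<open>g\<^sub>0\<close> free of zeros and where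
  \<open>M\<close> vanishes to high order at the points \<open>\<alpha> j\<close>, removes the point evaluations and leaves a
  linear recurrence for the Taylor coefficients of \<open>g\<close>.\<close>

lemma rational_of_quadrature:
  assumes g: "g analytic_on cball 0 1" "g 0 \<noteq> 0" and qi: "quadrature_identity g l r \<alpha> \<gamma> c n a"
  shows "is_rational g"
proof -
  have \<alpha>: "inj_on \<alpha> {0..l}" "\<And>j. j \<in> {0..l} \<Longrightarrow> \<alpha> j \<in> ball 0 1 \<and> 0 < n j"
    and \<gamma>: "\<And>j. j \<in> {1..r} \<Longrightarrow> valid_path (\<gamma> j) \<and> path_image (\<gamma> j) \<subseteq> ball 0 1"
    and Q: "\<And>h. h analytic_on cball 0 1 \<Longrightarrow>
        complex_of_real (1 / pi) * disk_pairing (\<lambda>z. h z * g z) g =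
        (\<Sum>j=1..r. c j * contour_integral (\<gamma> j) (\<lambda>\<zeta>. h \<zeta> * g \<zeta>)) +
        (\<Sum>j=0..l. \<Sum>k=1..n j - 1. a j k * (deriv ^^ (k - 1)) h (\<alpha> j))"
    using qi unfolding quadrature_identity_def weighted_integral_eq_disk_pairing by auto
  obtain p g0 where p: "p \<noteq> 0" "g0 analytic_on cball 0 1" "\<And>z. z \<in> cball 0 1 \<Longrightarrow> g0 z \<noteq> 0"
    "\<And>z. g z = poly p z * g0 z"
    using factor_out_zeros[OF g] by blast
  \<comment> \<open>A zero of order \<open>n j\<close> at \<open>\<alpha> j\<close> is enough, since
    the identity uses only derivatives of order at most \<open>n j - 2\<close> there.\<close>
  define M where "M = (\<Prod>j\<in>{0..l}. [:- \<alpha> j, 1:] ^ n j)"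
  define q where "q = p * M"
  have M0: "M \<noteq> 0" by (simp add: M_def)
  have q0: "q \<noteq> 0" using p M0 by (simp add: q_def)
  \<comment> \<open>The conjugated Taylor coefficients of \<open>g\<close> with the contribution of
    the arcs removed. Dividing by \<open>i + 1\<close> gives the value that the area term minus the
    arc terms takes when \<open>h g = z^i\<close>, so \<open>U\<close> satisfies the recurrence with
    the coefficients of \<open>q = p M\<close>.\<close>
  define G where "G = (\<lambda>i. cnj (jet g 0 i) - (\<Sum>j=1..r. c j * (pathfinish (\<gamma> j) ^ Suc i - pathstart (\<gamma> j) ^ Suc i)))"
  define U where "U = (\<lambda>i. G i / of_nat (Suc i))"
  have rec: "(\<Sum>k\<le>degree q. coeff q k * U (N + k)) = 0" for N
  proof -
    define h where "h = (\<lambda>z. z ^ N * poly M z / g0 z)"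
    have h: "h analytic_on cball 0 1"
        unfolding h_def using p by (intro analytic_intros poly_analytic_on) auto
    have hg: "h z * g z = (\<Sum>k\<le>degree q. coeff q k * z ^ (N + k))" if "z \<in> cball 0 1" for z
    proof -
      have "h z * g z = z ^ N * poly q z" using p(3)[OF that] by (simp add: h_def p(4) q_def)
      then show ?thesis by (simp add: poly_altdef sum_distrib_left power_add mult_ac)
    qed
    have jets: "(deriv ^^ (k - 1)) h (\<alpha> j) = 0" if j: "j \<in> {0..l}" and k: "k \<in> {1..n j - 1}" for j k
    proof -
      define rest where "rest = (\<lambda>z. poly (\<Prod>i\<in>{0..l} - {j}. [:- \<alpha> i, 1:] ^ n i) z * (z ^ N / g0 z))"
      have hM: "h = (\<lambda>z. (z - \<alpha> j) ^ n j * rest z)"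
        using j by (auto simp: h_def rest_def M_def prod.remove poly_power)
      have \<alpha>j: "\<alpha> j \<in> cball 0 1" using \<alpha>(2)[OF j] by auto
      have g0: "g0 analytic_on {\<alpha> j}" using p(2) \<alpha>j by (auto elim: analytic_on_subset)
      have "rest analytic_on {\<alpha> j}"
        unfolding rest_def using p(3)[OF \<alpha>j] by (intro analytic_intros poly_analytic_on g0) auto
      then have "jet h (\<alpha> j) (k - 1) = 0"
        unfolding hM using k by (subst jet_mult) (auto intro!: analytic_intros sum.neutral simp: jet_power_diff)
      then show ?thesis by (simp add: jet_def)
    qed
    define P where "P = (\<lambda>z. \<Sum>k\<le>degree q. coeff q k * (z ^ Suc (N + k) / of_nat (Suc (N + k))))"
    have P: "(P has_field_derivative (\<Sum>k\<le>degree q. coeff q k * z ^ (N + k))) (at z)" for z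
      unfolding P_def
      by (intro DERIV_sum DERIV_cmult) (auto intro!: derivative_eq_intros simp del: of_nat_Suc power_Suc)
    have cint: "contour_integral (\<gamma> j) (\<lambda>\<zeta>. h \<zeta> * g \<zeta>) = P (pathfinish (\<gamma> j)) - P (pathstart (\<gamma> j))"
      if j: "j \<in> {1..r}" for j
    proof (rule contour_integral_unique)
      show "((\<lambda>\<zeta>. h \<zeta> * g \<zeta>) has_contour_integral P (pathfinish (\<gamma> j)) - P (pathstart (\<gamma> j))) (\<gamma> j)"
      proof (rule contour_integral_primitive[where S = "ball 0 1"])
        fix z :: complex assume "z \<in> ball 0 1"
        then show "(P has_field_derivative h z * g z) (at z within ball 0 1)"
          using P[of z] hg[of z] by (simp add: has_field_derivative_at_within)
      qed (use \<gamma>[OF j] in auto)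
    qed
    have "complex_of_real (1 / pi) * disk_pairing (\<lambda>z. h z * g z) g
       = complex_of_real (1 / pi) * disk_pairing (\<lambda>z. \<Sum>k\<le>degree q. coeff q k * z ^ (N + k)) g"
      by (intro arg_cong[of _ _ "(*) _"] disk_pairing_cong) (auto simp: hg)
    also have "disk_pairing (\<lambda>z. \<Sum>k\<le>degree q. coeff q k * z ^ (N + k)) g
        = (\<Sum>k\<le>degree q. coeff q k * (of_real pi * cnj (jet g 0 (N + k)) / of_nat (Suc (N + k))))"
      by (subst disk_pairing_sum_left) (auto intro!: analytic_intros g simp: disk_pairing_power_left[OF g(1)])
    also have "complex_of_real (1 / pi) * \<dots> = (\<Sum>k\<le>degree q. coeff q k * (cnj (jet g 0 (N + k)) / of_nat (Suc (N + k))))"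
      by (simp add: sum_distrib_left del: of_nat_Suc)
    finally have lhs: "complex_of_real (1 / pi) * disk_pairing (\<lambda>z. h z * g z) g
        = (\<Sum>k\<le>degree q. coeff q k * (cnj (jet g 0 (N + k)) / of_nat (Suc (N + k))))" .
    have "(\<Sum>k\<le>degree q. coeff q k * (cnj (jet g 0 (N + k)) / of_nat (Suc (N + k))))
        = (\<Sum>j=1..r. c j * (P (pathfinish (\<gamma> j)) - P (pathstart (\<gamma> j))))"
    proof -
      have "(\<Sum>j=0..l. \<Sum>k=1..n j - 1. a j k * (deriv ^^ (k - 1)) h (\<alpha> j)) = 0"
        by (rule sum.neutral, rule ballI, rule sum.neutral, rule ballI) (simp only: jets mult_zero_right)
      then show ?thesis using Q[OF h] unfolding lhs by (simp add: cint)
    qed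
    also have "\<dots> = (\<Sum>j=1..r. \<Sum>k\<le>degree q. coeff q k *
        (c j * (pathfinish (\<gamma> j) ^ Suc (N + k) - pathstart (\<gamma> j) ^ Suc (N + k)) / of_nat (Suc (N + k))))"
      by (intro sum.cong refl)
         (simp add: P_def sum_distrib_left sum_subtractf right_diff_distrib diff_divide_distrib mult_ac del: of_nat_Suc power_Suc)
    also have "\<dots> = (\<Sum>k\<le>degree q. coeff q k *
        ((\<Sum>j=1..r. c j * (pathfinish (\<gamma> j) ^ Suc (N + k) - pathstart (\<gamma> j) ^ Suc (N + k))) / of_nat (Suc (N + k))))"
      by (subst sum.swap) (simp add: sum_distrib_left sum_divide_distrib del: of_nat_Suc power_Suc)
    finally show ?thesis
      unfolding U_def G_def by (simp add: diff_divide_distrib right_diff_distrib sum_subtractf del: of_nat_Suc power_Suc)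
  qed
  \<comment> \<open>Undoing the division by \<open>i + 1\<close> is multiplication by
    \<open>X\<close> followed by differentiation, and both preserve rationality.\<close>
  have "rational_fps (fps_deriv (fps_X * Abs_fps U))"
    using rational_fps_of_recurrence[OF q0 rec] rational_fps_of_poly[of "[:0, 1:]"]
    by (intro rational_fps_deriv rational_fps_mult) (auto simp: fps_of_poly_pCons)
  moreover have "fps_deriv (fps_X * Abs_fps U) = Abs_fps G"
  proof (rule fps_ext)
    fix n
    have "fps_nth (fps_X * Abs_fps U) (Suc n) = U n" by simp
    then show "fps_nth (fps_deriv (fps_X * Abs_fps U)) n = fps_nth (Abs_fps G) n"
      by (simp only: fps_deriv_nth Suc_eq_plus1[symmetric]) (simp add: U_def del: of_nat_Suc)
  qed
  ultimately have G: "rational_fps (Abs_fps G)" by simp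
  let ?E = "\<lambda>b. Abs_fps (\<lambda>n. b ^ Suc n) :: complex fps"
  \<comment> \<open>The end points of the arcs contribute geometric series, which are rational;
    adding them back leaves the conjugated Taylor coefficients.\<close>
  have "rational_fps (Abs_fps G + (\<Sum>j=1..r. fps_const (c j) * (?E (pathfinish (\<gamma> j)) + fps_const (- 1) * ?E (pathstart (\<gamma> j)))))"
    by (intro rational_fps_add rational_fps_sum rational_fps_mult rational_fps_const rational_fps_geometric G)
  moreover have "Abs_fps G + (\<Sum>j=1..r. fps_const (c j) * (?E (pathfinish (\<gamma> j)) + fps_const (- 1) * ?E (pathstart (\<gamma> j))))
      = Abs_fps (\<lambda>i. cnj (jet g 0 i))"
    by (rule fps_ext) (simp add: G_def fps_sum_nth del: fps_const_neg power_Suc)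
  ultimately have "rational_fps (Abs_fps (\<lambda>i. cnj (jet g 0 i)))" by simp
  from rational_fps_cnj[OF this] have "rational_fps (fps_expansion g 0)"
    by (simp add: jet_eq_fps fps_nth_inverse)
  then show ?thesis by (rule is_rational_of_fps[OF g(1)])
qed

section \<open>Conformal disks in a Riemann surface\<close>

lemma nn_integral_holomorphic_image:
  assumes \<psi>: "\<psi> holomorphic_on V" "open V" "inj_on \<psi> V" and u: "u \<in> borel_measurable borel"
  shows "(\<integral>\<^sup>+y\<in>\<psi> ` V. u y \<partial>lborel) = (\<integral>\<^sup>+z\<in>V. u (\<psi> z) * ennreal ((cmod (deriv \<psi> z))\<^sup>2) \<partial>lborel)"
proof -
  note u [measurable]
  have V [measurable]: "V \<in> sets borel" using \<psi> by auto
  have \<psi>V [measurable]: "\<psi> ` V \<in> sets borel" using open_mapping_thm3[OF \<psi>] by (rule borel_open)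
  have \<psi>m [measurable]: "(\<lambda>z. if z \<in> V then \<psi> z else 0) \<in> borel_measurable borel"
    by (intro borel_measurable_continuous_on_if holomorphic_on_imp_continuous_on \<psi>) auto
  define j where "j = (\<lambda>z. indicator V z *\<^sub>R deriv \<psi> z)"
  have [measurable]: "j \<in> borel_measurable borel"
    unfolding j_def by (rule deriv_borel_measurable_on[OF \<psi>(1,2)])
  have w_eq: "(\<lambda>z. ennreal (indicator V z * (cmod (deriv \<psi> z))\<^sup>2)) = (\<lambda>z. ennreal ((cmod (j z))\<^sup>2))"
    by (auto simp: indicator_def j_def)
  have "(\<integral>\<^sup>+y\<in>\<psi> ` V. u y \<partial>lborel) = (\<integral>\<^sup>+y. u y \<partial>density lborel (indicator (\<psi> ` V)))"
    by (subst nn_integral_density) (auto simp: mult.commute)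
  also have "\<dots> = (\<integral>\<^sup>+z. u (if z \<in> V then \<psi> z else 0) \<partial>density lborel (\<lambda>z. ennreal ((cmod (j z))\<^sup>2)))"
    unfolding distr_holomorphic_image[OF \<psi>, symmetric] w_eq by (subst nn_integral_distr) auto
  also have "\<dots> = (\<integral>\<^sup>+z. ennreal ((cmod (j z))\<^sup>2) * u (if z \<in> V then \<psi> z else 0) \<partial>lborel)"
    by (rule nn_integral_density) auto
  also have "\<dots> = (\<integral>\<^sup>+z\<in>V. u (\<psi> z) * ennreal ((cmod (deriv \<psi> z))\<^sup>2) \<partial>lborel)"
    by (intro nn_integral_cong) (auto simp: j_def indicator_def mult.commute)
  finally show ?thesis .
qed

text \<open>The cover is made disjoint, after which both measures are sums over the pieces; no
  finiteness of the measures enters.\<close>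

lemma measure_eq_on_countable_cover:
  assumes sets: "sets M = sets N" and W: "\<And>i::nat. W i \<in> sets M" "(\<Union>i. W i) = space M"
    and eq: "\<And>i E. E \<in> sets M \<Longrightarrow> E \<subseteq> W i \<Longrightarrow> emeasure M E = emeasure N E"
  shows "M = N"
proof (rule measure_eqI[OF sets])
  fix E assume E: "E \<in> sets M"
  define D where "D = (\<lambda>i. E \<inter> disjointed W i)"
  have DW: "disjointed W i \<in> sets M" for i
    using sets.range_disjointed_sets[of W M] W(1) by auto
  have D: "D i \<in> sets M" "D i \<subseteq> W i" for i
    using E DW disjointed_subset[of W i] by (auto simp: D_def)
  have disj: "disjoint_family D"
    using disjoint_family_disjointed[of W] by (auto simp: D_def disjoint_family_on_def)
  have U: "(\<Union>i. D i) = E"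
    using sets.sets_into_space[OF E] W(2) UN_disjointed_eq[of W] by (auto simp: D_def)
  have "emeasure M E = (\<Sum>i. emeasure M (D i))"
    using suminf_emeasure[of D M] D disj U by (simp add: image_subset_iff)
  also have "\<dots> = (\<Sum>i. emeasure N (D i))" by (simp add: eq[OF D])
  also have "\<dots> = emeasure N E"
    using suminf_emeasure[of D N] D disj U sets by (simp add: image_subset_iff)
  finally show "emeasure M E = emeasure N E" .
qed

text \<open>The lifted disk at a single time. It is instantiated at two times on the same surface
  with the same measure, so that integrals over both domains can be compared.\<close>

locale surface_disk =
  fixes X :: "'s topology" and A p \<mu> F f
  assumes surface: "riemann_surface X A" and p: "analytic_from_surface A p"
    and area: "pullback_area X A p \<mu>" and F: "analytic_to_surface X A (ball 0 1) F"
    and inj: "inj_on F (ball 0 1)" and f: "\<And>z. z \<in> ball 0 1 \<Longrightarrow> f z = p (F z)"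
begin

text \<open>A subset of the unit disk, not of the surface: the part of the disk that the lift sends
  into the chart domain \<open>U\<close>.\<close>

definition chart_dom :: "'s set \<Rightarrow> complex set" where
  "chart_dom U = {z \<in> ball 0 1. F z \<in> U}"

lemma F_topspace: "z \<in> ball 0 1 \<Longrightarrow> F z \<in> topspace X"
  using F unfolding analytic_to_surface_def continuous_map_def by auto

lemma chart_cover: "x \<in> topspace X \<Longrightarrow> \<exists>U \<phi>. (U, \<phi>) \<in> A \<and> x \<in> U"
  using surface unfolding riemann_surface_def by auto

lemma chart:
  assumes "(U, \<phi>) \<in> A"
  shows "openin X U" "open (\<phi> ` U)" "inj_on \<phi> U"
    "continuous_map (subtopology X U) (top_of_set (\<phi> ` U)) \<phi>"
    "(p \<circ> inv_into U \<phi>) holomorphic_on \<phi> ` U"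
proof -
  have *: "openin X U \<and> open (\<phi> ` U) \<and> homeomorphic_map (subtopology X U) (top_of_set (\<phi> ` U)) \<phi>"
    using surface assms unfolding riemann_surface_def by blast
  then show "openin X U" "open (\<phi> ` U)" by auto
  have "topspace (subtopology X U) = U" using * openin_subset by fastforce
  then show "inj_on \<phi> U"
    using * homeomorphic_imp_injective_map by fastforce
  show "continuous_map (subtopology X U) (top_of_set (\<phi> ` U)) \<phi>"
    using * homeomorphic_imp_continuous_map by blast
  show "(p \<circ> inv_into U \<phi>) holomorphic_on \<phi> ` U"
    using p assms unfolding analytic_from_surface_def by blast
qed

lemma open_chart_dom:
  assumes "openin X U"
  shows "open (chart_dom U)"
proof -
  have "continuous_map (top_of_set (ball 0 1)) X F" using F unfolding analytic_to_surface_def by blast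
  then have "openin (top_of_set (ball 0 1)) {z \<in> topspace (top_of_set (ball 0 1)). F z \<in> U}"
    using assms openin_continuous_map_preimage by blast
  then show ?thesis unfolding chart_dom_def using openin_open_trans by fastforce
qed

lemma chart_map:
  assumes "(U, \<phi>) \<in> A"
  shows "(\<phi> \<circ> F) holomorphic_on chart_dom U" "inj_on (\<phi> \<circ> F) (chart_dom U)"
proof -
  show "(\<phi> \<circ> F) holomorphic_on chart_dom U"
    using F assms unfolding analytic_to_surface_def chart_dom_def by blast
  show "inj_on (\<phi> \<circ> F) (chart_dom U)"
  proof (rule comp_inj_on)
    show "inj_on F (chart_dom U)" using inj by (rule inj_on_subset) (auto simp: chart_dom_def)
    show "inj_on \<phi> (F ` chart_dom U)" using chart(3)[OF assms] by (rule inj_on_subset) (auto simp: chart_dom_def)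
  qed
qed

text \<open>The open mapping theorem in charts: \<open>\<phi> \<circ> F\<close> is an injective
  holomorphic map of plane domains, and a chart pulls its open image back to an open set of the
  surface.\<close>

lemma open_image:
  assumes G: "open G" "G \<subseteq> ball 0 1"
  shows "openin X (F ` G)"
proof (subst openin_subopen, intro ballI)
  fix x assume "x \<in> F ` G"
  then obtain z where z: "z \<in> G" "x = F z" by blast
  then obtain U \<phi> where U: "(U, \<phi>) \<in> A" "x \<in> U" using chart_cover F_topspace G by blast
  let ?V = "chart_dom U \<inter> G"
  have V: "open ?V" "?V \<subseteq> chart_dom U" using open_chart_dom[OF chart(1)[OF U(1)]] G by auto
  have "open ((\<phi> \<circ> F) ` ?V)"
    using chart_map[OF U(1)] V by (intro open_mapping_thm3) (auto elim: holomorphic_on_subset inj_on_subset)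
  moreover have sub: "(\<phi> \<circ> F) ` ?V \<subseteq> \<phi> ` U" by (auto simp: chart_dom_def)
  ultimately have "openin (top_of_set (\<phi> ` U)) ((\<phi> \<circ> F) ` ?V)" by (simp add: open_subset)
  then have "openin (subtopology X U) {y \<in> topspace (subtopology X U). \<phi> y \<in> (\<phi> \<circ> F) ` ?V}"
    using chart(4)[OF U(1)] openin_continuous_map_preimage by blast
  moreover have "{y \<in> topspace (subtopology X U). \<phi> y \<in> (\<phi> \<circ> F) ` ?V} = F ` ?V"
  proof -
    have "U \<subseteq> topspace X" using chart(1)[OF U(1)] openin_subset by blast
    then show ?thesis using chart(3)[OF U(1)] by (auto simp: chart_dom_def inj_on_def)
  qed
  ultimately have "openin X (F ` ?V)"
    using chart(1)[OF U(1)] openin_trans_full by fastforce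
  moreover have "x \<in> F ` ?V" using z U G by (auto simp: chart_dom_def)
  ultimately show "\<exists>T. openin X T \<and> x \<in> T \<and> T \<subseteq> F ` G" by blast
qed

definition \<Omega> :: "'s set" where "\<Omega> = F ` ball 0 1"

text \<open>The inverse of the lift, a global coordinate on the lifted disk. The fixed value outside
  makes it a measurable function on the whole surface.\<close>

definition Finv :: "'s \<Rightarrow> complex" where
  "Finv x = (if x \<in> \<Omega> then inv_into (ball 0 1) F x else 0)"

lemma Finv_F [simp]: "z \<in> ball 0 1 \<Longrightarrow> Finv (F z) = z"
  using inj by (auto simp: Finv_def \<Omega>_def)

lemma Finv_in_ball: "x \<in> \<Omega> \<Longrightarrow> Finv x \<in> ball 0 1" and F_Finv: "x \<in> \<Omega> \<Longrightarrow> F (Finv x) = x"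
  by (auto simp: \<Omega>_def)

lemma space_\<mu>: "space \<mu> = topspace X"
  using area by (simp add: pullback_area_def)

lemma openin_sets: "openin X U \<Longrightarrow> U \<in> sets \<mu>"
  using area by (auto simp: pullback_area_def)

lemma \<Omega>_sets [measurable]: "\<Omega> \<in> sets \<mu>"
  unfolding \<Omega>_def by (intro openin_sets open_image) auto

lemma Finv_measurable [measurable]: "Finv \<in> borel_measurable \<mu>"
proof (rule borel_measurableI)
  fix S :: "complex set" assume S: "open S"
  \<comment> \<open>The second set accounts for the default value \<open>0\<close> taken outside
    \<open>\<Omega>\<close>.\<close>
  have "Finv -` S \<inter> space \<mu> = F ` (S \<inter> ball 0 1) \<union> (if 0 \<in> S then space \<mu> - \<Omega> else {})"
  proof -
    have A: "Finv x \<in> S \<longleftrightarrow> x \<in> F ` (S \<inter> ball 0 1)" if x: "x \<in> \<Omega>" for x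
    proof -
      obtain z where z: "z \<in> ball 0 1" "x = F z" using x by (auto simp: \<Omega>_def)
      have "z \<in> S" if w: "w \<in> S" "w \<in> ball 0 1" "F z = F w" for w
        using inj_onD[OF inj w(3) z(1) w(2)] w(1) by simp
      then show ?thesis using z by auto
    qed
    have B: "Finv x = 0" if "x \<notin> \<Omega>" for x using that by (simp add: Finv_def)
    have C: "\<Omega> \<subseteq> space \<mu>" "F ` (S \<inter> ball 0 1) \<subseteq> \<Omega>" using F_topspace by (auto simp: space_\<mu> \<Omega>_def)
    show ?thesis
    proof (rule set_eqI)
      fix x
      show "x \<in> Finv -` S \<inter> space \<mu> \<longleftrightarrow> x \<in> F ` (S \<inter> ball 0 1) \<union> (if 0 \<in> S then space \<mu> - \<Omega> else {})"
      proof (cases "x \<in> \<Omega>")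
        case True
        then have "x \<in> space \<mu>" using C by blast
        then show ?thesis using A[OF True] True by (simp only: vimage_eq Int_iff Un_iff) auto
      next
        case False
        then have "x \<notin> F ` (S \<inter> ball 0 1)" using C by blast
        then show ?thesis using B[OF False] False by (simp only: vimage_eq Int_iff Un_iff) auto
      qed
    qed
  qed
  moreover have "F ` (S \<inter> ball 0 1) \<in> sets \<mu>"
    using S by (intro openin_sets open_image) auto
  ultimately show "Finv -` S \<inter> space \<mu> \<in> sets \<mu>" by auto
qed

lemma image_borel:
  assumes E: "E \<in> sets borel" "E \<subseteq> ball 0 1"
  shows "F ` E \<in> sets \<mu>"
proof -
  have "F ` E = (Finv -` E \<inter> space \<mu>) \<inter> \<Omega>"
  proof
    show "F ` E \<subseteq> (Finv -` E \<inter> space \<mu>) \<inter> \<Omega>"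
      using E F_topspace by (auto simp: space_\<mu> \<Omega>_def)
    show "(Finv -` E \<inter> space \<mu>) \<inter> \<Omega> \<subseteq> F ` E"
      using F_Finv by (metis IntE image_eqI subsetI vimage_eq)
  qed
  then show ?thesis using measurable_sets[OF Finv_measurable E(1)] by auto
qed

lemma f_deriv:
  assumes U: "(U, \<phi>) \<in> A" and z: "z \<in> chart_dom U"
  shows "deriv f z = deriv (p \<circ> inv_into U \<phi>) (\<phi> (F z)) * deriv (\<phi> \<circ> F) z"
proof -
  let ?q = "p \<circ> inv_into U \<phi>"
  have "(\<phi> \<circ> F has_field_derivative deriv (\<phi> \<circ> F) z) (at z)"
    using holomorphic_derivI[OF chart_map(1)[OF U] open_chart_dom[OF chart(1)[OF U]] z] .
  moreover have "\<phi> (F z) \<in> \<phi> ` U" using z by (auto simp: chart_dom_def)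
  then have "(?q has_field_derivative deriv ?q (\<phi> (F z))) (at (\<phi> (F z)))"
    using holomorphic_derivI[OF chart(5,2)[OF U]] by blast
  ultimately have "(?q \<circ> (\<phi> \<circ> F) has_field_derivative deriv ?q (\<phi> (F z)) * deriv (\<phi> \<circ> F) z) (at z)"
    by (intro DERIV_chain) auto
  then have "(f has_field_derivative deriv ?q (\<phi> (F z)) * deriv (\<phi> \<circ> F) z) (at z)"
  proof (rule has_field_derivative_transform_within_open)
    show "open (chart_dom U)" by (rule open_chart_dom[OF chart(1)[OF U]])
    show "z \<in> chart_dom U" by fact
    fix w assume "w \<in> chart_dom U"
    then show "(?q \<circ> (\<phi> \<circ> F)) w = f w"
      using chart(3)[OF U] f by (auto simp: chart_dom_def)
  qed
  then show ?thesis by (rule DERIV_imp_deriv)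
qed

lemma f_holomorphic: "f holomorphic_on ball 0 1"
proof -
  have "f field_differentiable at z" if z: "z \<in> ball 0 1" for z
  proof -
    obtain U \<phi> where U: "(U, \<phi>) \<in> A" "F z \<in> U" using chart_cover F_topspace[OF z] by blast
    have zU: "z \<in> chart_dom U" using U z by (simp add: chart_dom_def)
    have "(p \<circ> inv_into U \<phi>) \<circ> (\<phi> \<circ> F) holomorphic_on chart_dom U"
      by (rule holomorphic_on_compose_gen[OF chart_map(1)[OF U(1)] chart(5)[OF U(1)]]) (auto simp: chart_dom_def)
    moreover have "((p \<circ> inv_into U \<phi>) \<circ> (\<phi> \<circ> F)) w = f w" if "w \<in> chart_dom U" for w
      using chart(3)[OF U(1)] f that by (auto simp: chart_dom_def)
    ultimately have "f holomorphic_on chart_dom U" using holomorphic_cong[OF refl] by metis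
    then show ?thesis
      using holomorphic_on_imp_differentiable_at open_chart_dom[OF chart(1)[OF U(1)]] zU by blast
  qed
  then show ?thesis by (auto simp: holomorphic_on_def field_differentiable_at_within)
qed

text \<open>In the chart the area has density \<open>\<bar>q'\<bar>\<^sup>2\<close>, with
  \<open>q\<close> the local expression of \<open>p\<close>; the change of variables by
  \<open>\<phi> \<circ> F\<close> multiplies this by the squared modulus of its derivative, and the
  chain rule turns the product into that of \<open>f'\<close>.\<close>

lemma emeasure_chart:
  assumes U: "(U, \<phi>) \<in> A" and E: "E \<in> sets borel" "E \<subseteq> chart_dom U"
  shows "emeasure \<mu> (F ` E) = (\<integral>\<^sup>+z\<in>E. ennreal ((cmod (deriv f z))\<^sup>2) \<partial>lborel)"
proof -
  let ?q = "p \<circ> inv_into U \<phi>" and ?\<psi> = "\<phi> \<circ> F" and ?V = "chart_dom U"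
  have V: "open ?V" by (rule open_chart_dom[OF chart(1)[OF U]])
  note \<psi> = chart_map(1)[OF U] V chart_map(2)[OF U]
  have \<psi>E [measurable]: "?\<psi> ` E \<in> sets borel" by (rule holomorphic_image_borel[OF \<psi> E])
  have "E \<subseteq> ball 0 1" using E by (auto simp: chart_dom_def)
  then have B: "F ` E \<in> sets \<mu>" using image_borel E by blast
  have FU: "F ` E \<subseteq> U" using E by (auto simp: chart_dom_def)
  define j where "j = (\<lambda>y. indicator (\<phi> ` U) y *\<^sub>R deriv ?q y)"
  have [measurable]: "j \<in> borel_measurable borel"
    unfolding j_def by (rule deriv_borel_measurable_on[OF chart(5,2)[OF U]])
  define u where "u = (\<lambda>y. ennreal ((cmod (j y))\<^sup>2) * indicator (?\<psi> ` E) y)"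
  have um: "u \<in> borel_measurable borel" unfolding u_def by measurable
  have "emeasure \<mu> (F ` E) = (\<integral>\<^sup>+z\<in>\<phi> ` (F ` E). ennreal ((cmod (deriv ?q z))\<^sup>2) \<partial>lborel)"
    using area U B FU unfolding pullback_area_def by blast
  also have "\<dots> = (\<integral>\<^sup>+y\<in>?\<psi> ` ?V. u y \<partial>lborel)"
    using E FU by (intro nn_integral_cong) (auto simp: u_def j_def indicator_def chart_dom_def)
  also have "\<dots> = (\<integral>\<^sup>+z\<in>?V. u (?\<psi> z) * ennreal ((cmod (deriv ?\<psi> z))\<^sup>2) \<partial>lborel)"
    by (rule nn_integral_holomorphic_image[OF \<psi> um])
  also have "\<dots> = (\<integral>\<^sup>+z\<in>E. ennreal ((cmod (deriv f z))\<^sup>2) \<partial>lborel)"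
  proof (intro nn_integral_cong)
    fix z
    have mem: "?\<psi> z \<in> ?\<psi> ` E \<longleftrightarrow> z \<in> E" if "z \<in> ?V"
      using \<psi>(3) E(2) that by (auto simp: inj_on_def)
    show "u (?\<psi> z) * ennreal ((cmod (deriv ?\<psi> z))\<^sup>2) * indicator ?V z = ennreal ((cmod (deriv f z))\<^sup>2) * indicator E z"
    proof (cases "z \<in> E")
      case True
      then have zV: "z \<in> ?V" using E by blast
      then have "\<phi> (F z) \<in> \<phi> ` U" by (auto simp: chart_dom_def)
      then have "u (?\<psi> z) = ennreal ((cmod (deriv ?q (\<phi> (F z))))\<^sup>2)"
        using mem[OF zV] True by (simp add: u_def j_def)
      then show ?thesis using True zV
        by (simp add: f_deriv[OF U zV] norm_mult power_mult_distrib ennreal_mult)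
    next
      case False
      then show ?thesis using mem by (cases "z \<in> ?V") (auto simp: u_def)
    qed
  qed
  finally show ?thesis .
qed

text \<open>The surface is not assumed to be second countable, but the disk is Lindelof, so countably many
  charts suffice.\<close>

lemma distr_Finv:
  "distr (density \<mu> (indicator \<Omega>)) borel Finv = density lborel (\<lambda>z. ennreal (indicator (ball 0 1) z * (cmod (deriv f z))\<^sup>2))"
    (is "?M = ?N")
proof -
  define j where "j = (\<lambda>z. indicator (ball 0 1) z *\<^sub>R deriv f z)"
  have [measurable]: "j \<in> borel_measurable borel"
    unfolding j_def by (rule deriv_borel_measurable_on[OF f_holomorphic]) auto
  have w_eq: "(\<lambda>z. ennreal (indicator (ball 0 1) z * (cmod (deriv f z))\<^sup>2)) = (\<lambda>z. ennreal ((cmod (j z))\<^sup>2))"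
    by (auto simp: indicator_def j_def)
  have M: "emeasure ?M E = emeasure \<mu> (F ` (E \<inter> ball 0 1))" if E: "E \<in> sets borel" for E
  proof -
    have [measurable]: "Finv -` E \<inter> space \<mu> \<in> sets \<mu>" using measurable_sets[OF Finv_measurable E] .
    have "emeasure ?M E = emeasure (density \<mu> (indicator \<Omega>)) (Finv -` E \<inter> space \<mu>)"
      using E by (subst emeasure_distr) auto
    also have "\<dots> = (\<integral>\<^sup>+x. indicator \<Omega> x * indicator (Finv -` E \<inter> space \<mu>) x \<partial>\<mu>)"
      by (rule emeasure_density) auto
    also have "\<dots> = (\<integral>\<^sup>+x. indicator (\<Omega> \<inter> (Finv -` E \<inter> space \<mu>)) x \<partial>\<mu>)"
      by (simp add: indicator_inter_arith)
    also have "\<dots> = emeasure \<mu> (\<Omega> \<inter> (Finv -` E \<inter> space \<mu>))"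
      by (rule nn_integral_indicator) auto
    also have "\<Omega> \<inter> (Finv -` E \<inter> space \<mu>) = F ` (E \<inter> ball 0 1)"
      using F_topspace by (auto simp: \<Omega>_def space_\<mu>)
    finally show ?thesis .
  qed
  have N: "emeasure ?N E = (\<integral>\<^sup>+z\<in>E \<inter> ball 0 1. ennreal ((cmod (deriv f z))\<^sup>2) \<partial>lborel)" if E: "E \<in> sets borel" for E
  proof -
    have "emeasure ?N E = (\<integral>\<^sup>+z. ennreal ((cmod (j z))\<^sup>2) * indicator E z \<partial>lborel)"
      unfolding w_eq using E by (intro emeasure_density) auto
    also have "\<dots> = (\<integral>\<^sup>+z\<in>E \<inter> ball 0 1. ennreal ((cmod (deriv f z))\<^sup>2) \<partial>lborel)"
      by (intro nn_integral_cong) (auto simp: j_def indicator_def)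
    finally show ?thesis .
  qed
  define \<V> where "\<V> = {chart_dom U |U \<phi>. (U, \<phi>) \<in> A}"
  have op\<V>: "open G" if "G \<in> \<V>" for G using that open_chart_dom chart(1) unfolding \<V>_def by blast
  obtain \<C> where \<C>: "\<C> \<subseteq> \<V>" "countable \<C>" "\<Union>\<C> = \<Union>\<V>"
    using Lindelof[of \<V>] op\<V> by metis
  have cov: "\<Union>\<C> = ball 0 1"
  proof -
    have "z \<in> \<Union>\<V>" if z: "z \<in> ball 0 1" for z
    proof -
      obtain U \<phi> where "(U, \<phi>) \<in> A" "F z \<in> U" using chart_cover F_topspace[OF z] by blast
      then show ?thesis using z unfolding \<V>_def chart_dom_def by blast
    qed
    then show ?thesis unfolding \<C>(3) by (auto simp: \<V>_def chart_dom_def)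
  qed
  \<comment> \<open>The complement of the disk is added so that the family covers the plane; both
    measures vanish on its subsets.\<close>
  define \<D> where "\<D> = insert (- ball 0 1) \<C>"
  have \<D>: "countable \<D>" "\<D> \<noteq> {}" using \<C> by (auto simp: \<D>_def)
  have rng: "range (from_nat_into \<D>) = \<D>" by (rule range_from_nat_into[OF \<D>(2,1)])
  show ?thesis
  proof (rule measure_eq_on_countable_cover[where W = "from_nat_into \<D>"])
    show "sets ?M = sets ?N" by simp
    have "G \<in> sets borel" if "G \<in> \<D>" for G using that op\<V> \<C>(1) by (auto simp: \<D>_def)
    then show "from_nat_into \<D> i \<in> sets ?M" for i using rng by (simp add: from_nat_into[OF \<D>(2)])
    show "(\<Union>i. from_nat_into \<D> i) = space ?M"
      using rng cov by (auto simp: \<D>_def)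
    fix i E assume E: "E \<in> sets ?M" "E \<subseteq> from_nat_into \<D> i"
    then have Eb: "E \<in> sets borel" by simp
    have mem: "from_nat_into \<D> i \<in> \<D>" by (rule from_nat_into[OF \<D>(2)])
    consider "E \<inter> ball 0 1 = {}" | U \<phi> where "(U, \<phi>) \<in> A" "E \<subseteq> chart_dom U"
    proof (cases "from_nat_into \<D> i \<in> \<C>")
      case True
      then obtain U \<phi> where "(U, \<phi>) \<in> A" "from_nat_into \<D> i = chart_dom U"
        using \<C>(1) unfolding \<V>_def by blast
      then show ?thesis using that(2) E(2) by blast
    next
      case False
      then have "from_nat_into \<D> i = - ball 0 1" using mem unfolding \<D>_def by blast
      then show ?thesis using that(1) E(2) by blast
    qed
    then show "emeasure ?M E = emeasure ?N E"
    proof cases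
      case 1 then show ?thesis using M[OF Eb] N[OF Eb] by simp
    next
      case 2
      then have "E \<inter> ball 0 1 = E" by (auto simp: chart_dom_def)
      then show ?thesis using M[OF Eb] N[OF Eb] emeasure_chart[OF 2(1) Eb 2(2)] by simp
    qed
  qed
qed

text \<open>Measurability is asked for in the coordinate of the disk. This allows integrands written
  with the inverse of another, larger disk.\<close>

lemma set_integral_\<Omega>:
  fixes v :: "'s \<Rightarrow> real"
  assumes v: "(\<lambda>z. indicator (ball 0 1) z * v (F z)) \<in> borel_measurable borel"
  shows "(LINT x:\<Omega>|\<mu>. v x) = (LINT z:ball 0 1|lborel. (cmod (deriv f z))\<^sup>2 * v (F z))"
proof -
  define w where "w = (\<lambda>z. indicator (ball 0 1) z * v (F z))"
  have [measurable]: "w \<in> borel_measurable borel" using v by (simp add: w_def)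
  define j where "j = (\<lambda>z. indicator (ball 0 1) z *\<^sub>R deriv f z)"
  have [measurable]: "j \<in> borel_measurable borel"
    unfolding j_def by (rule deriv_borel_measurable_on[OF f_holomorphic]) auto
  have w_eq: "(\<lambda>z. indicator (ball 0 1) z * (cmod (deriv f z))\<^sup>2) = (\<lambda>z. (cmod (j z))\<^sup>2)"
    by (auto simp: indicator_def j_def)
  have "(LINT x:\<Omega>|\<mu>. v x) = (LINT x|\<mu>. indicator \<Omega> x *\<^sub>R w (Finv x))"
    unfolding set_lebesgue_integral_def w_def
    by (intro Bochner_Integration.integral_cong refl) (auto simp: indicator_def F_Finv dest: Finv_in_ball)
  also have "\<dots> = (LINT x|density \<mu> (indicator \<Omega>). w (Finv x))"
    using integral_density[of "\<lambda>x. w (Finv x)" \<mu> "indicator \<Omega>"] by (simp add: ennreal_indicator)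
  also have "\<dots> = (LINT z|distr (density \<mu> (indicator \<Omega>)) borel Finv. w z)"
    by (rule integral_distr[symmetric]) auto
  also have "\<dots> = (LINT z|lborel. (indicator (ball 0 1) z * (cmod (deriv f z))\<^sup>2) *\<^sub>R w z)"
    unfolding distr_Finv using w_eq by (intro integral_density) auto
  also have "\<dots> = (LINT z:ball 0 1|lborel. (cmod (deriv f z))\<^sup>2 * v (F z))"
    unfolding set_lebesgue_integral_def w_def
    by (intro Bochner_Integration.integral_cong refl) (auto simp: indicator_def)
  finally show ?thesis .
qed

end

section \<open>Weak solutions\<close>

lemma has_integral_mean_value:
  assumes h: "h holomorphic_on G" "open G" and G: "cball a r \<subseteq> G" "0 < r"
  shows "((\<lambda>\<theta>. Re (h (a + complex_of_real r * cis \<theta>))) has_integral (2 * pi * Re (h a))) {0..2 * pi}"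
proof -
  have "h holomorphic_on cball a r" using h G holomorphic_on_subset by blast
  then have "((\<lambda>u. h u / (u - a)) has_contour_integral 2 * of_real pi * \<i> * h a) (circlepath a r)"
    by (rule Cauchy_integral_circlepath_simple) (use G in auto)
  then have "((\<lambda>t. h (a + r * cis t) / (a + r * cis t - a) * r * \<i> * cis t)
      has_integral 2 * of_real pi * \<i> * h a) {0..2 * pi}"
    unfolding circlepath_def by (rule has_contour_integral_part_circlepath_iff[THEN iffD1, rotated]) simp
  then have "((\<lambda>t. \<i> * h (a + r * cis t)) has_integral \<i> * (2 * of_real pi * h a)) {0..2 * pi}"
  proof (rule has_integral_eq_rhs[OF has_integral_eq[rotated]])
    fix t :: real
    show "h (a + r * cis t) / (a + r * cis t - a) * r * \<i> * cis t = \<i> * h (a + r * cis t)"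
      using G by simp
  qed simp
  then have "((\<lambda>t. (- \<i>) * (\<i> * h (a + r * cis t))) has_integral (- \<i>) * (\<i> * (2 * of_real pi * h a))) {0..2 * pi}"
    by (rule has_integral_mult_right)
  then have "((\<lambda>t. h (a + r * cis t)) has_integral 2 * of_real pi * h a) {0..2 * pi}"
    by (simp add: mult.assoc[symmetric])
  from has_integral_linear[OF this bounded_linear_Re] show ?thesis
    by (simp add: o_def)
qed

text \<open>The real part is harmonic, so the sub-mean value inequality holds with equality by
  Cauchy's formula on the circle. Subtracting from an upper bound \<open>C\<close> makes the
  integrand nonnegative, which matches the nonnegative integral in the definition.\<close>

lemma subharmonic_on_Re:
  assumes h: "h holomorphic_on G" "open G"
  shows "subharmonic_on (\<lambda>z. ereal (Re (h z))) G"
  unfolding subharmonic_on_def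
proof (intro conjI allI impI ballI)
  show "ereal (Re (h z)) < \<infinity>" for z by simp
  have cont: "continuous_on G h" using h holomorphic_on_imp_continuous_on by blast
  show "openin (top_of_set G) {z \<in> G. ereal (Re (h z)) < c}" for c
  proof -
    have "continuous_on G (\<lambda>z. ereal (Re (h z)))" by (intro continuous_intros continuous_on_ereal cont)
    then have "openin (top_of_set G) (G \<inter> (\<lambda>z. ereal (Re (h z))) -` {..<c})"
      by (intro continuous_openin_preimage_gen) auto
    moreover have "G \<inter> (\<lambda>z. ereal (Re (h z))) -` {..<c} = {z \<in> G. ereal (Re (h z)) < c}" by auto
    ultimately show ?thesis by simp
  qed
  fix a r C assume *: "0 < r \<and> cball a r \<subseteq> G \<and> (\<forall>z\<in>sphere a r. ereal (Re (h z)) \<le> ereal C)"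
  define w where "w = (\<lambda>\<theta>. C - Re (h (a + complex_of_real r * cis \<theta>)))"
  have sph: "a + complex_of_real r * cis \<theta> \<in> sphere a r" for \<theta>
    using * by (simp add: dist_norm norm_mult)
  have w0: "w \<theta> \<ge> 0" for \<theta> using * sph[of \<theta>] by (auto simp: w_def)
  have "(w has_integral (2 * pi * C - 2 * pi * Re (h a))) {0..2 * pi}"
    unfolding w_def using has_integral_const_real[of C 0 "2 * pi"]
    by (intro has_integral_diff has_integral_mean_value[OF h]) (use * in auto)
  then have I: "((\<lambda>\<theta>. indicator {0..2 * pi} \<theta> * w \<theta>) has_integral (2 * pi * (C - Re (h a)))) UNIV"
    by (subst (asm) has_integral_restrict_UNIV[symmetric], elim has_integral_eq_rhs[OF has_integral_eq[rotated]])
       (simp_all add: indicator_def right_diff_distrib)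
  have "continuous_on UNIV (\<lambda>\<theta>. h (a + complex_of_real r * cis \<theta>))"
  proof (rule continuous_on_compose2[OF cont])
    show "continuous_on UNIV (\<lambda>\<theta>. a + complex_of_real r * cis \<theta>)" by (intro continuous_intros)
    show "(\<lambda>\<theta>. a + complex_of_real r * cis \<theta>) ` UNIV \<subseteq> G" using sph * by force
  qed
  then have "continuous_on UNIV w" unfolding w_def by (intro continuous_intros)
  then have [measurable]: "w \<in> borel_measurable borel" by (rule borel_measurable_continuous_onI)
  have nn0: "(\<integral>\<^sup>+\<theta>. ennreal (indicator {0..2 * pi} \<theta> * w \<theta>) \<partial>lborel) = ennreal (2 * pi * (C - Re (h a)))"
    by (rule nn_integral_has_integral_lborel[OF _ _ I]) (use w0 in \<open>auto simp: indicator_def\<close>)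
  have nonneg: "0 \<le> 2 * pi * (C - Re (h a))"
    using has_integral_nonneg[OF I] w0 by (auto simp: indicator_def)
  have "(\<integral>\<^sup>+\<theta>\<in>{0..2 * pi}. e2ennreal (ereal C - ereal (Re (h (a + complex_of_real r * cis \<theta>)))) \<partial>lborel)
     = (\<integral>\<^sup>+\<theta>. ennreal (indicator {0..2 * pi} \<theta> * w \<theta>) \<partial>lborel)"
    by (intro nn_integral_cong) (auto simp: w_def indicator_def e2ennreal_ereal)
  then have "enn2ereal (\<integral>\<^sup>+\<theta>\<in>{0..2 * pi}. e2ennreal (ereal C - ereal (Re (h (a + complex_of_real r * cis \<theta>)))) \<partial>lborel)
     = ereal (2 * pi * (C - Re (h a)))"
    unfolding nn0 using nonneg by (simp add: enn2ereal_ennreal)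
  then show "enn2ereal (\<integral>\<^sup>+\<theta>\<in>{0..2 * pi}. e2ennreal (ereal C - ereal (Re (h (a + complex_of_real r * cis \<theta>)))) \<partial>lborel)
     \<le> ereal (2 * pi) * (ereal C - ereal (Re (h a)))"
    by simp
qed

context surface_disk
begin

lemma chart_inverse:
  assumes U: "(U, \<phi>) \<in> A"
  shows "open ((\<phi> \<circ> F) ` chart_dom U)"
    "(Finv \<circ> inv_into U \<phi>) holomorphic_on (\<phi> \<circ> F) ` chart_dom U"
    "(\<phi> \<circ> F) ` chart_dom U = \<phi> ` (U \<inter> \<Omega>)"
proof -
  have V: "open (chart_dom U)" by (rule open_chart_dom[OF chart(1)[OF U]])
  note \<psi> = chart_map(1)[OF U] V chart_map(2)[OF U]
  show "open ((\<phi> \<circ> F) ` chart_dom U)" by (rule open_mapping_thm3[OF \<psi>])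
  obtain \<xi> where \<xi>: "\<xi> holomorphic_on ((\<phi> \<circ> F) ` chart_dom U)" "\<And>z. z \<in> chart_dom U \<Longrightarrow> \<xi> ((\<phi> \<circ> F) z) = z"
    using holomorphic_has_inverse[OF \<psi>] by metis
  have "\<xi> y = (Finv \<circ> inv_into U \<phi>) y" if y: "y \<in> (\<phi> \<circ> F) ` chart_dom U" for y
  proof -
    obtain z where z: "z \<in> chart_dom U" "y = \<phi> (F z)" using y by auto
    then have "inv_into U \<phi> y = F z" using chart(3)[OF U] by (simp add: chart_dom_def)
    then show ?thesis using \<xi>(2)[OF z(1)] z by (simp add: chart_dom_def)
  qed
  then show "(Finv \<circ> inv_into U \<phi>) holomorphic_on (\<phi> \<circ> F) ` chart_dom U"
    using \<xi>(1) holomorphic_cong[OF refl] by metis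
  show "(\<phi> \<circ> F) ` chart_dom U = \<phi> ` (U \<inter> \<Omega>)"
    by (auto simp: chart_dom_def \<Omega>_def)
qed

text \<open>\<open>Finv\<close> is holomorphic in every chart, so \<open>K \<circ> Finv\<close> is
  holomorphic on the lifted disk. Since the negative of \<open>K\<close> is equally admissible,
  every such function can be tested with both signs.\<close>

lemma surface_subharmonic_Re:
  assumes K: "K holomorphic_on ball 0 1"
  shows "surface_subharmonic_on A (\<lambda>x. ereal (Re (K (Finv x)))) \<Omega>"
  unfolding surface_subharmonic_on_def
proof clarify
  fix U \<phi> assume U: "(U, \<phi>) \<in> A"
  note c = chart_inverse[OF U]
  have "K \<circ> (Finv \<circ> inv_into U \<phi>) holomorphic_on (\<phi> \<circ> F) ` chart_dom U"
  proof (rule holomorphic_on_compose_gen[OF c(2) K])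
    show "(Finv \<circ> inv_into U \<phi>) ` (\<phi> \<circ> F) ` chart_dom U \<subseteq> ball 0 1"
      using chart(3)[OF U] by (auto simp: chart_dom_def)
  qed
  from subharmonic_on_Re[OF this c(1)]
  show "subharmonic_on ((\<lambda>x. ereal (Re (K (Finv x)))) \<circ> inv_into U \<phi>) (\<phi> ` (U \<inter> \<Omega>))"
    by (simp add: o_def c(3)[symmetric])
qed

lemma Re_comp_measurable:
  assumes "continuous_on (ball 0 1) K"
  shows "(\<lambda>z. indicator (ball 0 1) z * Re (K z)) \<in> borel_measurable borel"
  using borel_measurable_continuous_on_indicator[of "ball 0 1" "\<lambda>z. Re (K z)"] assms
  by (simp add: continuous_on_Re)

text \<open>The lifted disk has finite area because \<open>f'\<close> is bounded on the closed disk,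
  so boundedness of \<open>K\<close> suffices for integrability.\<close>

lemma integrable_Re:
  assumes K: "K holomorphic_on ball 0 1" and B: "\<And>z. z \<in> ball 0 1 \<Longrightarrow> cmod (K z) \<le> B"
    and f: "f analytic_on cball 0 1"
  shows "integrable_ereal_on \<mu> \<Omega> (\<lambda>x. ereal (Re (K (Finv x))))"
proof -
  define w where "w = (\<lambda>z. indicator (ball 0 1) z * Re (K z))"
  have [measurable]: "w \<in> borel_measurable borel"
    unfolding w_def by (rule Re_comp_measurable[OF holomorphic_on_imp_continuous_on[OF K]])
  have eq: "(\<lambda>x. indicator \<Omega> x *\<^sub>R Re (K (Finv x))) = (\<lambda>x. indicator \<Omega> x *\<^sub>R w (Finv x))"
  proof
    fix x show "indicator \<Omega> x *\<^sub>R Re (K (Finv x)) = indicator \<Omega> x *\<^sub>R w (Finv x)"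
      using Finv_in_ball[of x] by (cases "x \<in> \<Omega>") (simp_all add: w_def)
  qed
  have m: "(\<lambda>x. indicator \<Omega> x *\<^sub>R Re (K (Finv x))) \<in> borel_measurable \<mu>"
    unfolding eq by measurable
  obtain C where C: "C > 0" "\<And>z. z \<in> cball 0 1 \<Longrightarrow> cmod (deriv f z) \<le> C"
    using analytic_on_cball_bounded[OF analytic_deriv[OF f]] by blast
  define j where "j = (\<lambda>z. indicator (ball 0 1) z *\<^sub>R deriv f z)"
  have [measurable]: "j \<in> borel_measurable borel"
    unfolding j_def by (rule deriv_borel_measurable_on[OF f_holomorphic]) auto
  have w_eq: "(\<lambda>z. ennreal (indicator (ball 0 1) z * (cmod (deriv f z))\<^sup>2)) = (\<lambda>z. ennreal ((cmod (j z))\<^sup>2))"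
    by (auto simp: indicator_def j_def)
  have fin: "emeasure \<mu> \<Omega> < \<infinity>"
  proof -
    have "emeasure \<mu> \<Omega> = emeasure (density \<mu> (indicator \<Omega>)) (space \<mu>)"
      using sets.sets_into_space[OF \<Omega>_sets]
      by (subst emeasure_density) (auto simp: indicator_inter_arith[symmetric] Int_absorb2)
    also have "\<dots> = emeasure (distr (density \<mu> (indicator \<Omega>)) borel Finv) UNIV"
      by (subst emeasure_distr) auto
    also have "\<dots> = (\<integral>\<^sup>+z. ennreal ((cmod (j z))\<^sup>2) \<partial>lborel)"
      unfolding distr_Finv w_eq by (subst emeasure_density) auto
    also have "\<dots> \<le> (\<integral>\<^sup>+z. ennreal (C\<^sup>2) * indicator (ball (0::complex) 1) z \<partial>lborel)"
      using C by (intro nn_integral_mono) (auto simp: j_def indicator_def intro!: power_mono)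
    also have "\<dots> = ennreal (C\<^sup>2) * emeasure lborel (ball (0::complex) 1)"
      by (rule nn_integral_cmult_indicator) simp
    also have "\<dots> < \<infinity>"
      using emeasure_lborel_ball_finite[of "0::complex" 1] by (simp add: ennreal_mult_less_top)
    finally show ?thesis .
  qed
  have "set_integrable \<mu> \<Omega> (\<lambda>x. Re (K (Finv x)))"
    unfolding set_integrable_def
  proof (rule integrableI_bounded_set[OF \<Omega>_sets m fin, of B])
    show "AE x in \<mu>. x \<in> \<Omega> \<longrightarrow> norm (indicat_real \<Omega> x *\<^sub>R Re (K (Finv x))) \<le> B"
    proof (intro AE_I2 impI)
      fix x assume x: "x \<in> \<Omega>"
      have "\<bar>Re (K (Finv x))\<bar> \<le> cmod (K (Finv x))" by (rule abs_Re_le_cmod)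
      also have "\<dots> \<le> B" by (rule B[OF Finv_in_ball[OF x]])
      finally show "norm (indicat_real \<Omega> x *\<^sub>R Re (K (Finv x))) \<le> B" using x by simp
    qed
  qed (auto intro!: AE_I2)
  then show ?thesis unfolding integrable_ereal_on_def by simp
qed

end

text \<open>\<open>\<Phi>\<close> is the lift at time \<open>s\<close> read in the coordinate of the
  lift at time \<open>t\<close>; it is defined because the domains increase. The test function lives
  on the larger domain, as a function \<open>K\<close> of its coordinate, so on the smaller one it
  becomes \<open>K \<circ> \<Phi>\<close>.\<close>

lemma weak_solution_transport:
  fixes F :: "real \<Rightarrow> complex \<Rightarrow> complex"
  assumes ws: "weak_solution TYPE('s) I q F" and st: "s \<in> I" "t \<in> I" "s < t"
    and an: "F s analytic_on cball 0 1" "F t analytic_on cball 0 1"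
  obtains \<Phi> where "\<Phi> holomorphic_on ball 0 1" "inj_on \<Phi> (ball 0 1)" "\<Phi> ` ball 0 1 \<subseteq> ball 0 1" "\<Phi> 0 = 0"
    "\<And>z. z \<in> ball 0 1 \<Longrightarrow> F s z = F t (\<Phi> z)"
    "\<forall>K B. K holomorphic_on ball 0 1 \<longrightarrow> (\<forall>z\<in>ball 0 1. cmod (K z) \<le> B) \<longrightarrow>
       (LINT z:ball 0 1|lborel. (cmod (deriv (F t) z))\<^sup>2 * Re (K z)) =
       (LINT z:ball 0 1|lborel. (cmod (deriv (F s) z))\<^sup>2 * Re (K (\<Phi> z))) +
       2 * pi * (source_total q t - source_total q s) * Re (K 0)"
proof -
  obtain X :: "'s topology" and A p o' G \<mu> where
    X: "riemann_surface X A" "analytic_from_surface A p" "pullback_area X A p \<mu>" and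
    G: "\<forall>t\<in>I. analytic_to_surface X A (ball 0 1) (G t) \<and> inj_on (G t) (ball 0 1) \<and> G t 0 = o' \<and>
        (\<forall>z\<in>ball 0 1. F t z = p (G t z)) \<and> compactin X (X closure_of (G t ` ball 0 1))" and
    W: "\<forall>s\<in>I. \<forall>t\<in>I. s < t \<longrightarrow> G s ` ball 0 1 \<subseteq> G t ` ball 0 1 \<and>
      (\<forall>h. surface_subharmonic_on A h (G t ` ball 0 1) \<and> integrable_ereal_on \<mu> (G t ` ball 0 1) h \<longrightarrow>
        ereal (set_lebesgue_integral \<mu> (G t ` ball 0 1) (\<lambda>x. real_of_ereal (h x)) -
               set_lebesgue_integral \<mu> (G s ` ball 0 1) (\<lambda>x. real_of_ereal (h x)))
        \<ge> ereal (2 * pi * (source_total q t - source_total q s)) * h o')"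
    using ws unfolding weak_solution_def by (elim exE conjE) (rule that, assumption+)
  note G = G[rule_format] and W = W[rule_format]
  interpret S: surface_disk X A p \<mu> "G s" "F s"
    by standard (use X G[OF st(1)] in auto)
  interpret T: surface_disk X A p \<mu> "G t" "F t"
    by standard (use X G[OF st(2)] in auto)
  have sub: "S.\<Omega> \<subseteq> T.\<Omega>" using W[OF st] by (simp add: S.\<Omega>_def T.\<Omega>_def)
  define \<Phi> where "\<Phi> = (\<lambda>z. T.Finv (G s z))"
  have inT: "G s z \<in> T.\<Omega>" if "z \<in> ball 0 1" for z using that sub by (auto simp: S.\<Omega>_def)
  have \<Phi>b: "\<Phi> z \<in> ball 0 1" and G\<Phi>: "G t (\<Phi> z) = G s z" if "z \<in> ball 0 1" for z
    using T.Finv_in_ball[OF inT[OF that]] T.F_Finv[OF inT[OF that]] by (auto simp: \<Phi>_def)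
  have hol: "\<Phi> holomorphic_on ball 0 1"
  proof -
    \<comment> \<open>Locally \<open>\<Phi>\<close> factors through a chart: \<open>\<phi>\<close>
      after the lift at time \<open>s\<close>, followed by the coordinate of the lift at time
      \<open>t\<close> expressed in the same chart.\<close>
    have "\<Phi> field_differentiable at z" if z: "z \<in> ball 0 1" for z
    proof -
      obtain U \<phi> where U: "(U, \<phi>) \<in> A" "G s z \<in> U" using T.chart_cover S.F_topspace[OF z] by blast
      define V where "V = S.chart_dom U"
      have V: "open V" "z \<in> V" using S.open_chart_dom[OF S.chart(1)[OF U(1)]] U z
        by (auto simp: V_def S.chart_dom_def)
      have VT: "(\<phi> \<circ> G s) ` V \<subseteq> (\<phi> \<circ> G t) ` T.chart_dom U"
      proof
        fix y assume "y \<in> (\<phi> \<circ> G s) ` V"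
        then obtain w where w: "w \<in> ball 0 1" "G s w \<in> U" "y = \<phi> (G s w)"
          by (auto simp: V_def S.chart_dom_def)
        then show "y \<in> (\<phi> \<circ> G t) ` T.chart_dom U"
          unfolding T.chart_inverse(3)[OF U(1)] using inT[OF w(1)] by blast
      qed
      have "(T.Finv \<circ> inv_into U \<phi>) \<circ> (\<phi> \<circ> G s) holomorphic_on V"
        by (rule holomorphic_on_compose_gen[OF _ T.chart_inverse(2)[OF U(1)] VT])
           (use S.chart_map(1)[OF U(1)] in \<open>simp add: V_def\<close>)
      moreover have "((T.Finv \<circ> inv_into U \<phi>) \<circ> (\<phi> \<circ> G s)) w = \<Phi> w" if "w \<in> V" for w
        using that S.chart(3)[OF U(1)] by (simp add: V_def S.chart_dom_def \<Phi>_def)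
      ultimately have "\<Phi> holomorphic_on V" using holomorphic_cong[OF refl] by metis
      then show ?thesis using holomorphic_on_imp_differentiable_at V by blast
    qed
    then show ?thesis by (auto simp: holomorphic_on_def field_differentiable_at_within)
  qed
  have inj: "inj_on \<Phi> (ball 0 1)"
  proof (rule inj_onI)
    fix z w assume zw: "z \<in> ball 0 1" "w \<in> ball 0 1" "\<Phi> z = \<Phi> w"
    then have "G s z = G s w" using G\<Phi> by metis
    then show "z = w" using inj_onD[OF S.inj] zw by blast
  qed
  have \<Phi>0: "\<Phi> 0 = 0"
  proof -
    have "G s 0 = G t 0" using G[OF st(1)] G[OF st(2)] by simp
    then show ?thesis by (simp add: \<Phi>_def)
  qed
  have FF: "F s z = F t (\<Phi> z)" if z: "z \<in> ball 0 1" for z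
    using S.f[OF z] T.f[OF \<Phi>b[OF z]] G\<Phi>[OF z] by simp
  have ineq: "(LINT z:ball 0 1|lborel. (cmod (deriv (F t) z))\<^sup>2 * Re (K z)) -
      (LINT z:ball 0 1|lborel. (cmod (deriv (F s) z))\<^sup>2 * Re (K (\<Phi> z)))
      \<ge> 2 * pi * (source_total q t - source_total q s) * Re (K 0)"
    if K: "K holomorphic_on ball 0 1" and B: "\<And>z. z \<in> ball 0 1 \<Longrightarrow> cmod (K z) \<le> B" for K B
  proof -
    let ?h = "\<lambda>x. ereal (Re (K (T.Finv x)))"
    have contK: "continuous_on (ball 0 1) K" using K holomorphic_on_imp_continuous_on by blast
    have "ereal (set_lebesgue_integral \<mu> T.\<Omega> (\<lambda>x. real_of_ereal (?h x)) -
               set_lebesgue_integral \<mu> S.\<Omega> (\<lambda>x. real_of_ereal (?h x)))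
        \<ge> ereal (2 * pi * (source_total q t - source_total q s)) * ?h o'"
      using W[OF st] T.surface_subharmonic_Re[OF K] T.integrable_Re[OF K B an(2)]
      unfolding S.\<Omega>_def T.\<Omega>_def by blast
    moreover have "T.Finv o' = 0"
    proof -
      have "T.Finv (G t 0) = 0" by (rule T.Finv_F) simp
      then show ?thesis using G[OF st(2)] by simp
    qed
    ultimately have *: "(LINT x:T.\<Omega>|\<mu>. Re (K (T.Finv x))) - (LINT x:S.\<Omega>|\<mu>. Re (K (T.Finv x)))
        \<ge> 2 * pi * (source_total q t - source_total q s) * Re (K 0)" by simp
    have m1: "(\<lambda>z. indicator (ball 0 1) z * Re (K (T.Finv (G t z)))) \<in> borel_measurable borel"
    proof -
      have "(\<lambda>z. indicator (ball 0 1) z * Re (K (T.Finv (G t z)))) = (\<lambda>z. indicator (ball 0 1) z * Re (K z))"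
        by (auto simp: indicator_def)
      then show ?thesis using T.Re_comp_measurable[OF contK] by simp
    qed
    have "continuous_on (ball 0 1) (\<lambda>z. K (\<Phi> z))"
      using continuous_on_compose2[OF contK holomorphic_on_imp_continuous_on[OF hol]] \<Phi>b by blast
    then have m2: "(\<lambda>z. indicator (ball 0 1) z * Re (K (T.Finv (G s z)))) \<in> borel_measurable borel"
      using T.Re_comp_measurable unfolding \<Phi>_def by blast
    have "(LINT x:T.\<Omega>|\<mu>. Re (K (T.Finv x))) = (LINT z:ball 0 1|lborel. (cmod (deriv (F t) z))\<^sup>2 * Re (K z))"
      unfolding T.set_integral_\<Omega>[OF m1] by (intro set_lebesgue_integral_cong) auto
    moreover have "(LINT x:S.\<Omega>|\<mu>. Re (K (T.Finv x))) = (LINT z:ball 0 1|lborel. (cmod (deriv (F s) z))\<^sup>2 * Re (K (\<Phi> z)))"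
      unfolding S.set_integral_\<Omega>[OF m2] \<Phi>_def ..
    ultimately show ?thesis using * by simp
  qed
  have eq: "(LINT z:ball 0 1|lborel. (cmod (deriv (F t) z))\<^sup>2 * Re (K z)) =
       (LINT z:ball 0 1|lborel. (cmod (deriv (F s) z))\<^sup>2 * Re (K (\<Phi> z))) +
       2 * pi * (source_total q t - source_total q s) * Re (K 0)"
    if K: "K holomorphic_on ball 0 1" and B: "\<And>z. z \<in> ball 0 1 \<Longrightarrow> cmod (K z) \<le> B" for K B
  proof -
    have "(\<lambda>z. - K z) holomorphic_on ball 0 1" by (intro holomorphic_intros K)
    from ineq[OF this, of B] have "- (LINT z:ball 0 1|lborel. (cmod (deriv (F t) z))\<^sup>2 * Re (K z)) +
      (LINT z:ball 0 1|lborel. (cmod (deriv (F s) z))\<^sup>2 * Re (K (\<Phi> z)))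
      \<ge> - (2 * pi * (source_total q t - source_total q s) * Re (K 0))"
      using B by (simp add: set_lebesgue_integral_def)
    then show ?thesis using ineq[OF K B] by linarith
  qed
  have im: "\<Phi> ` ball 0 1 \<subseteq> ball 0 1" using \<Phi>b by blast
  show ?thesis by (rule that[OF hol inj im \<Phi>0 FF]) (use eq in blast)+
qed

section \<open>Bounded test functions\<close>

definition weighted_integral :: "(complex \<Rightarrow> complex) \<Rightarrow> (complex \<Rightarrow> complex) \<Rightarrow> complex" where
  "weighted_integral g h = (LINT z:ball 0 1|lborel. h z * complex_of_real ((cmod (g z))\<^sup>2))"

lemma weighted_integrable:
  assumes g: "g analytic_on cball 0 1" and h: "continuous_on (ball 0 1) h" "\<And>z. z \<in> ball 0 1 \<Longrightarrow> cmod (h z) \<le> B"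
  shows "set_integrable lborel (ball 0 1) (\<lambda>z. h z * complex_of_real ((cmod (g z))\<^sup>2))"
proof -
  obtain C where C: "C > 0" "\<And>z. z \<in> cball 0 1 \<Longrightarrow> cmod (g z) \<le> C"
    using analytic_on_cball_bounded[OF g] by blast
  have B0: "B \<ge> 0" using order_trans[OF norm_ge_zero h(2)[of 0]] by simp
  have cg: "continuous_on (ball 0 1) g"
    using holomorphic_on_imp_continuous_on[OF analytic_imp_holomorphic[OF g]] by (rule continuous_on_subset) auto
  show ?thesis
  proof (rule set_integrable_ball_continuous)
    show "continuous_on (ball 0 1) (\<lambda>z. h z * complex_of_real ((cmod (g z))\<^sup>2))"
      by (intro continuous_intros h(1) cg)
    fix z :: complex assume z: "z \<in> ball 0 1"
    then have "(cmod (g z))\<^sup>2 \<le> C\<^sup>2" using C(2)[of z] by (intro power_mono) auto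
    then show "cmod (h z * complex_of_real ((cmod (g z))\<^sup>2)) \<le> B * C\<^sup>2"
      using h(2)[OF z] B0 by (simp add: norm_mult norm_power mult_mono)
  qed
qed

lemma Re_weighted_integral:
  assumes g: "g analytic_on cball 0 1" and h: "continuous_on (ball 0 1) h" "\<And>z. z \<in> ball 0 1 \<Longrightarrow> cmod (h z) \<le> B"
  shows "Re (weighted_integral g h) = (LINT z:ball 0 1|lborel. (cmod (g z))\<^sup>2 * Re (h z))"
  using weighted_integrable[OF assms] unfolding weighted_integral_def set_lebesgue_integral_def set_integrable_def
  by (subst integral_Re[symmetric]) (simp_all add: mult_ac)

text \<open>Uniform continuity on a smaller closed disk, since the dilation moves a point by at most
  \<open>1 / (m + 2)\<close>. The shift by \<open>2\<close> keeps the factor between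
  \<open>1/2\<close> and \<open>1\<close>.\<close>

lemma dilation_uniform_limit:
  assumes h: "h holomorphic_on ball 0 1" and s: "s < 1"
  shows "uniform_limit (cball 0 s) (\<lambda>m z. h (of_real (1 - 1 / (real m + 2)) * z)) h sequentially"
proof (rule uniform_limitI)
  fix e :: real assume e: "e > 0"
  have "continuous_on (cball 0 s) h"
    using holomorphic_on_imp_continuous_on[OF h] by (rule continuous_on_subset) (use s in auto)
  then have "uniformly_continuous_on (cball 0 s) h"
    by (intro compact_uniformly_continuous) auto
  then obtain d where d: "d > 0" "\<And>x y. x \<in> cball 0 s \<Longrightarrow> y \<in> cball 0 s \<Longrightarrow> dist y x < d \<Longrightarrow> dist (h y) (h x) < e"
    using e unfolding uniformly_continuous_on_def by metis
  have "(\<lambda>m. 1 / (real m + 2)) \<longlonglongrightarrow> 0" by real_asymp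
  then have "\<forall>\<^sub>F m in sequentially. 1 / (real m + 2) < d"
    using d(1) by (rule order_tendstoD(2))
  then show "\<forall>\<^sub>F m in sequentially. \<forall>z\<in>cball 0 s. dist (h (of_real (1 - 1 / (real m + 2)) * z)) (h z) < e"
  proof eventually_elim
    case (elim m)
    show ?case
    proof
      fix z :: complex assume z: "z \<in> cball 0 s"
      define q where "q = 1 / (real m + 2)"
      have q: "0 < q" "q < 1" by (auto simp: q_def)
      have "cmod (of_real (1 - q) * z) \<le> 1 * cmod z"
        unfolding norm_mult norm_of_real using q by (intro mult_right_mono) auto
      then have in1: "of_real (1 - q) * z \<in> cball 0 s" using z by simp
      have "of_real (1 - q) * z - z = - (of_real q * z)" by (simp add: algebra_simps)
      then have "dist (of_real (1 - q) * z) z = q * cmod z" using q by (simp add: dist_norm norm_mult)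
      also have "\<dots> \<le> q * 1" using z s q by (intro mult_left_mono) auto
      finally have "dist (of_real (1 - q) * z) z < d" using elim by (simp add: q_def)
      then show "dist (h (of_real (1 - 1 / (real m + 2)) * z)) (h z) < e"
        using d(2)[OF z in1] by (simp add: q_def)
    qed
  qed
qed

text \<open>The test functions \<open>h \<circ> \<Phi>\<close>, with \<open>\<Phi>\<close> a conformal map of the disk into itself, need not extend
  across the unit circle; they are approximated by dilations.\<close>

lemma identity_extends_to_bounded:
  assumes g: "g analytic_on cball 0 1"
    and J: "finite J" "\<And>j. j \<in> J \<Longrightarrow> x j \<in> ball 0 1 \<and> y j \<in> ball 0 1"
    and L: "finite L" "\<And>j. j \<in> L \<Longrightarrow> \<alpha> j \<in> ball 0 1"
    and id: "\<And>h. h analytic_on cball 0 1 \<Longrightarrow> weighted_integral g h =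
       (\<Sum>j\<in>J. c j * contour_integral (linepath (x j) (y j)) (\<lambda>\<zeta>. h \<zeta> * g \<zeta>)) +
       (\<Sum>j\<in>L. \<Sum>k\<in>T j. a j k * (deriv ^^ (k - 1)) h (\<alpha> j))"
    and h: "h holomorphic_on ball 0 1" "\<And>z. z \<in> ball 0 1 \<Longrightarrow> cmod (h z) \<le> B"
  shows "weighted_integral g h =
       (\<Sum>j\<in>J. c j * contour_integral (linepath (x j) (y j)) (\<lambda>\<zeta>. h \<zeta> * g \<zeta>)) +
       (\<Sum>j\<in>L. \<Sum>k\<in>T j. a j k * (deriv ^^ (k - 1)) h (\<alpha> j))"
proof -
  define \<rho> where "\<rho> = (\<lambda>m. 1 - 1 / (real m + 2))"
  define hm where "hm = (\<lambda>m z. h (of_real (\<rho> m) * z))"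
  have \<rho>: "0 < \<rho> m" "\<rho> m < 1" for m by (auto simp: \<rho>_def field_simps)
  have \<rho>b: "of_real (\<rho> m) * z \<in> ball 0 1" if "cmod z < 1 / \<rho> m" for m z
    using that \<rho>[of m] by (simp add: norm_mult field_simps)
  have hm_an: "hm m analytic_on cball 0 1" for m
  proof (rule holomorphic_ball_imp_analytic_cball)
    show "1 / \<rho> m > 1" using \<rho>[of m] by (simp add: field_simps)
    show "hm m holomorphic_on ball 0 (1 / \<rho> m)"
      unfolding hm_def
      by (rule holomorphic_on_compose_gen[OF _ h(1), unfolded o_def]) (use \<rho>b in \<open>auto intro!: holomorphic_intros\<close>)
  qed
  have in1: "of_real (\<rho> m) * z \<in> ball 0 1" if "z \<in> ball 0 1" for m and z :: complex
  proof (rule \<rho>b)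
    have "1 < 1 / \<rho> m" using \<rho>[of m] by (simp add: field_simps)
    then show "cmod z < 1 / \<rho> m" using that by (auto intro: order_less_trans)
  qed
  have cont: "continuous_on (ball 0 1) h" using h(1) holomorphic_on_imp_continuous_on by blast
  have ul: "uniform_limit (cball 0 s) hm h sequentially" if "s < 1" for s
    using dilation_uniform_limit[OF h(1) that] by (simp add: hm_def \<rho>_def)
  have gb: "g holomorphic_on cball 0 1" using g analytic_imp_holomorphic by blast
  have cg: "continuous_on (cball 0 1) g" using gb holomorphic_on_imp_continuous_on by blast
  obtain C where C: "C > 0" "\<And>z. z \<in> cball 0 1 \<Longrightarrow> cmod (g z) \<le> C"
    using analytic_on_cball_bounded[OF g] by blast
  have "(\<lambda>m. weighted_integral g (hm m)) \<longlonglongrightarrow> weighted_integral g h"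
    unfolding weighted_integral_def set_lebesgue_integral_def
  \<comment> \<open>Every dilation inherits the bound \<open>B\<close>, and \<open>g\<close> is
    bounded by \<open>C\<close> on the closed disk, so the constant \<open>B * C\<^sup>2\<close> on
    the disk dominates.\<close>
  proof (rule integral_dominated_convergence[where w = "\<lambda>z. indicator (ball 0 1) z *\<^sub>R (B * C\<^sup>2)"])
    show "(\<lambda>z. indicator (ball 0 1) z *\<^sub>R (h z * complex_of_real ((cmod (g z))\<^sup>2))) \<in> borel_measurable lborel"
      using weighted_integrable[OF g cont h(2)] by (auto simp: set_integrable_def)
    have "continuous_on (ball 0 1) (hm m)" for m
      using holomorphic_on_imp_continuous_on[OF analytic_imp_holomorphic[OF hm_an[of m]]]
      by (rule continuous_on_subset) auto
    moreover have hmB: "cmod (hm m z) \<le> B" if "z \<in> ball 0 1" for m z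
      unfolding hm_def by (intro h(2) in1 that)
    ultimately have "set_integrable lborel (ball 0 1) (\<lambda>z. hm m z * complex_of_real ((cmod (g z))\<^sup>2))" for m
      by (intro weighted_integrable[OF g]) auto
    then show "(\<lambda>z. indicator (ball 0 1) z *\<^sub>R (hm m z * complex_of_real ((cmod (g z))\<^sup>2))) \<in> borel_measurable lborel" for m
      by (auto simp: set_integrable_def)
    show "integrable lborel (\<lambda>z::complex. indicator (ball 0 1) z *\<^sub>R (B * C\<^sup>2))"
      using emeasure_lborel_ball_finite[of "0::complex" 1]
      by (intro integrable_scaleR_left integrable_real_indicator) auto
    show "AE z in lborel. norm (indicator (ball 0 1) z *\<^sub>R (hm m z * complex_of_real ((cmod (g z))\<^sup>2)))
        \<le> indicator (ball 0 1) z *\<^sub>R (B * C\<^sup>2)" for m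
    proof (rule AE_I2)
      fix z :: complex
      have "cmod (hm m z) * (cmod (g z))\<^sup>2 \<le> B * C\<^sup>2" if z: "z \<in> ball 0 1"
        using hmB[OF z, of m] C(2)[of z] z order_trans[OF norm_ge_zero hmB[OF z, of m]]
        by (intro mult_mono power_mono) auto
      then show "norm (indicator (ball 0 1) z *\<^sub>R (hm m z * complex_of_real ((cmod (g z))\<^sup>2)))
        \<le> indicator (ball 0 1) z *\<^sub>R (B * C\<^sup>2)"
        by (auto simp: indicator_def norm_mult norm_power)
    qed
    show "AE z in lborel. (\<lambda>m. indicator (ball 0 1) z *\<^sub>R (hm m z * complex_of_real ((cmod (g z))\<^sup>2)))
        \<longlonglongrightarrow> indicator (ball 0 1) z *\<^sub>R (h z * complex_of_real ((cmod (g z))\<^sup>2))"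
    proof (rule AE_I2)
      fix z :: complex
      show "(\<lambda>m. indicator (ball 0 1) z *\<^sub>R (hm m z * complex_of_real ((cmod (g z))\<^sup>2)))
        \<longlonglongrightarrow> indicator (ball 0 1) z *\<^sub>R (h z * complex_of_real ((cmod (g z))\<^sup>2))"
      proof (cases "z \<in> ball 0 1")
        case True
        then have "(\<lambda>m. hm m z) \<longlonglongrightarrow> h z"
          by (intro tendsto_uniform_limitI[OF ul[of "cmod z"]]) auto
        then show ?thesis by (intro tendsto_intros)
      qed simp
    qed
  qed
  moreover have "(\<lambda>m. (\<Sum>j\<in>J. c j * contour_integral (linepath (x j) (y j)) (\<lambda>\<zeta>. hm m \<zeta> * g \<zeta>)) +
       (\<Sum>j\<in>L. \<Sum>k\<in>T j. a j k * (deriv ^^ (k - 1)) (hm m) (\<alpha> j)))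
    \<longlonglongrightarrow> (\<Sum>j\<in>J. c j * contour_integral (linepath (x j) (y j)) (\<lambda>\<zeta>. h \<zeta> * g \<zeta>)) +
       (\<Sum>j\<in>L. \<Sum>k\<in>T j. a j k * (deriv ^^ (k - 1)) h (\<alpha> j))"
  proof (intro tendsto_add tendsto_sum tendsto_mult tendsto_const)
    fix j assume j: "j \<in> J"
    \<comment> \<open>The segment stays in a closed disk of radius \<open>s < 1\<close>, where the
      dilations converge uniformly.\<close>
    define s where "s = max (cmod (x j)) (cmod (y j))"
    have s: "s < 1" using J(2)[OF j] by (simp add: s_def)
    have seg: "closed_segment (x j) (y j) \<subseteq> cball 0 s"
      by (rule closed_segment_subset) (auto simp: s_def)
    show "(\<lambda>m. contour_integral (linepath (x j) (y j)) (\<lambda>\<zeta>. hm m \<zeta> * g \<zeta>)) \<longlonglongrightarrow> contour_integral (linepath (x j) (y j)) (\<lambda>\<zeta>. h \<zeta> * g \<zeta>)"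
    proof (rule contour_integral_uniform_limit(2)[where B = "cmod (y j - x j)"])
      have sub: "closed_segment (x j) (y j) \<subseteq> cball 0 1" using seg s by (force intro: order_trans)
      show "\<forall>\<^sub>F m in sequentially. (\<lambda>\<zeta>. hm m \<zeta> * g \<zeta>) contour_integrable_on linepath (x j) (y j)"
      proof (intro always_eventually allI contour_integrable_continuous_linepath continuous_on_mult)
        show "continuous_on (closed_segment (x j) (y j)) (hm m)" for m
          by (rule continuous_on_subset[OF holomorphic_on_imp_continuous_on[OF analytic_imp_holomorphic[OF hm_an]] sub])
        show "continuous_on (closed_segment (x j) (y j)) g" by (rule continuous_on_subset[OF cg sub])
      qed
      have "uniform_limit (closed_segment (x j) (y j)) (\<lambda>m \<zeta>. hm m \<zeta> * g \<zeta>) (\<lambda>\<zeta>. h \<zeta> * g \<zeta>) sequentially"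
      proof (rule uniform_lim_mult[OF _ uniform_limit_const])
        show "uniform_limit (closed_segment (x j) (y j)) hm h sequentially"
          using ul[OF s] seg by (rule uniform_limit_on_subset)
        have "compact (h ` closed_segment (x j) (y j))"
          using seg s by (intro compact_continuous_image continuous_on_subset[OF cont]) force+
        then show "bounded (h ` closed_segment (x j) (y j))" by (rule compact_imp_bounded)
        have "compact (g ` closed_segment (x j) (y j))"
          by (intro compact_continuous_image continuous_on_subset[OF cg] sub) auto
        then show "bounded (g ` closed_segment (x j) (y j))" by (rule compact_imp_bounded)
      qed
      then show "uniform_limit (path_image (linepath (x j) (y j))) (\<lambda>m \<zeta>. hm m \<zeta> * g \<zeta>) (\<lambda>\<zeta>. h \<zeta> * g \<zeta>) sequentially"
        by simp
    qed auto
  next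
    fix j k assume j: "j \<in> L"
    define s where "s = (1 + cmod (\<alpha> j)) / 2"
    have s: "s < 1" "\<alpha> j \<in> ball 0 s" using L(2)[OF j] by (auto simp: s_def)
    show "(\<lambda>m. (deriv ^^ (k - 1)) (hm m) (\<alpha> j)) \<longlonglongrightarrow> (deriv ^^ (k - 1)) h (\<alpha> j)"
    proof (rule higher_deriv_complex_uniform_limit[where A = "ball 0 s"])
      show "uniform_limit (ball 0 s) hm h sequentially"
        using ul[OF s(1)] by (rule uniform_limit_on_subset) auto
      show "\<forall>\<^sub>F m in sequentially. hm m holomorphic_on ball 0 s"
      proof (intro always_eventually allI)
        fix m
        have "ball (0::complex) s \<subseteq> cball 0 1" using s(1) by auto
        then show "hm m holomorphic_on ball 0 s"
          using analytic_imp_holomorphic[OF hm_an[of m]] holomorphic_on_subset by blast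
      qed
    qed (use s in auto)
  qed
  ultimately show ?thesis unfolding id[OF hm_an] by (rule LIMSEQ_unique)
qed

lemma contour_integral_eq_primitive:
  assumes "\<And>z. z \<in> ball 0 1 \<Longrightarrow> (P has_field_derivative k z) (at z)" "valid_path \<gamma>" "path_image \<gamma> \<subseteq> ball 0 1"
  shows "contour_integral \<gamma> k = P (pathfinish \<gamma>) - P (pathstart \<gamma>)"
  using assms by (intro contour_integral_unique contour_integral_primitive[where S = "ball 0 1"])
    (auto intro: has_field_derivative_at_within)

text \<open>The integrals of \<open>h g\<close> depend only on end points, so the arcs can be
  replaced by segments before the limit of dilations is taken. The result is stated with a
  primitive, the form that composes with a conformal map.\<close>

lemma quadrature_bounded:
  assumes g: "g analytic_on cball 0 1" and qi: "quadrature_identity g l r \<alpha> \<gamma> c n a"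
    and h: "h holomorphic_on ball 0 1" "\<And>z. z \<in> ball 0 1 \<Longrightarrow> cmod (h z) \<le> B"
    and P: "\<And>z. z \<in> ball 0 1 \<Longrightarrow> (P has_field_derivative h z * g z) (at z)"
  shows "weighted_integral g h = of_real pi * ((\<Sum>j=1..r. c j * (P (pathfinish (\<gamma> j)) - P (pathstart (\<gamma> j)))) +
        (\<Sum>j=0..l. \<Sum>k=1..n j - 1. a j k * (deriv ^^ (k - 1)) h (\<alpha> j)))"
proof -
  have \<alpha>: "\<And>j. j \<in> {0..l} \<Longrightarrow> \<alpha> j \<in> ball 0 1"
    and \<gamma>: "\<And>j. j \<in> {1..r} \<Longrightarrow> valid_path (\<gamma> j) \<and> path_image (\<gamma> j) \<subseteq> ball 0 1"
    and Q: "\<And>h. h analytic_on cball 0 1 \<Longrightarrow>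
        complex_of_real (1 / pi) * weighted_integral g h =
        (\<Sum>j=1..r. c j * contour_integral (\<gamma> j) (\<lambda>\<zeta>. h \<zeta> * g \<zeta>)) +
        (\<Sum>j=0..l. \<Sum>k=1..n j - 1. a j k * (deriv ^^ (k - 1)) h (\<alpha> j))"
    using qi unfolding quadrature_identity_def weighted_integral_def by auto
  have ends: "pathstart (\<gamma> j) \<in> ball 0 1" "pathfinish (\<gamma> j) \<in> ball 0 1" if "j \<in> {1..r}" for j
    using \<gamma>[OF that] pathstart_in_path_image pathfinish_in_path_image by blast+
  have seg: "closed_segment (pathstart (\<gamma> j)) (pathfinish (\<gamma> j)) \<subseteq> ball 0 1" if "j \<in> {1..r}" for j
    using ends[OF that] by (intro closed_segment_subset) auto
  have "weighted_integral g h =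
       (\<Sum>j\<in>{1..r}. (of_real pi * c j) * contour_integral (linepath (pathstart (\<gamma> j)) (pathfinish (\<gamma> j))) (\<lambda>\<zeta>. h \<zeta> * g \<zeta>)) +
       (\<Sum>j\<in>{0..l}. \<Sum>k\<in>{1..n j - 1}. (of_real pi * a j k) * (deriv ^^ (k - 1)) h (\<alpha> j))"
  proof (rule identity_extends_to_bounded[OF g _ _ _ _ _ h])
    fix h assume h: "h analytic_on cball 0 (1::real)"
    obtain \<rho> P where P: "\<rho> > 1" "P holomorphic_on ball 0 \<rho>" "P analytic_on cball 0 1"
      "\<And>z. z \<in> ball 0 \<rho> \<Longrightarrow> (P has_field_derivative h z * g z) (at z)"
      "\<And>z. z \<in> ball 0 \<rho> \<Longrightarrow> deriv P z = h z * g z"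
      by (rule primitive_on_cball[OF analytic_on_mult[OF h g]]) (rule that; assumption)
    have P1: "(P has_field_derivative h z * g z) (at z)" if "z \<in> ball 0 1" for z
      using P that by auto
    have "weighted_integral g h = of_real pi * (complex_of_real (1 / pi) * weighted_integral g h)" by simp
    also have "\<dots> = (\<Sum>j=1..r. of_real pi * (c j * contour_integral (\<gamma> j) (\<lambda>\<zeta>. h \<zeta> * g \<zeta>))) +
        (\<Sum>j=0..l. \<Sum>k=1..n j - 1. of_real pi * (a j k * (deriv ^^ (k - 1)) h (\<alpha> j)))"
      unfolding Q[OF h] by (simp only: distrib_left sum_distrib_left)
    also have "(\<Sum>j=1..r. of_real pi * (c j * contour_integral (\<gamma> j) (\<lambda>\<zeta>. h \<zeta> * g \<zeta>))) =
       (\<Sum>j\<in>{1..r}. (of_real pi * c j) * contour_integral (linepath (pathstart (\<gamma> j)) (pathfinish (\<gamma> j))) (\<lambda>\<zeta>. h \<zeta> * g \<zeta>))"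
    proof (rule sum.cong[OF refl])
      fix j assume j: "j \<in> {1..r}"
      show "of_real pi * (c j * contour_integral (\<gamma> j) (\<lambda>\<zeta>. h \<zeta> * g \<zeta>)) =
         of_real pi * c j * contour_integral (linepath (pathstart (\<gamma> j)) (pathfinish (\<gamma> j))) (\<lambda>\<zeta>. h \<zeta> * g \<zeta>)"
        using contour_integral_eq_primitive[OF P1, of "\<gamma> j"] \<gamma>[OF j] seg[OF j]
          contour_integral_eq_primitive[OF P1, of "linepath (pathstart (\<gamma> j)) (pathfinish (\<gamma> j))"]
        by simp
    qed
    finally show "weighted_integral g h =
       (\<Sum>j\<in>{1..r}. (of_real pi * c j) * contour_integral (linepath (pathstart (\<gamma> j)) (pathfinish (\<gamma> j))) (\<lambda>\<zeta>. h \<zeta> * g \<zeta>)) +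
       (\<Sum>j\<in>{0..l}. \<Sum>k\<in>{1..n j - 1}. (of_real pi * a j k) * (deriv ^^ (k - 1)) h (\<alpha> j))"
      by (simp only: mult.assoc)
  qed (use \<alpha> ends in auto)
  moreover have "contour_integral (linepath (pathstart (\<gamma> j)) (pathfinish (\<gamma> j))) (\<lambda>\<zeta>. h \<zeta> * g \<zeta>)
      = P (pathfinish (\<gamma> j)) - P (pathstart (\<gamma> j))" if "j \<in> {1..r}" for j
    using contour_integral_eq_primitive[OF P, of "linepath (pathstart (\<gamma> j)) (pathfinish (\<gamma> j))"] seg[OF that] by simp
  ultimately show ?thesis by (simp add: distrib_left sum_distrib_left mult.assoc)
qed

text \<open>Since the residues add up to zero, the values of \<open>P\<close> can be replaced by
  integrals of \<open>h g\<close> along segments from the origin. The functional then depends on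
  \<open>h\<close> alone and has the form to which the limit of dilations applies.\<close>

lemma star_expansion_bounded:
  assumes g: "g analytic_on cball 0 1" and ext: "rational_extension g R" and se: "star_expansion R S N e"
    and h: "h holomorphic_on ball 0 1" "\<And>z. z \<in> ball 0 1 \<Longrightarrow> cmod (h z) \<le> B"
    and P: "\<And>z. z \<in> ball 0 1 \<Longrightarrow> (P has_field_derivative h z * g z) (at z)"
  shows "weighted_integral g h = of_real pi * jet_functional S N e P"
proof -
  have S: "finite S" "S \<subseteq> ball 0 1" using se by (auto simp: star_expansion_def)
  have gb: "g analytic_on ball 0 1" using g by (rule analytic_on_subset) auto
  have sum0: "(\<Sum>w\<in>S. e w 0) = 0" by (rule star_expansion_residues_sum[OF g ext se])
  have seg: "closed_segment 0 w \<subseteq> ball 0 1" if "w \<in> S" for w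
    using that S by (intro closed_segment_subset) auto
  have J: "jet_functional S N e P = (\<Sum>w\<in>S. e w 0 * contour_integral (linepath 0 w) (\<lambda>\<zeta>. h \<zeta> * g \<zeta>)) +
      (\<Sum>w\<in>S. \<Sum>k\<in>{1..<N}. point_coeff g N e w k * (deriv ^^ (k - 1)) h w)"
    if h: "h analytic_on ball 0 1" and P: "\<And>z. z \<in> ball 0 1 \<Longrightarrow> (P has_field_derivative h z * g z) (at z)" for h P
  proof -
    have "contour_integral (linepath 0 w) (\<lambda>\<zeta>. h \<zeta> * g \<zeta>) = P w - P 0" if "w \<in> S" for w
      using contour_integral_eq_primitive[OF P, of "linepath 0 w"] seg[OF that] by simp
    then have "(\<Sum>w\<in>S. e w 0 * contour_integral (linepath 0 w) (\<lambda>\<zeta>. h \<zeta> * g \<zeta>)) = (\<Sum>w\<in>S. e w 0 * P w) - (\<Sum>w\<in>S. e w 0) * P 0"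
      by (simp add: right_diff_distrib sum_subtractf sum_distrib_right)
    moreover have "jet_functional S N e P = (\<Sum>w\<in>S. e w 0 * P w) +
      (\<Sum>w\<in>S. \<Sum>k=1..<N. point_coeff g N e w k * (deriv ^^ (k - 1)) h w)"
      by (rule jet_functional_point_coeff[OF h gb S(2)])
         (use star_expansion_eq_0[OF se] DERIV_imp_deriv[OF P] in auto)
    ultimately show ?thesis by (simp add: sum0)
  qed
  have hb: "h analytic_on ball 0 1" using h(1) by (subst analytic_on_open) auto
  have "weighted_integral g h =
       (\<Sum>w\<in>S. (of_real pi * e w 0) * contour_integral (linepath 0 w) (\<lambda>\<zeta>. h \<zeta> * g \<zeta>)) +
       (\<Sum>w\<in>S. \<Sum>k\<in>{1..<N}. (of_real pi * point_coeff g N e w k) * (deriv ^^ (k - 1)) h w)"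
  proof (rule identity_extends_to_bounded[OF g _ _ _ _ _ h])
    fix h assume h: "h analytic_on cball 0 (1::real)"
    have hb: "h analytic_on ball 0 1" using h by (rule analytic_on_subset) auto
    obtain \<rho> P where P: "\<rho> > 1" "P holomorphic_on ball 0 \<rho>" "P analytic_on cball 0 1"
      "\<And>z. z \<in> ball 0 \<rho> \<Longrightarrow> (P has_field_derivative h z * g z) (at z)"
      "\<And>z. z \<in> ball 0 \<rho> \<Longrightarrow> deriv P z = h z * g z"
      by (rule primitive_on_cball[OF analytic_on_mult[OF h g]]) (rule that; assumption)
    have P1: "(P has_field_derivative h z * g z) (at z)" if "z \<in> ball 0 1" for z
      using P that by auto
    have "weighted_integral g h = disk_pairing (deriv P) g"
      unfolding weighted_integral_def weighted_integral_eq_disk_pairing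
      by (rule disk_pairing_cong) (use P in auto)
    also have "\<dots> = of_real pi * jet_functional S N e P" by (rule star_expansion_pairing[OF g ext se P(3)])
    also have "\<dots> =
       (\<Sum>w\<in>S. (of_real pi * e w 0) * contour_integral (linepath 0 w) (\<lambda>\<zeta>. h \<zeta> * g \<zeta>)) +
       (\<Sum>w\<in>S. \<Sum>k\<in>{1..<N}. (of_real pi * point_coeff g N e w k) * (deriv ^^ (k - 1)) h w)"
      by (simp only: J[OF hb P1] distrib_left sum_distrib_left mult.assoc)
    finally show "weighted_integral g h =
       (\<Sum>w\<in>S. (of_real pi * e w 0) * contour_integral (linepath 0 w) (\<lambda>\<zeta>. h \<zeta> * g \<zeta>)) +
       (\<Sum>w\<in>S. \<Sum>k\<in>{1..<N}. (of_real pi * point_coeff g N e w k) * (deriv ^^ (k - 1)) h w)" .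
  qed (use S in auto)
  also have "\<dots> = of_real pi * jet_functional S N e P"
    by (simp only: J[OF hb P] distrib_left sum_distrib_left mult.assoc)
  finally show ?thesis .
qed

section \<open>Transport by a conformal map\<close>

lemma has_zero_order_unique:
  assumes "has_zero_order g w m" "\<And>i. i < k \<Longrightarrow> jet g w i = 0" "jet g w k \<noteq> 0"
  shows "m = k"
  using has_zero_order_jet[OF assms(1)] assms(2,3) by (metis linorder_neqE_nat)

text \<open>Injectivity gives \<open>\<Phi>' \<noteq> 0\<close>, so neither the composition nor the
  factor \<open>\<Phi>'\<close> changes the order: the lowest Taylor coefficient is multiplied by a
  power of \<open>\<Phi>'(w)\<close>.\<close>

lemma has_zero_order_comp:
  assumes g0: "\<forall>z\<in>ball 0 1. g0 z = g (\<Phi> z) * deriv \<Phi> z"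
    and \<Phi>: "\<Phi> holomorphic_on ball 0 1" "inj_on \<Phi> (ball 0 1)" and w: "w \<in> ball 0 1"
    and g: "g analytic_on {\<Phi> w}" and m: "has_zero_order g (\<Phi> w) m" and m0: "has_zero_order g0 w m0"
  shows "m0 = m"
proof -
  have \<Phi>w: "\<Phi> analytic_on {w}" using \<Phi>(1) w analytic_at[of \<Phi> w] by blast
  have d: "deriv \<Phi> w \<noteq> 0" using holomorphic_injective_imp_regular[OF \<Phi>(1) open_ball \<Phi>(2) w] .
  have g\<Phi>: "(\<lambda>z. g (\<Phi> z)) analytic_on {w}"
    using analytic_on_compose[OF \<Phi>w, of g] g by (simp add: o_def)
  have jc: "jet (\<lambda>z. g (\<Phi> z)) w i = (\<Sum>k\<le>i. jet g (\<Phi> w) k * comp_coeff \<Phi> w k i)" for i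
    by (rule jet_comp[OF \<Phi>w g])
  have jc0: "jet (\<lambda>z. g (\<Phi> z)) w i = 0" if "i < m" for i
    unfolding jc using has_zero_order_jet(1)[OF m] that by (intro sum.neutral) auto
  have "jet (\<lambda>z. g (\<Phi> z)) w m = (\<Sum>k\<le>m. if k = m then jet g (\<Phi> w) m * deriv \<Phi> w ^ m else 0)"
    unfolding jc using has_zero_order_jet(1)[OF m] by (intro sum.cong) (auto simp: comp_coeff_same)
  then have jcm: "jet (\<lambda>z. g (\<Phi> z)) w m = jet g (\<Phi> w) m * deriv \<Phi> w ^ m" by simp
  have j: "jet g0 w i = (\<Sum>k\<le>i. jet (\<lambda>z. g (\<Phi> z)) w k * jet (deriv \<Phi>) w (i - k))" for i
  proof -
    have an: "(\<lambda>z. g (\<Phi> z) * deriv \<Phi> z) analytic_on {w}"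
      by (intro analytic_intros g\<Phi> \<Phi>w)
    have "\<forall>\<^sub>F z in nhds w. g (\<Phi> z) * deriv \<Phi> z = g0 z"
      using eventually_nhds_in_open[OF open_ball w] by eventually_elim (simp add: g0)
    from jet_cong[OF an this] show ?thesis
      by (subst jet_mult[symmetric]) (auto intro: g\<Phi> \<Phi>w analytic_deriv)
  qed
  show ?thesis
  proof (rule has_zero_order_unique[OF m0])
    show "jet g0 w i = 0" if "i < m" for i
      unfolding j using jc0 that by (intro sum.neutral) auto
    have "jet g0 w m = (\<Sum>k\<le>m. if k = m then jet g (\<Phi> w) m * deriv \<Phi> w ^ m * deriv \<Phi> w else 0)"
      unfolding j using jc0 by (intro sum.cong) (auto simp: jcm)
    then show "jet g0 w m \<noteq> 0" using has_zero_order_jet(2)[OF m] d by simp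
  qed
qed

text \<open>If \<open>P\<close> is a primitive of \<open>h g\<close>, then
  \<open>P \<circ> \<Phi>\<close> is one of \<open>(h \<circ> \<Phi>) g0\<close>; so the arcs are
  mapped by \<open>\<Phi>\<close> and keep their coefficients. A derivative of
  \<open>h \<circ> \<Phi>\<close> involves derivatives of \<open>h\<close> of at most the same
  order, so the \<open>n j\<close> do not change. With \<open>2 \<le> n 0\<close> the index
  \<open>k = 1\<close> occurs at the origin and can absorb the source term.\<close>

lemma quadrature_transport:
  assumes g0: "g0 analytic_on cball 0 1" and g: "g analytic_on cball 0 1"
    and \<Phi>: "\<Phi> holomorphic_on ball 0 1" "inj_on \<Phi> (ball 0 1)" "\<Phi> ` ball 0 1 \<subseteq> ball 0 1" "\<Phi> 0 = 0"
    and gg: "\<And>z. z \<in> ball 0 1 \<Longrightarrow> g0 z = g (\<Phi> z) * deriv \<Phi> z"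
    and W: "\<And>h. h analytic_on cball 0 1 \<Longrightarrow>
       weighted_integral g h = weighted_integral g0 (\<lambda>z. h (\<Phi> z)) + of_real pi * q * h 0"
    and qi: "quadrature_identity g0 l r \<alpha> \<gamma> c n a" and n0: "2 \<le> n 0"
  shows "quadrature_identity g l r (\<lambda>j. \<Phi> (\<alpha> j)) (\<lambda>j. \<Phi> \<circ> \<gamma> j) c n
     (\<lambda>j k. (\<Sum>m=k..n j - 1. a j m * fact (m - 1) * comp_coeff \<Phi> (\<alpha> j) (k - 1) (m - 1)) / fact (k - 1)
        + (if j = 0 \<and> k = 1 then q else 0))"
    (is "quadrature_identity g l r ?\<alpha> ?\<gamma> c n ?a")
proof -
  have \<alpha>: "\<alpha> 0 = 0" "inj_on \<alpha> {0..l}" "\<And>j. j \<in> {0..l} \<Longrightarrow> \<alpha> j \<in> ball 0 1 \<and> 0 < n j"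
    and \<gamma>: "\<And>j. j \<in> {1..r} \<Longrightarrow> valid_path (\<gamma> j) \<and> arc (\<gamma> j) \<and> path_image (\<gamma> j) \<subseteq> ball 0 1"
    using qi unfolding quadrature_identity_def by auto
  have \<Phi>b: "\<Phi> z \<in> ball 0 1" if "z \<in> ball 0 1" for z using \<Phi>(3) that by blast
  have valid: "valid_path (?\<gamma> j)" "path_image (?\<gamma> j) \<subseteq> ball 0 1" "arc (?\<gamma> j)" if j: "j \<in> {1..r}" for j
  proof -
    show "valid_path (?\<gamma> j)"
      using \<gamma>[OF j] \<Phi>(1) by (intro valid_path_compose_holomorphic[of _ _ "ball 0 1"]) auto
    show "path_image (?\<gamma> j) \<subseteq> ball 0 1"
      using \<gamma>[OF j] \<Phi>(3) by (auto simp: path_image_compose)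
    have "inj_on \<Phi> (path_image (\<gamma> j))" using \<gamma>[OF j] inj_on_subset[OF \<Phi>(2)] by blast
    then have "inj_on (\<Phi> \<circ> \<gamma> j) {0..1}"
      using \<gamma>[OF j] by (intro comp_inj_on) (auto simp: arc_def path_image_def)
    then show "arc (?\<gamma> j)" using \<open>valid_path (?\<gamma> j)\<close> by (simp add: arc_def valid_path_imp_path)
  qed
  show ?thesis
    unfolding quadrature_identity_def weighted_integral_def[symmetric]
  proof (intro conjI allI impI ballI)
    show "\<Phi> (\<alpha> 0) = 0" using \<alpha> \<Phi>(4) by simp
    show "inj_on ?\<alpha> {0..l}"
      using comp_inj_on[OF \<alpha>(2) inj_on_subset[OF \<Phi>(2)]] \<alpha>(3) by (force simp: o_def)
    show "?\<alpha> j \<in> ball 0 1" "0 < n j" if "j \<in> {0..l}" for j using \<alpha>(3)[OF that] \<Phi>b by blast+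
    show "valid_path (?\<gamma> j)" "arc (?\<gamma> j)" "path_image (?\<gamma> j) \<subseteq> ball 0 1" if "j \<in> {1..r}" for j
      using valid[OF that] by auto
    fix h assume h: "h analytic_on cball 0 (1::real)"
    obtain \<rho> P where P: "\<rho> > 1" "P holomorphic_on ball 0 \<rho>" "P analytic_on cball 0 1"
      "\<And>z. z \<in> ball 0 \<rho> \<Longrightarrow> (P has_field_derivative h z * g z) (at z)"
      "\<And>z. z \<in> ball 0 \<rho> \<Longrightarrow> deriv P z = h z * g z"
      by (rule primitive_on_cball[OF analytic_on_mult[OF h g]]) (rule that; assumption)
    have P1: "(P has_field_derivative h z * g z) (at z)" if "z \<in> ball 0 1" for z using P(1,4) that by auto
    obtain B where B: "\<And>z. z \<in> cball 0 1 \<Longrightarrow> cmod (h z) \<le> B" using analytic_on_cball_bounded[OF h] by blast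
    have h\<Phi>: "(\<lambda>z. h (\<Phi> z)) holomorphic_on ball 0 1"
    proof -
      have "h holomorphic_on ball 0 1" using analytic_imp_holomorphic[OF h] by (rule holomorphic_on_subset) auto
      from holomorphic_on_compose_gen[OF \<Phi>(1) this \<Phi>(3)] show ?thesis by (simp add: o_def)
    qed
    have P\<Phi>: "((\<lambda>z. P (\<Phi> z)) has_field_derivative h (\<Phi> z) * g0 z) (at z)" if z: "z \<in> ball 0 1" for z
    proof -
      have "\<Phi> z \<in> ball 0 1" using \<Phi>(3) z by blast
      from DERIV_chain[OF P1[OF this] holomorphic_derivI[OF \<Phi>(1) open_ball z]]
      show ?thesis by (simp add: o_def gg[OF z] mult.assoc)
    qed
    have "weighted_integral g0 (\<lambda>z. h (\<Phi> z)) = of_real pi * ((\<Sum>j=1..r. c j * (P (\<Phi> (pathfinish (\<gamma> j))) - P (\<Phi> (pathstart (\<gamma> j))))) +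
        (\<Sum>j=0..l. \<Sum>k=1..n j - 1. a j k * (deriv ^^ (k - 1)) (\<lambda>z. h (\<Phi> z)) (\<alpha> j)))"
    proof (rule quadrature_bounded[OF g0 qi h\<Phi> _ P\<Phi>])
      show "cmod (h (\<Phi> z)) \<le> B" if "z \<in> ball 0 1" for z
        using \<Phi>b[OF that] by (intro B) auto
    qed
    also have "(\<Sum>j=1..r. c j * (P (\<Phi> (pathfinish (\<gamma> j))) - P (\<Phi> (pathstart (\<gamma> j)))))
        = (\<Sum>j=1..r. c j * contour_integral (?\<gamma> j) (\<lambda>\<zeta>. h \<zeta> * g \<zeta>))"
    proof (rule sum.cong[OF refl])
      fix j assume j: "j \<in> {1..r}"
      show "c j * (P (\<Phi> (pathfinish (\<gamma> j))) - P (\<Phi> (pathstart (\<gamma> j)))) = c j * contour_integral (?\<gamma> j) (\<lambda>\<zeta>. h \<zeta> * g \<zeta>)"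
        using contour_integral_eq_primitive[OF P1 valid(1,2)[OF j]] by (simp add: pathfinish_compose pathstart_compose)
    qed
    also have "(\<Sum>j=0..l. \<Sum>k=1..n j - 1. a j k * (deriv ^^ (k - 1)) (\<lambda>z. h (\<Phi> z)) (\<alpha> j))
        = (\<Sum>j=0..l. \<Sum>k=1..n j - 1. (?a j k - (if j = 0 \<and> k = 1 then q else 0)) * (deriv ^^ (k - 1)) h (?\<alpha> j))"
    proof (rule sum.cong[OF refl])
      fix j assume j: "j \<in> {0..l}"
      define w where "w = \<alpha> j"
      have w: "w \<in> ball 0 1" using \<alpha>(3)[OF j] by (simp add: w_def)
      have \<Phi>w: "\<Phi> analytic_on {w}" using \<Phi>(1) w analytic_at[of \<Phi> w] by blast
      have "\<Phi> w \<in> cball 0 1" using \<Phi>(3) w by force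
      then have hw: "h analytic_on {\<Phi> w}" using h by (auto elim: analytic_on_subset)
      have "(\<Sum>k=1..n j - 1. a j k * (deriv ^^ (k - 1)) (\<lambda>z. h (\<Phi> z)) w)
          = (\<Sum>m=1..n j - 1. \<Sum>k=1..n j - 1. if k \<le> m then a j m * fact (m - 1) * comp_coeff \<Phi> w (k - 1) (m - 1) / fact (k - 1) * (deriv ^^ (k - 1)) h (\<Phi> w) else 0)"
      proof (rule sum.cong[OF refl])
        fix m assume m: "m \<in> {1..n j - 1}"
        have "(deriv ^^ (m - 1)) (\<lambda>z. h (\<Phi> z)) w = fact (m - 1) * (\<Sum>i\<le>m - 1. jet h (\<Phi> w) i * comp_coeff \<Phi> w i (m - 1))"
          unfolding higher_deriv_eq_jet jet_comp[OF \<Phi>w hw] ..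
        also have "(\<Sum>i\<le>m - 1. jet h (\<Phi> w) i * comp_coeff \<Phi> w i (m - 1)) = (\<Sum>k=1..m. jet h (\<Phi> w) (k - 1) * comp_coeff \<Phi> w (k - 1) (m - 1))"
          using m by (intro sum.reindex_bij_witness[of _ "\<lambda>k. k - 1" Suc]) auto
        finally have "a j m * (deriv ^^ (m - 1)) (\<lambda>z. h (\<Phi> z)) w =
          (\<Sum>k=1..m. a j m * fact (m - 1) * comp_coeff \<Phi> w (k - 1) (m - 1) / fact (k - 1) * (deriv ^^ (k - 1)) h (\<Phi> w))"
          by (simp add: sum_distrib_left jet_def mult_ac)
        also have "\<dots> = (\<Sum>k=1..n j - 1. if k \<le> m then a j m * fact (m - 1) * comp_coeff \<Phi> w (k - 1) (m - 1) / fact (k - 1) * (deriv ^^ (k - 1)) h (\<Phi> w) else 0)"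
          using m by (intro sum.mono_neutral_cong_left) auto
        finally show "a j m * (deriv ^^ (m - 1)) (\<lambda>z. h (\<Phi> z)) w = \<dots>" .
      qed
      also have "\<dots> = (\<Sum>k=1..n j - 1. \<Sum>m=1..n j - 1. if k \<le> m then a j m * fact (m - 1) * comp_coeff \<Phi> w (k - 1) (m - 1) / fact (k - 1) * (deriv ^^ (k - 1)) h (\<Phi> w) else 0)"
        by (rule sum.swap)
      also have "\<dots> = (\<Sum>k=1..n j - 1. (?a j k - (if j = 0 \<and> k = 1 then q else 0)) * (deriv ^^ (k - 1)) h (\<Phi> w))"
      proof (rule sum.cong[OF refl])
        fix k assume k: "k \<in> {1..n j - 1}"
        have "(\<Sum>m=1..n j - 1. if k \<le> m then a j m * fact (m - 1) * comp_coeff \<Phi> w (k - 1) (m - 1) / fact (k - 1) * (deriv ^^ (k - 1)) h (\<Phi> w) else 0)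
            = (\<Sum>m=k..n j - 1. a j m * fact (m - 1) * comp_coeff \<Phi> w (k - 1) (m - 1) / fact (k - 1) * (deriv ^^ (k - 1)) h (\<Phi> w))"
          using k by (intro sum.mono_neutral_cong_right) auto
        then show "(\<Sum>m=1..n j - 1. if k \<le> m then a j m * fact (m - 1) * comp_coeff \<Phi> w (k - 1) (m - 1) / fact (k - 1) * (deriv ^^ (k - 1)) h (\<Phi> w) else 0)
            = (?a j k - (if j = 0 \<and> k = 1 then q else 0)) * (deriv ^^ (k - 1)) h (\<Phi> w)"
          by (simp add: w_def sum_distrib_right sum_divide_distrib)
      qed
      finally show "(\<Sum>k=1..n j - 1. a j k * (deriv ^^ (k - 1)) (\<lambda>z. h (\<Phi> z)) (\<alpha> j))
        = (\<Sum>k=1..n j - 1. (?a j k - (if j = 0 \<and> k = 1 then q else 0)) * (deriv ^^ (k - 1)) h (?\<alpha> j))"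
        by (simp only: w_def)
    qed
    also have "\<dots> = (\<Sum>j=0..l. \<Sum>k=1..n j - 1. ?a j k * (deriv ^^ (k - 1)) h (?\<alpha> j))
        - (\<Sum>j=0..l. \<Sum>k=1..n j - 1. if k = 1 then (if j = 0 then q * h 0 else 0) else 0)"
    proof -
      have e: "(if j = 0 \<and> k = 1 then q else 0) * (deriv ^^ (k - 1)) h (?\<alpha> j)
          = (if k = 1 then (if j = 0 then q * h 0 else 0) else 0)" for j k
        using \<alpha>(1) \<Phi>(4) by auto
      show ?thesis by (simp only: left_diff_distrib sum_subtractf e)
    qed
    also have "(\<Sum>j=0..l. \<Sum>k=1..n j - 1. if k = 1 then (if j = 0 then q * h 0 else 0) else 0) = q * h 0"
    proof -
      have "(\<Sum>j=0..l. \<Sum>k=1..n j - 1. if k = 1 then (if j = 0 then q * h 0 else 0) else 0)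
          = (\<Sum>j=0..l. if j = 0 then q * h 0 else 0)"
        using n0 by (intro sum.cong refl) auto
      then show ?thesis by simp
    qed
    finally have W0: "weighted_integral g0 (\<lambda>z. h (\<Phi> z)) = of_real pi * ((\<Sum>j=1..r. c j * contour_integral (?\<gamma> j) (\<lambda>\<zeta>. h \<zeta> * g \<zeta>)) +
        ((\<Sum>j=0..l. \<Sum>k=1..n j - 1. ?a j k * (deriv ^^ (k - 1)) h (?\<alpha> j)) - q * h 0))" .
    have "complex_of_real (1 / pi) * weighted_integral g h = complex_of_real (1 / pi) * (weighted_integral g0 (\<lambda>z. h (\<Phi> z)) + of_real pi * q * h 0)"
      by (simp only: W[OF h])
    also have "\<dots> = (\<Sum>j=1..r. c j * contour_integral (?\<gamma> j) (\<lambda>\<zeta>. h \<zeta> * g \<zeta>)) +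
        (\<Sum>j=0..l. \<Sum>k=1..n j - 1. ?a j k * (deriv ^^ (k - 1)) h (?\<alpha> j))"
    proof -
      have "complex_of_real (1 / pi) * (of_real pi * (A + (E - q * h 0)) + of_real pi * q * h 0) = A + E" for A E
        by (simp add: field_simps)
      then show ?thesis unfolding W0 .
    qed
    finally show "complex_of_real (1 / pi) * weighted_integral g h =
      (\<Sum>j=1..r. c j * contour_integral (?\<gamma> j) (\<lambda>\<zeta>. h \<zeta> * g \<zeta>)) +
      (\<Sum>j=0..l. \<Sum>k=1..n j - 1. ?a j k * (deriv ^^ (k - 1)) h (?\<alpha> j))" .
  qed
qed

text \<open>A polynomial \<open>P = (z - v)\<^sup>j E\<close> with \<open>E \<equiv> 1\<close> to high order at \<open>v\<close> and \<open>E \<equiv> 0\<close> to high order at the other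
  points and zeros of \<open>g\<close>; for \<open>j > 0\<close> larger than the order of \<open>g\<close> at \<open>v\<close> this makes \<open>P'/g\<close> analytic.\<close>

lemma jet_interpolation:
  assumes g: "g analytic_on cball 0 1" "g 0 \<noteq> 0" and T: "finite T" and v: "v \<in> ball 0 1"
    and m: "has_zero_order g v m" and j: "j = 0 \<or> m < j"
  obtains P h where "P analytic_on cball 0 1" "h analytic_on cball 0 1"
    "\<And>z. z \<in> ball 0 1 \<Longrightarrow> (P has_field_derivative h z * g z) (at z)"
    "\<And>u i. u \<in> insert v T \<Longrightarrow> i < N \<Longrightarrow> jet P u i = (if u = v \<and> i = j then 1 else 0)"
proof -
  obtain p g0 where p: "p \<noteq> 0" "g0 analytic_on cball 0 1" "\<And>z. z \<in> cball 0 1 \<Longrightarrow> g0 z \<noteq> 0"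
    "\<And>z. g z = poly p z * g0 z"
    using factor_out_zeros[OF g] by blast
  define ov where "ov = order v p"
  obtain p2 where p2: "p = [:- v, 1:] ^ ov * p2" "\<not> [:- v, 1:] dvd p2"
    using order_decomp[OF p(1), of v] by (auto simp: ov_def)
  have p2v: "poly p2 v \<noteq> 0" using p2(2) by (simp add: poly_eq_0_iff_dvd)
  have vc: "v \<in> cball 0 1" using v by auto
  have om: "m = ov"
  proof -
    have "g0 analytic_on {v}" using p(2) vc by (auto elim: analytic_on_subset)
    then obtain r where r: "r > 0" "g0 holomorphic_on ball v r" unfolding analytic_on_def by auto
    have "has_zero_order g v ov"
      unfolding has_zero_order_def
      by (intro exI[of _ r] exI[of _ "\<lambda>z. poly p2 z * g0 z"])
         (use r p2 p2v p vc in \<open>auto intro!: holomorphic_intros simp: poly_power\<close>)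
    from has_zero_order_jet[OF this] show ?thesis
      by (intro has_zero_order_unique[OF m]) auto
  qed
  define Z where "Z = (T \<union> {z. poly p z = 0}) - {v}"
  have Z: "finite Z" using T poly_roots_finite[OF p(1)] by (simp add: Z_def)
  define W where "W = (\<Prod>u\<in>Z. [:- u, 1:])"
  have Wv: "poly W v \<noteq> 0" using Z by (auto simp: W_def poly_prod Z_def)
  have Wu: "[:- u, 1:] dvd W" if "u \<in> Z" for u
    unfolding W_def using Z that by (intro dvd_prodI)
  \<comment> \<open>Large enough for three purposes: jets below \<open>N\<close> are not affected,
    and the powers of \<open>W\<close> and of \<open>z - v\<close> that survive differentiation
    still contain \<open>p2\<close> and \<open>(z - v)^ov\<close>.\<close>
  define M' where "M' = N + ov + degree p2"
  define M where "M = Suc M'"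
  \<comment> \<open>Vanishes to order \<open>M\<close> on \<open>Z\<close> and takes the value
    \<open>1\<close> at \<open>v\<close>.\<close>
  define V where "V = smult (1 / poly W v ^ M) (W ^ M)"
  have Vv: "poly V v = 1" using Wv by (simp add: V_def poly_power)
  \<comment> \<open>\<open>V\<close> divides \<open>E\<close>, so \<open>E\<close> vanishes to order
    \<open>M\<close> on \<open>Z\<close>; and \<open>1 - E = (1 - V)^M\<close> vanishes to order
    \<open>M\<close> at \<open>v\<close>.\<close>
  define E where "E = 1 - (1 - V) ^ M"
  define P where "P = [:- v, 1:] ^ j * E"
  have "[:- v, 1:] dvd 1 - V" using Vv by (simp add: poly_eq_0_iff_dvd[symmetric])
  then obtain C where C: "(1 - V) ^ M = [:- v, 1:] ^ M * C" using dvd_power_same dvdE by metis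
  have Pv: "P = [:- v, 1:] ^ j - [:- v, 1:] ^ M * ([:- v, 1:] ^ j * C)"
    by (simp add: P_def E_def C algebra_simps)
  have "V dvd E"
  proof -
    have "1 - (1 - V) dvd 1 ^ M - (1 - V) ^ M"
      using power_diff_sumr2[of 1 M "1 - V"] by (metis dvd_triv_left)
    then show ?thesis by (simp add: E_def)
  qed
  moreover have "W ^ M dvd V" by (simp add: V_def dvd_smult)
  ultimately have "W ^ M dvd P" unfolding P_def by (meson dvd_mult dvd_trans)
  then obtain D where D: "P = W ^ M * D" by blast
  have jets: "jet (poly P) u i = (if u = v \<and> i = j then 1 else 0)" if u: "u \<in> insert v T" and i: "i < N" for u i
  proof (cases "u = v")
    case True
    have "poly P = (\<lambda>z. (z - v) ^ j - (z - v) ^ M * poly ([:- v, 1:] ^ j * C) z)"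
      by (auto simp: Pv poly_power)
    then have "jet (poly P) v i = jet (\<lambda>z. (z - v) ^ j) v i - jet (\<lambda>z. (z - v) ^ M * poly ([:- v, 1:] ^ j * C) z) v i"
      by (simp only:) (intro jet_diff analytic_intros poly_analytic_on)
    also have "jet (\<lambda>z. (z - v) ^ M * poly ([:- v, 1:] ^ j * C) z) v i = 0"
      using i by (subst jet_mult) (auto intro!: analytic_intros poly_analytic_on sum.neutral simp: jet_power_diff M_def M'_def simp del: power_Suc)
    finally show ?thesis using True by (simp add: jet_power_diff)
  next
    case False
    then have "u \<in> Z" using u by (auto simp: Z_def)
    then have "[:- u, 1:] ^ M dvd W ^ M" using Wu dvd_power_same by blast
    then obtain Y where "W ^ M = [:- u, 1:] ^ M * Y" by blast
    then have "poly P = (\<lambda>z. (z - u) ^ M * poly (Y * D) z)" by (auto simp: D poly_power)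
    moreover have "jet (\<lambda>z. (z - u) ^ M * poly (Y * D) z) u i = 0"
      using i by (subst jet_mult) (auto intro!: analytic_intros poly_analytic_on sum.neutral simp: jet_power_diff M_def M'_def simp del: power_Suc)
    ultimately show ?thesis using False by simp
  qed
  have "p dvd pderiv P"
  proof -
    \<comment> \<open>Differentiation costs one factor \<open>W\<close>, which is why
      \<open>M = Suc M'\<close>.\<close>
    have "pderiv P = W ^ M' * (W * pderiv D + smult (of_nat M) (pderiv W) * D)"
      unfolding D M_def pderiv_mult pderiv_power_Suc by (simp add: algebra_simps del: of_nat_Suc)
    then obtain Y where Y: "pderiv P = W ^ M' * Y" by blast
    have vP: "[:- v, 1:] ^ ov dvd pderiv P"
    proof -
      have d1: "[:- v, 1:] ^ ov dvd pderiv ([:- v, 1:] ^ j)"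
      proof (cases j)
        case (Suc j')
        then have "ov \<le> j'" using j om by auto
        then show ?thesis unfolding Suc pderiv_power_Suc
          by (intro dvd_mult2 dvd_smult le_imp_power_dvd)
      qed simp
      have d2: "[:- v, 1:] ^ ov dvd pderiv ([:- v, 1:] ^ M * X)" for X
      proof -
        have "pderiv ([:- v, 1:] ^ M * X) = [:- v, 1:] ^ M' * ([:- v, 1:] * pderiv X + smult (of_nat M) (pderiv [:- v, 1:]) * X)"
          unfolding M_def pderiv_mult pderiv_power_Suc by (simp only: power_Suc distrib_left mult_smult_left mult_smult_right mult_ac)
        moreover have "ov \<le> M'" by (simp add: M'_def)
        ultimately show ?thesis by (metis dvd_mult2 le_imp_power_dvd)
      qed
      show ?thesis unfolding Pv pderiv_diff by (intro dvd_diff d1 d2)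
    qed
    \<comment> \<open>\<open>W\<close> does not vanish at \<open>v\<close>, so the power of
      \<open>z - v\<close> in the derivative of \<open>P\<close> is carried by the cofactor
      \<open>Y\<close>. It needs \<open>j = 0\<close> or \<open>m < j\<close>, through the
      divisibility \<open>vP\<close>.\<close>
    have "[:- v, 1:] ^ ov dvd Y"
    proof (cases "Y = 0")
      case False
      have W0: "W ^ M' \<noteq> 0" using Wv by auto
      have "order v (W ^ M') = 0" using Wv by (intro order_0I) (simp add: poly_power)
      then have "order v (pderiv P) = order v Y"
        unfolding Y using W0 False by (simp add: order_mult)
      moreover have "pderiv P \<noteq> 0" using W0 False Y by simp
      ultimately show ?thesis using vP by (simp add: order_divides)
    qed simp
    moreover have "p2 dvd W ^ M'"
    proof -
      have "poly W z = 0" if "poly p2 z = 0" for z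
      proof -
        have "z \<in> Z" using that p2v by (auto simp: Z_def p2(1))
        then show ?thesis using Wu by (simp add: poly_eq_0_iff_dvd)
      qed
      \<comment> \<open>All roots of \<open>p2\<close> are roots of \<open>W\<close>, and no
        multiplicity exceeds the degree of \<open>p2\<close>.\<close>
      then have "p2 dvd W ^ degree p2" using nullstellensatz_univariate[of p2 W] p2v by auto
      moreover have "W ^ degree p2 dvd W ^ M'" by (intro le_imp_power_dvd) (simp add: M'_def)
      ultimately show ?thesis by (rule dvd_trans)
    qed
    ultimately show ?thesis unfolding p2(1) Y by (metis mult.commute mult_dvd_mono)
  qed
  then obtain A where A: "pderiv P = p * A" by blast
  define h where "h = (\<lambda>z. poly A z / g0 z)"
  show ?thesis
  proof
    show "poly P analytic_on cball 0 1" by (rule poly_analytic_on)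
    show "h analytic_on cball 0 1" unfolding h_def using p by (intro analytic_intros poly_analytic_on) auto
    show "(poly P has_field_derivative h z * g z) (at z)" if "z \<in> ball 0 1" for z
    proof -
      have "h z * g z = poly (pderiv P) z" using p(3)[of z] that by (simp add: h_def p(4) A)
      then show ?thesis using poly_DERIV[of P z] by simp
    qed
  qed (rule jets)
qed

text \<open>Comparing the two functionals on the interpolating polynomials expresses the principal parts of
  \<open>(f\<^sub>t\<^sup>*)'\<close> in terms of those of \<open>(f\<^sub>0\<^sup>*)'\<close>.\<close>

lemma star_expansion_transport:
  assumes g0: "g0 analytic_on cball 0 1" and g: "g analytic_on cball 0 1" "g 0 \<noteq> 0"
    and \<Phi>: "\<Phi> holomorphic_on ball 0 1" "inj_on \<Phi> (ball 0 1)" "\<Phi> ` ball 0 1 \<subseteq> ball 0 1"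
    and gg': "\<forall>z\<in>ball 0 1. g0 z = g (\<Phi> z) * deriv \<Phi> z"
    and W': "\<forall>h. h analytic_on cball 0 1 \<longrightarrow>
       weighted_integral g h = weighted_integral g0 (\<lambda>z. h (\<Phi> z)) + of_real pi * q * h 0"
    and ext0: "rational_extension g0 R0" and se0: "star_expansion R0 S0 N0 e0"
    and ext: "rational_extension g R" and se: "star_expansion R S N e"
    and v: "v \<in> ball 0 1" and m: "has_zero_order g v m" and j: "j = 0 \<or> v \<noteq> 0 \<and> m < j"
  shows "v \<notin> \<Phi> ` ball 0 1 \<Longrightarrow> e v j = 0"
    and "w \<in> ball 0 1 \<Longrightarrow> v = \<Phi> w \<Longrightarrow> e v j = (\<Sum>k\<in>{j..<N0}. e0 w k * comp_coeff \<Phi> w j k)"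
proof -
  note gg = gg'[rule_format] and W = W'[rule_format]
  have S: "finite S" "S \<subseteq> ball 0 1" "\<And>w k. w \<notin> S \<or> N \<le> k \<Longrightarrow> e w k = 0"
    and S0: "finite S0" "S0 \<subseteq> ball 0 1" "\<And>w k. w \<notin> S0 \<or> N0 \<le> k \<Longrightarrow> e0 w k = 0"
    using se se0 by (auto simp: star_expansion_def)
  \<comment> \<open>All points at which either functional evaluates \<open>P\<close>, and the
    origin, where the source acts.\<close>
  define T where "T = S \<union> \<Phi> ` S0 \<union> {0}"
  have T: "finite T" using S S0 by (simp add: T_def)
  \<comment> \<open>The bound \<open>N + N0 + 2\<close> covers the indices of both expansions and
    the index \<open>1\<close> at the origin.\<close>
  obtain P h where P: "P analytic_on cball 0 1" and h: "h analytic_on cball 0 1"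
    and Ph: "\<And>z. z \<in> ball 0 1 \<Longrightarrow> (P has_field_derivative h z * g z) (at z)"
    and jets: "\<And>u i. u \<in> insert v T \<Longrightarrow> i < N + N0 + 2 \<Longrightarrow> jet P u i = (if u = v \<and> i = j then 1 else 0)"
    using jet_interpolation[OF g T v m, of j "N + N0 + 2"] j by (metis (no_types, lifting))
  have \<Phi>b: "\<Phi> z \<in> ball 0 1" if "z \<in> ball 0 1" for z using \<Phi>(3) that by blast
  \<comment> \<open>The hypothesis on \<open>j\<close> excludes \<open>v = 0\<close> with
    \<open>j = 1\<close>, so \<open>P'\<close> vanishes at the origin and the source term drops
    out.\<close>
  have h0: "h 0 = 0"
  proof -
    have "jet P 0 1 = 0" using jets[of 0 1] j by (auto simp: T_def)
    then have "deriv P 0 = 0" by (simp add: jet_1)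
    then show ?thesis using DERIV_imp_deriv[OF Ph[of 0]] g(2) by simp
  qed
  obtain B where B: "\<And>z. z \<in> cball 0 1 \<Longrightarrow> cmod (h z) \<le> B" using analytic_on_cball_bounded[OF h] by blast
  have hh: "h holomorphic_on ball 0 1" using analytic_imp_holomorphic[OF h] by (rule holomorphic_on_subset) auto
  have h\<Phi>: "(\<lambda>z. h (\<Phi> z)) holomorphic_on ball 0 1"
    using holomorphic_on_compose_gen[OF \<Phi>(1) hh \<Phi>(3)] by (simp add: o_def)
  have P\<Phi>: "((\<lambda>z. P (\<Phi> z)) has_field_derivative h (\<Phi> z) * g0 z) (at z)" if z: "z \<in> ball 0 1" for z
    using DERIV_chain[OF Ph[OF \<Phi>b[OF z]] holomorphic_derivI[OF \<Phi>(1) open_ball z]]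
    by (simp add: o_def gg[OF z] mult.assoc)
  have "of_real pi * jet_functional S N e P = weighted_integral g h"
  proof (rule star_expansion_bounded[OF g(1) ext se hh _ Ph, symmetric])
    show "cmod (h z) \<le> B" if "z \<in> ball 0 1" for z using that by (intro B) auto
  qed
  also have "\<dots> = weighted_integral g0 (\<lambda>z. h (\<Phi> z))" using W[OF h] h0 by simp
  also have "\<dots> = of_real pi * jet_functional S0 N0 e0 (\<lambda>z. P (\<Phi> z))"
  proof (rule star_expansion_bounded[OF g0 ext0 se0 h\<Phi> _ P\<Phi>])
    show "cmod (h (\<Phi> z)) \<le> B" if "z \<in> ball 0 1" for z
      using \<Phi>b[OF that] by (intro B) auto
  qed
  finally have eq: "jet_functional S N e P = jet_functional S0 N0 e0 (\<lambda>z. P (\<Phi> z))" by simp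
  have lhs: "jet_functional S N e P = e v j"
  proof -
    have "jet_functional S N e P = (\<Sum>u\<in>S. if u = v then (\<Sum>k<N. if k = j then e v j else 0) else 0)"
      unfolding jet_functional_def
    proof (rule sum.cong[OF refl])
      fix u assume "u \<in> S"
      then have "jet P u k = (if u = v \<and> k = j then 1 else 0)" if "k < N" for k
        using jets[of u k] that by (auto simp: T_def)
      then have "(\<Sum>k<N. e u k * jet P u k) = (\<Sum>k<N. if u = v then (if k = j then e v j else 0) else 0)"
        by (intro sum.cong) auto
      then show "(\<Sum>k<N. e u k * jet P u k) = (if u = v then \<Sum>k<N. if k = j then e v j else 0 else 0)"
        by (cases "u = v") simp_all
    qed
    also have "\<dots> = e v j" using S by (auto simp: not_less)
    finally show ?thesis .
  qed
  have inner: "(\<Sum>k<N0. e0 u k * jet (\<lambda>z. P (\<Phi> z)) u k) = (if \<Phi> u = v then \<Sum>k\<in>{j..<N0}. e0 u k * comp_coeff \<Phi> u j k else 0)"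
    if u: "u \<in> S0" for u
  proof -
    have ub: "u \<in> ball 0 1" using u S0 by blast
    have \<Phi>u: "\<Phi> analytic_on {u}" using \<Phi>(1) ub analytic_at[of \<Phi> u] by blast
    have "\<Phi> u \<in> cball 0 1" using \<Phi>b[OF ub] by auto
    then have Pu: "P analytic_on {\<Phi> u}" using P by (auto elim: analytic_on_subset)
    have "jet (\<lambda>z. P (\<Phi> z)) u k = (if \<Phi> u = v \<and> j \<le> k then comp_coeff \<Phi> u j k else 0)" if k: "k < N0" for k
    proof -
      have "jet (\<lambda>z. P (\<Phi> z)) u k = (\<Sum>i\<le>k. jet P (\<Phi> u) i * comp_coeff \<Phi> u i k)"
        by (rule jet_comp[OF \<Phi>u Pu])
      also have "\<dots> = (\<Sum>i\<le>k. if i = j then (if \<Phi> u = v then comp_coeff \<Phi> u j k else 0) else 0)"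
        using u k jets[of "\<Phi> u"] by (intro sum.cong refl) (auto simp: T_def)
      finally show ?thesis by auto
    qed
    then have "(\<Sum>k<N0. e0 u k * jet (\<lambda>z. P (\<Phi> z)) u k) = (\<Sum>k<N0. if j \<le> k then (if \<Phi> u = v then e0 u k * comp_coeff \<Phi> u j k else 0) else 0)"
      by (intro sum.cong) auto
    also have "\<dots> = (\<Sum>k\<in>{j..<N0}. if \<Phi> u = v then e0 u k * comp_coeff \<Phi> u j k else 0)"
      by (intro sum.mono_neutral_cong_right) auto
    finally show ?thesis by auto
  qed
  have rhs: "e v j = (\<Sum>u\<in>S0. if \<Phi> u = v then \<Sum>k\<in>{j..<N0}. e0 u k * comp_coeff \<Phi> u j k else 0)"
    using eq unfolding lhs by (simp add: jet_functional_def inner)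
  show "e v j = 0" if "v \<notin> \<Phi> ` ball 0 1"
    unfolding rhs using that S0 by (intro sum.neutral) auto
  show "e v j = (\<Sum>k\<in>{j..<N0}. e0 w k * comp_coeff \<Phi> w j k)" if w: "w \<in> ball 0 1" "v = \<Phi> w"
  proof -
    \<comment> \<open>Injectivity leaves a single point of the initial expansion in the sum.\<close>
    have "\<Phi> u = v \<longleftrightarrow> u = w" if "u \<in> S0" for u
      using that w S0(2) inj_onD[OF \<Phi>(2)] by blast
    then have "e v j = (\<Sum>u\<in>S0. if u = w then \<Sum>k\<in>{j..<N0}. e0 w k * comp_coeff \<Phi> w j k else 0)"
      unfolding rhs by (intro sum.cong) auto
    then show ?thesis using S0 by (cases "w \<in> S0") auto
  qed
qed

text \<open>Residues are carried over unchanged, and away from the origin the top coefficient of a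
  principal part that reaches beyond the zero of \<open>g\<close> is multiplied by a power of
  \<open>\<Phi>'\<close>. So logarithmic poles, nonzero ordinary poles and their orders correspond.
  The origin is listed at both times, and \<open>n'\<close> may differ from \<open>n\<close>
  there.\<close>

lemma pole_location_transport:
  assumes g0: "g0 analytic_on cball 0 1" "g0 0 \<noteq> 0" and g: "g analytic_on cball 0 1" "g 0 \<noteq> 0"
    and \<Phi>: "\<Phi> holomorphic_on ball 0 1" "inj_on \<Phi> (ball 0 1)" "\<Phi> ` ball 0 1 \<subseteq> ball 0 1" "\<Phi> 0 = 0"
    and gg: "\<forall>z\<in>ball 0 1. g0 z = g (\<Phi> z) * deriv \<Phi> z"
    and W: "\<forall>h. h analytic_on cball 0 1 \<longrightarrow>
       weighted_integral g h = weighted_integral g0 (\<lambda>z. h (\<Phi> z)) + of_real pi * q * h 0"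
    and rat: "is_rational g" and loc: "pole_location g0 l r \<alpha> \<gamma> n"
    and \<alpha>0: "\<alpha> 0 = 0" and inj: "inj_on \<alpha> {0..l}" and n': "\<And>j. j \<noteq> 0 \<Longrightarrow> n' j = n j"
  shows "pole_location g l r (\<lambda>j. \<Phi> (\<alpha> j)) (\<lambda>j. \<Phi> \<circ> \<gamma> j) n'"
proof -
  obtain R where ext: "rational_extension g R" using rat by (auto simp: is_rational_def)
  obtain R0 where ext0: "rational_extension g0 R0" and
    ends: "(\<Union>j\<in>{1..r}. {pathstart (\<gamma> j), pathfinish (\<gamma> j)}) = log_poles_star R0" and
    \<alpha>im: "\<alpha> ` {0..l} = insert 0 (ordinary_poles_star R0)" and
    pol: "\<And>j. j \<in> {1..l} \<Longrightarrow> is_pole R0 (star_pt (\<alpha> j)) \<and> zorder R0 (star_pt (\<alpha> j)) = - int (n j)"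
    using loc unfolding pole_location_def by auto
  obtain S N e where se: "star_expansion R S N e" using star_expansion_exists[OF ext] by blast
  obtain S0 N0 e0 where se0: "star_expansion R0 S0 N0 e0" using star_expansion_exists[OF ext0] by blast
  have \<Phi>b: "\<Phi> z \<in> ball 0 1" if "z \<in> ball 0 1" for z using \<Phi>(3) that by blast
  have eb: "w \<in> ball 0 1" if "e w k \<noteq> 0" for w k using se that unfolding star_expansion_def by blast
  have e0b: "w \<in> ball 0 1" if "e0 w k \<noteq> 0" for w k using se0 that unfolding star_expansion_def by blast
  note tr = star_expansion_transport[OF g0(1) g \<Phi>(1,2,3) gg W ext0 se0 ext se]
  have ordx: "\<exists>m. has_zero_order g w m" if "w \<in> ball 0 1" for w
    using has_zero_order_exists[OF g, of w] that by (metis ball_subset_cball subsetD)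
  have ordx0: "\<exists>m. has_zero_order g0 w m" if "w \<in> ball 0 1" for w
    using has_zero_order_exists[OF g0, of w] that by (metis ball_subset_cball subsetD)
  have logs: "log_poles_star R = \<Phi> ` log_poles_star R0"
  proof -
    \<comment> \<open>Row \<open>0\<close> of the composition coefficients is
      \<open>1, 0, 0, ...\<close>, so no coefficient of positive index enters the residue.\<close>
    have fwd: "e (\<Phi> w) 0 = e0 w 0" if w: "w \<in> ball 0 1" for w
    proof -
      obtain m where m: "has_zero_order g (\<Phi> w) m" using ordx[OF \<Phi>b[OF w]] by blast
      have "e (\<Phi> w) 0 = (\<Sum>k\<in>{0..<N0}. e0 w k * comp_coeff \<Phi> w 0 k)"
        by (rule tr(2)[OF \<Phi>b[OF w] m _ w refl]) simp
      also have "\<dots> = (\<Sum>k\<in>{0..<N0}. if k = 0 then e0 w 0 else 0)"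
        by (intro sum.cong) (auto simp: comp_coeff_0)
      also have "\<dots> = e0 w 0" using star_expansion_eq_0[OF se0, of 0 w] by auto
      finally show ?thesis .
    qed
    have bwd: "v \<in> \<Phi> ` ball 0 1" if v: "e v 0 \<noteq> 0" for v
    proof -
      obtain m where m: "has_zero_order g v m" using ordx[OF eb[OF v]] by blast
      show ?thesis using tr(1)[OF eb[OF v] m, of 0] v by blast
    qed
    show ?thesis
      unfolding log_poles_star_eq[OF se] log_poles_star_eq[OF se0]
    proof (intro subset_antisym subsetI)
      fix v assume v: "v \<in> {w. e w 0 \<noteq> 0}"
      then obtain w where "w \<in> ball 0 1" "v = \<Phi> w" using bwd by blast
      then show "v \<in> \<Phi> ` {w. e0 w 0 \<noteq> 0}" using fwd[of w] v by auto
    next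
      fix v assume "v \<in> \<Phi> ` {w. e0 w 0 \<noteq> 0}"
      then show "v \<in> {w. e w 0 \<noteq> 0}" using fwd e0b by force
    qed
  qed
  \<comment> \<open>The relation between the coefficients is triangular. In the row of the top index
    only the diagonal entry \<open>\<Phi>'(w)^K\<close> remains, and the rows above it
    vanish.\<close>
  have top: "e (\<Phi> w) K \<noteq> 0 \<and> (\<forall>i>K. e (\<Phi> w) i = 0)"
    if w: "w \<in> ball 0 1" "w \<noteq> 0" and K: "e0 w K \<noteq> 0" "\<And>i. i > K \<Longrightarrow> e0 w i = 0"
      and m: "has_zero_order g (\<Phi> w) m" "m < K" for w K m
  proof -
    have \<Phi>w: "\<Phi> w \<noteq> 0" using inj_onD[OF \<Phi>(2), of w 0] w \<Phi>(4) by auto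
    have d: "deriv \<Phi> w \<noteq> 0" using holomorphic_injective_imp_regular[OF \<Phi>(1) open_ball \<Phi>(2) w(1)] .
    have KN: "K < N0" using star_expansion_eq_0[OF se0] K(1) by (metis not_le)
    have r: "e (\<Phi> w) i = (\<Sum>k\<in>{i..<N0}. e0 w k * comp_coeff \<Phi> w i k)" if "m < i" for i
      by (rule tr(2)[OF \<Phi>b[OF w(1)] m(1) _ w(1) refl]) (use that \<Phi>w in auto)
    have "e (\<Phi> w) K = (\<Sum>k\<in>{K..<N0}. if k = K then e0 w K * deriv \<Phi> w ^ K else 0)"
      unfolding r[OF m(2)] using K(2) by (intro sum.cong) (auto simp: comp_coeff_same)
    also have "\<dots> = e0 w K * deriv \<Phi> w ^ K" using KN by simp
    finally have "e (\<Phi> w) K \<noteq> 0" using K(1) d by simp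
    moreover have "e (\<Phi> w) i = 0" if "i > K" for i
      using r[of i] that m(2) K(2) by (auto intro!: sum.neutral)
    ultimately show ?thesis by blast
  qed
  have ord_fwd: "\<exists>K. e (\<Phi> w) K \<noteq> 0 \<and> (\<forall>i>K. e (\<Phi> w) i = 0) \<and> e0 w K \<noteq> 0 \<and> (\<forall>i>K. e0 w i = 0) \<and> \<Phi> w \<in> ordinary_poles_star R"
    if w: "w \<in> ordinary_poles_star R0" "w \<noteq> 0" for w
  proof -
    have wb: "w \<in> ball 0 1" using w by (auto simp: ordinary_poles_star_def)
    obtain m where m: "has_zero_order g (\<Phi> w) m" using ordx[OF \<Phi>b[OF wb]] by blast
    obtain m0 where m0: "has_zero_order g0 w m0" using ordx0[OF wb] by blast
    have "g analytic_on {\<Phi> w}" using g(1) \<Phi>b[OF wb] by (auto elim: analytic_on_subset)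
    then have mm: "m0 = m" using has_zero_order_comp[OF gg \<Phi>(1,2) wb _ m m0] by blast
    obtain k where k: "k > m" "e0 w k \<noteq> 0"
      using ordinary_pole_iff[OF ext0 se0 wb m0] w(1) mm by blast
    obtain K where K: "k \<le> K" "e0 w K \<noteq> 0" "\<And>i. i > K \<Longrightarrow> e0 w i = 0"
      using star_expansion_top[OF se0 k(2)] by blast
    have t: "e (\<Phi> w) K \<noteq> 0 \<and> (\<forall>i>K. e (\<Phi> w) i = 0)"
      by (rule top[OF wb w(2) K(2,3) m]) (use k K in auto)
    then have "\<Phi> w \<in> ordinary_poles_star R"
      using ordinary_pole_iff[OF ext se \<Phi>b[OF wb] m] k K by (meson less_le_trans)
    then show ?thesis using t K by blast
  qed
  have ord_bwd: "v \<in> \<Phi> ` ordinary_poles_star R0" if v: "v \<in> ordinary_poles_star R" "v \<noteq> 0" for v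
  proof -
    have vb: "v \<in> ball 0 1" using v by (auto simp: ordinary_poles_star_def)
    obtain m where m: "has_zero_order g v m" using ordx[OF vb] by blast
    obtain k where k: "k > m" "e v k \<noteq> 0" using ordinary_pole_iff[OF ext se vb m] v(1) by blast
    have "v \<in> \<Phi> ` ball 0 1" using tr(1)[OF vb m, of k] k v(2) by blast
    then obtain w where w: "w \<in> ball 0 1" "v = \<Phi> w" by blast
    obtain m0 where m0: "has_zero_order g0 w m0" using ordx0[OF w(1)] by blast
    have "g analytic_on {\<Phi> w}" using g(1) \<Phi>b[OF w(1)] by (auto elim: analytic_on_subset)
    then have mm: "m0 = m" using has_zero_order_comp[OF gg \<Phi>(1,2) w(1) _ _ m0] m w(2) by blast
    have "e v k = (\<Sum>i\<in>{k..<N0}. e0 w i * comp_coeff \<Phi> w k i)"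
      by (rule tr(2)[OF vb m _ w]) (use k v in auto)
    moreover have "(\<Sum>i\<in>{k..<N0}. e0 w i * comp_coeff \<Phi> w k i) = 0"
      if "\<And>i. i \<in> {k..<N0} \<Longrightarrow> e0 w i * comp_coeff \<Phi> w k i = 0"
      using that by (intro sum.neutral) blast
    ultimately obtain i where "i \<in> {k..<N0}" "e0 w i * comp_coeff \<Phi> w k i \<noteq> 0"
      using k(2) by metis
    then have "i > m0" "e0 w i \<noteq> 0" using k mm by auto
    then show ?thesis using ordinary_pole_iff[OF ext0 se0 w(1) m0] w(2) by blast
  qed
  have ords: "insert 0 (ordinary_poles_star R) = \<Phi> ` insert 0 (ordinary_poles_star R0)"
  proof (rule set_eqI)
    fix v
    show "v \<in> insert 0 (ordinary_poles_star R) \<longleftrightarrow> v \<in> \<Phi> ` insert 0 (ordinary_poles_star R0)"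
    proof (cases "v = 0")
      case True then show ?thesis using \<Phi>(4) by force
    next
      case False then show ?thesis using ord_fwd ord_bwd \<Phi>(4) by blast
    qed
  qed
  have ends': "(\<Union>j\<in>{1..r}. {pathstart (\<Phi> \<circ> \<gamma> j), pathfinish (\<Phi> \<circ> \<gamma> j)}) = log_poles_star R"
    unfolding logs ends[symmetric] by (auto simp: pathstart_compose pathfinish_compose)
  have \<alpha>im': "(\<lambda>j. \<Phi> (\<alpha> j)) ` {0..l} = insert 0 (ordinary_poles_star R)"
    unfolding ords \<alpha>im[symmetric] by (simp add: image_image)
  show ?thesis
    unfolding pole_location_def
  proof (intro exI[of _ R] conjI ext ends' \<alpha>im' ballI)
    have "v \<in> insert 0 (star_pt ` {\<zeta>. is_pole R \<zeta>})" if v: "v \<in> log_poles_star R \<union> ordinary_poles_star R" for v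
    proof (cases "v = 0")
      case False
      have "\<exists>k. e v k \<noteq> 0"
      proof (cases "v \<in> log_poles_star R")
        case True then show ?thesis unfolding log_poles_star_eq[OF se] by blast
      next
        case False
        then have vo: "v \<in> ordinary_poles_star R" using v by blast
        then have vb: "v \<in> ball 0 1" by (auto simp: ordinary_poles_star_def)
        obtain m where m: "has_zero_order g v m" using ordx[OF vb] by blast
        then show ?thesis using ordinary_pole_iff[OF ext se vb m] vo by blast
      qed
      then have "is_pole R (star_pt v)" using star_expansion_pole[OF se] False by blast
      then show ?thesis by (metis image_eqI insertI2 mem_Collect_eq star_pt_star_pt)
    qed simp
    then show "(\<Union>j\<in>{1..r}. {pathstart (\<Phi> \<circ> \<gamma> j), pathfinish (\<Phi> \<circ> \<gamma> j)}) \<union> (\<lambda>j. \<Phi> (\<alpha> j)) ` {0..l}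
      \<subseteq> insert 0 (star_pt ` {\<zeta>. is_pole R \<zeta>})"
      unfolding ends' \<alpha>im' by blast
    fix j assume j: "j \<in> {1..l}"
    have \<alpha>j0: "\<alpha> j \<noteq> 0" using inj_onD[OF inj, of j 0] j \<alpha>0 by auto
    moreover have "\<alpha> j \<in> insert 0 (ordinary_poles_star R0)" using \<alpha>im j by (metis atLeastAtMost_iff image_eqI le0)
    ultimately have or: "\<alpha> j \<in> ordinary_poles_star R0" by blast
    then have wb: "\<alpha> j \<in> ball 0 1" by (auto simp: ordinary_poles_star_def)
    obtain K where K: "e (\<Phi> (\<alpha> j)) K \<noteq> 0" "\<And>i. i > K \<Longrightarrow> e (\<Phi> (\<alpha> j)) i = 0" "e0 (\<alpha> j) K \<noteq> 0" "\<And>i. i > K \<Longrightarrow> e0 (\<alpha> j) i = 0"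
      using ord_fwd[OF or \<alpha>j0] by blast
    have \<Phi>0: "\<Phi> (\<alpha> j) \<noteq> 0" using inj_onD[OF \<Phi>(2), of "\<alpha> j" 0] wb \<alpha>j0 \<Phi>(4) by auto
    \<comment> \<open>The pole order is determined by the top index, and this is the same
      \<open>K\<close> at both times.\<close>
    have "- int (n j) = - int (Suc K)"
      using pol[OF j] star_expansion_pole_order(2)[OF se0 wb \<alpha>j0 K(3,4)] by simp
    then have nj: "n' j = Suc K" using n'[of j] j by auto
    show "is_pole R (star_pt (\<Phi> (\<alpha> j)))" "zorder R (star_pt (\<Phi> (\<alpha> j))) = - int (n' j)"
      using star_expansion_pole_order[OF se \<Phi>b[OF wb] \<Phi>0 K(1,2)] nj by auto
  qed
qed

section \<open>Evolution of quadrature identities\<close>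

lemma O_norm_deriv:
  assumes "f \<in> O_norm"
  shows "f analytic_on cball 0 1" "deriv f analytic_on cball 0 1" "deriv f 0 \<noteq> 0"
  using assms by (auto simp: O_norm_def intro: analytic_deriv)

lemma quadrature_enlarge_order:
  assumes qi: "quadrature_identity g l r \<alpha> \<gamma> c n a" and a: "n 0 = 1 \<longrightarrow> a 0 1 = 0"
  shows "quadrature_identity g l r \<alpha> \<gamma> c (n(0 := max 2 (n 0))) a"
proof -
  let ?n = "n(0 := max 2 (n 0))"
  have n0: "0 < n j" if "j \<in> {0..l}" for j using qi that unfolding quadrature_identity_def by blast
  have "(\<Sum>k=1..?n j - 1. a j k * (deriv ^^ (k - 1)) h (\<alpha> j)) = (\<Sum>k=1..n j - 1. a j k * (deriv ^^ (k - 1)) h (\<alpha> j))"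
    for j h
  proof (cases "j = 0 \<and> n 0 = 1")
    case True then show ?thesis using a by simp
  next
    case False
    then have "?n j = n j" using n0[of 0] by (auto simp: max_def)
    then show ?thesis by simp
  qed
  moreover have "\<forall>j\<in>{0..l}. \<alpha> j \<in> ball 0 1 \<and> 0 < ?n j"
    using qi unfolding quadrature_identity_def by auto
  ultimately show ?thesis using qi unfolding quadrature_identity_def by simp
qed

text \<open>The identity is used with the enlarged order at the origin, while the pole location is
  known with the original one; quantifying over all \<open>m\<close> that agree with
  \<open>n\<close> off index \<open>0\<close> connects the two.\<close>

lemma weak_solution_step:
  fixes F :: "real \<Rightarrow> complex \<Rightarrow> complex"
  assumes ws: "weak_solution TYPE('s) I q F" and I: "0 \<in> I" "t \<in> I" "0 < t"
    and On: "F 0 \<in> O_norm" "F t \<in> O_norm"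
    and qi: "quadrature_identity (deriv (F 0)) l r \<alpha> \<gamma> c n a" and n0: "2 \<le> n 0"
  shows "\<exists>\<alpha>' \<gamma>' a'. quadrature_identity (deriv (F t)) l r \<alpha>' \<gamma>' c n a' \<and> \<alpha>' 0 = 0 \<and>
     a' 0 1 = a 0 1 + complex_of_real (2 * source_total q t) \<and>
     (\<forall>m. (\<forall>j. j \<noteq> 0 \<longrightarrow> n j = m j) \<longrightarrow> pole_location (deriv (F 0)) l r \<alpha> \<gamma> m \<longrightarrow>
        pole_location (deriv (F t)) l r \<alpha>' \<gamma>' n)"
proof -
  let ?k = "deriv (F 0)" and ?g = "deriv (F t)"
  note o0 = O_norm_deriv[OF On(1)] and ot = O_norm_deriv[OF On(2)]
  obtain \<Phi> where \<Phi>: "\<Phi> holomorphic_on ball 0 1" "inj_on \<Phi> (ball 0 1)" "\<Phi> ` ball 0 1 \<subseteq> ball 0 1" "\<Phi> 0 = 0"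
    and FF: "\<And>z. z \<in> ball 0 1 \<Longrightarrow> F 0 z = F t (\<Phi> z)"
    and W: "\<forall>K B. K holomorphic_on ball 0 1 \<longrightarrow> (\<forall>z\<in>ball 0 1. cmod (K z) \<le> B) \<longrightarrow>
       (LINT z:ball 0 1|lborel. (cmod (?g z))\<^sup>2 * Re (K z)) =
       (LINT z:ball 0 1|lborel. (cmod (?k z))\<^sup>2 * Re (K (\<Phi> z))) +
       2 * pi * (source_total q t - source_total q 0) * Re (K 0)"
    by (rule weak_solution_transport[OF ws I(1,2,3) o0(1) ot(1)]) (rule that; assumption)
  have \<Phi>b: "\<Phi> z \<in> ball 0 1" if "z \<in> ball 0 1" for z using \<Phi>(3) that by blast
  have Q0: "source_total q 0 = 0" by (simp add: source_total_def)
  define Q where "Q = source_total q t"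
  have gg: "?k z = ?g (\<Phi> z) * deriv \<Phi> z" if z: "z \<in> ball 0 1" for z
  proof -
    have "F t holomorphic_on ball 0 1" using analytic_imp_holomorphic[OF ot(1)] by (rule holomorphic_on_subset) auto
    from DERIV_chain[OF holomorphic_derivI[OF this open_ball \<Phi>b[OF z]] holomorphic_derivI[OF \<Phi>(1) open_ball z]]
    have "(F 0 has_field_derivative ?g (\<Phi> z) * deriv \<Phi> z) (at z)"
      by (rule has_field_derivative_transform_within_open[OF _ open_ball z]) (simp add: FF)
    then show ?thesis by (rule DERIV_imp_deriv)
  qed
  \<comment> \<open>The weak inequality gives \<open>2 * pi * Q\<close>; the factor
    \<open>1 / pi\<close> in the quadrature identity turns this into the increment
    \<open>2 * Q\<close>.\<close>
  have WI: "weighted_integral ?g h = weighted_integral ?k (\<lambda>z. h (\<Phi> z)) + of_real pi * of_real (2 * Q) * h 0"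
    if h: "h analytic_on cball 0 1" for h
  proof -
    obtain B where B: "\<And>z. z \<in> cball 0 1 \<Longrightarrow> cmod (h z) \<le> B" using analytic_on_cball_bounded[OF h] by blast
    have hh: "h holomorphic_on ball 0 1" using analytic_imp_holomorphic[OF h] by (rule holomorphic_on_subset) auto
    \<comment> \<open>The inequality speaks of real parts only; the test function
      \<open>- i h\<close> supplies the imaginary part.\<close>
    have re: "Re (weighted_integral ?g K) = Re (weighted_integral ?k (\<lambda>z. K (\<Phi> z))) + 2 * pi * Q * Re (K 0)"
      if K: "K holomorphic_on ball 0 1" and KB: "\<And>z. z \<in> ball 0 1 \<Longrightarrow> cmod (K z) \<le> B" for K
    proof -
      have "continuous_on (ball 0 1) K" using K holomorphic_on_imp_continuous_on by blast
      moreover have "continuous_on (ball 0 1) (\<lambda>z. K (\<Phi> z))"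
        using continuous_on_compose2[OF calculation holomorphic_on_imp_continuous_on[OF \<Phi>(1)]] \<Phi>b by blast
      ultimately show ?thesis
        using W[rule_format, OF K KB] Re_weighted_integral[OF ot(2), of K B] KB
          Re_weighted_integral[OF o0(2), of "\<lambda>z. K (\<Phi> z)" B] \<Phi>b
        by (simp add: Q0 Q_def)
    qed
    have mult: "weighted_integral k (\<lambda>z. - \<i> * u z) = - \<i> * weighted_integral k u" for k u
      unfolding weighted_integral_def mult.assoc by (rule set_integral_mult_right)
    have "Re (weighted_integral ?g h) = Re (weighted_integral ?k (\<lambda>z. h (\<Phi> z))) + 2 * pi * Q * Re (h 0)"
      by (rule re[OF hh]) (use B in auto)
    moreover have "Re (weighted_integral ?g (\<lambda>z. - \<i> * h z)) = Re (weighted_integral ?k (\<lambda>z. - \<i> * h (\<Phi> z))) + 2 * pi * Q * Re (- \<i> * h 0)"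
      by (rule re) (use B hh in \<open>auto intro!: holomorphic_intros simp: norm_mult\<close>)
    then have "Im (weighted_integral ?g h) = Im (weighted_integral ?k (\<lambda>z. h (\<Phi> z))) + 2 * pi * Q * Im (h 0)"
      unfolding mult by simp
    ultimately show ?thesis by (simp add: complex_eq_iff)
  qed
  define a' where "a' = (\<lambda>j k. (\<Sum>m=k..n j - 1. a j m * fact (m - 1) * comp_coeff \<Phi> (\<alpha> j) (k - 1) (m - 1)) / fact (k - 1)
        + (if j = 0 \<and> k = 1 then of_real (2 * Q) else 0))"
  have qt: "quadrature_identity ?g l r (\<lambda>j. \<Phi> (\<alpha> j)) (\<lambda>j. \<Phi> \<circ> \<gamma> j) c n a'"
    unfolding a'_def
  proof (rule quadrature_transport[OF o0(2) ot(2) \<Phi> _ _ qi n0])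
    show "?k z = ?g (\<Phi> z) * deriv \<Phi> z" if "z \<in> ball 0 1" for z by (rule gg[OF that])
    show "weighted_integral ?g h = weighted_integral ?k (\<lambda>z. h (\<Phi> z)) + of_real pi * of_real (2 * Q) * h 0"
      if "h analytic_on cball 0 1" for h by (rule WI[OF that])
  qed
  have \<alpha>0: "\<alpha> 0 = 0" "inj_on \<alpha> {0..l}" using qi unfolding quadrature_identity_def by auto
  \<comment> \<open>Only the undifferentiated term of \<open>h \<circ> \<Phi>\<close> contributes
    the value \<open>h 0\<close>, so no other old coefficient enters the new
    \<open>a 0 1\<close>.\<close>
  have "(\<Sum>m=1..n 0 - 1. a 0 m * fact (m - 1) * comp_coeff \<Phi> (\<alpha> 0) 0 (m - 1)) = (\<Sum>m=1..n 0 - 1. if m = 1 then a 0 1 else 0)"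
    by (intro sum.cong) (auto simp: comp_coeff_0)
  also have "\<dots> = a 0 1" using n0 by simp
  finally have a1: "a' 0 1 = a 0 1 + complex_of_real (2 * source_total q t)"
    by (simp add: a'_def Q_def)
  have "pole_location ?g l r (\<lambda>j. \<Phi> (\<alpha> j)) (\<lambda>j. \<Phi> \<circ> \<gamma> j) n"
    if m: "\<forall>j. j \<noteq> 0 \<longrightarrow> n j = m j" "pole_location ?k l r \<alpha> \<gamma> m" for m
  proof (rule pole_location_transport[OF o0(2,3) ot(2,3) \<Phi> _ _ _ m(2) \<alpha>0])
    show "\<forall>z\<in>ball 0 1. ?k z = ?g (\<Phi> z) * deriv \<Phi> z" using gg by blast
    show "\<forall>h. h analytic_on cball 0 1 \<longrightarrow> weighted_integral ?g h = weighted_integral ?k (\<lambda>z. h (\<Phi> z)) + of_real pi * of_real (2 * Q) * h 0"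
      using WI by blast
    show "is_rational ?g" by (rule rational_of_quadrature[OF ot(2,3) qt])
  qed (use m(1) in auto)
  then show ?thesis using qt a1 \<alpha>0 \<Phi>(4) by (intro exI[of _ "\<lambda>j. \<Phi> (\<alpha> j)"] exI[of _ "\<lambda>j. \<Phi> \<circ> \<gamma> j"] exI[of _ a']) auto
qed

theorem proposition9p1:
  fixes f :: "complex \<Rightarrow> complex" and F :: "real \<Rightarrow> complex \<Rightarrow> complex"
    and I :: "real set" and q :: "real \<Rightarrow> real"
  shows
    "(f \<in> O_norm \<longrightarrow>
        (is_rational (deriv f) \<longleftrightarrow>
           (\<exists>l r \<alpha> \<gamma> c n a. quadrature_identity (deriv f) l r \<alpha> \<gamma> c n a)) \<and>
        (is_rational (deriv f) \<longrightarrow>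
           (\<exists>l r \<alpha> \<gamma> c n a. quadrature_identity (deriv f) l r \<alpha> \<gamma> c n a \<and>
                            pole_location (deriv f) l r \<alpha> \<gamma> n)))
     \<and>
     (is_interval I \<and> 0 \<in> I \<and> (\<forall>t\<in>I. 0 \<le> t) \<and>
      (\<forall>t\<in>I. 0 \<le> q t \<and> q integrable_on {0..t}) \<and>
      (\<forall>t\<in>I. F t \<in> O_norm) \<and> weak_solution TYPE('s) I q F \<longrightarrow>
        (\<forall>l r \<alpha> \<gamma> c n a.
           quadrature_identity (deriv (F 0)) l r \<alpha> \<gamma> c n a \<and> (n 0 = 1 \<longrightarrow> a 0 1 = 0) \<longrightarrow>
           (\<exists>\<alpha>t \<gamma>t a_t. \<alpha>t 0 = \<alpha> \<and> \<gamma>t 0 = \<gamma> \<and> a_t 0 = a \<and>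
              (\<forall>t\<in>I.
                 quadrature_identity (deriv (F t)) l r (\<alpha>t t) (\<gamma>t t) c
                   (n(0 := max 2 (n 0))) (a_t t) \<and>
                 \<alpha>t t 0 = 0 \<and>
                 a_t t 0 1 = a 0 1 + complex_of_real (2 * source_total q t) \<and>
                 (pole_location (deriv (F 0)) l r \<alpha> \<gamma> n \<longrightarrow>
                    pole_location (deriv (F t)) l r (\<alpha>t t) (\<gamma>t t) (n(0 := max 2 (n 0))))))))"
proof (rule conjI; intro impI allI)
  assume "f \<in> O_norm"
  note d = O_norm_deriv(2,3)[OF this]
  have fwd: "\<exists>l r \<alpha> \<gamma> c n a. quadrature_identity (deriv f) l r \<alpha> \<gamma> c n a \<and> pole_location (deriv f) l r \<alpha> \<gamma> n"
    if "is_rational (deriv f)"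
    using that quadrature_of_rational[OF d] unfolding is_rational_def by blast
  moreover have "is_rational (deriv f)"
    if "\<exists>l r \<alpha> \<gamma> c n a. quadrature_identity (deriv f) l r \<alpha> \<gamma> c n a"
    using that rational_of_quadrature[OF d] by blast
  ultimately show "(is_rational (deriv f) \<longleftrightarrow>
           (\<exists>l r \<alpha> \<gamma> c n a. quadrature_identity (deriv f) l r \<alpha> \<gamma> c n a)) \<and>
        (is_rational (deriv f) \<longrightarrow>
           (\<exists>l r \<alpha> \<gamma> c n a. quadrature_identity (deriv f) l r \<alpha> \<gamma> c n a \<and>
                            pole_location (deriv f) l r \<alpha> \<gamma> n))"
    by blast
next
  fix l r \<alpha> \<gamma> c n a
  assume A: "is_interval I \<and> 0 \<in> I \<and> (\<forall>t\<in>I. 0 \<le> t) \<and>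
      (\<forall>t\<in>I. 0 \<le> q t \<and> q integrable_on {0..t}) \<and>
      (\<forall>t\<in>I. F t \<in> O_norm) \<and> weak_solution TYPE('s) I q F"
    and B: "quadrature_identity (deriv (F 0)) l r \<alpha> \<gamma> c n a \<and> (n 0 = 1 \<longrightarrow> a 0 1 = 0)"
  let ?n = "n(0 := max 2 (n 0))"
  have qi: "quadrature_identity (deriv (F 0)) l r \<alpha> \<gamma> c ?n a"
    using quadrature_enlarge_order B by blast
  have ws: "weak_solution TYPE('s) I q F" and I0: "0 \<in> I" and On: "\<And>t. t \<in> I \<Longrightarrow> F t \<in> O_norm" using A by auto
  define Conc where "Conc = (\<lambda>t \<alpha>' \<gamma>' a'. quadrature_identity (deriv (F t)) l r \<alpha>' \<gamma>' c ?n a' \<and> \<alpha>' 0 = 0 \<and>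
      a' 0 1 = a 0 1 + complex_of_real (2 * source_total q t) \<and>
      (pole_location (deriv (F 0)) l r \<alpha> \<gamma> n \<longrightarrow> pole_location (deriv (F t)) l r \<alpha>' \<gamma>' ?n))"
  \<comment> \<open>The initial time is separate, because the comparison of domains concerns times
    \<open>s < t\<close> and the initial data are to be kept literally.\<close>
  have zero: "Conc 0 \<alpha> \<gamma> a"
  proof -
    have "\<alpha> 0 = 0" using qi unfolding quadrature_identity_def by blast
    moreover have "pole_location (deriv (F 0)) l r \<alpha> \<gamma> ?n" if "pole_location (deriv (F 0)) l r \<alpha> \<gamma> n"
      using that unfolding pole_location_def by auto
    ultimately show ?thesis using qi unfolding Conc_def by (simp add: source_total_def)
  qed
  \<comment> \<open>Points, arcs and coefficients at one time belong together, so they are chosen as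
    one triple; the clause for \<open>t = 0\<close> forces the choice to start with the given
    data.\<close>
  have "\<exists>d. (t = 0 \<longrightarrow> d = (\<alpha>, \<gamma>, a)) \<and> Conc t (fst d) (fst (snd d)) (snd (snd d))" if t: "t \<in> I" for t
  proof (cases "t = 0")
    case True
    then show ?thesis using zero by (intro exI[of _ "(\<alpha>, \<gamma>, a)"]) simp
  next
    case False
    then have t0: "0 < t" using A t by force
    obtain \<alpha>' \<gamma>' a' where *: "quadrature_identity (deriv (F t)) l r \<alpha>' \<gamma>' c ?n a'" "\<alpha>' 0 = 0"
      "a' 0 1 = a 0 1 + complex_of_real (2 * source_total q t)"
      "\<forall>m. (\<forall>j. j \<noteq> 0 \<longrightarrow> ?n j = m j) \<longrightarrow> pole_location (deriv (F 0)) l r \<alpha> \<gamma> m \<longrightarrow>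
        pole_location (deriv (F t)) l r \<alpha>' \<gamma>' ?n"
    proof -
      have "2 \<le> ?n 0" by simp
      from weak_solution_step[OF ws I0 t t0 On[OF I0] On[OF t] qi this] show ?thesis
        using that by (elim exE conjE)
    qed
    have "Conc t \<alpha>' \<gamma>' a'"
      unfolding Conc_def using *(1-3) *(4)[rule_format, of n] by simp
    then show ?thesis using False by (intro exI[of _ "(\<alpha>', \<gamma>', a')"]) simp
  qed
  then have "\<exists>d. \<forall>t\<in>I. (t = 0 \<longrightarrow> d t = (\<alpha>, \<gamma>, a)) \<and> Conc t (fst (d t)) (fst (snd (d t))) (snd (snd (d t)))"
    by (intro bchoice) blast
  then obtain d where d: "\<And>t. t \<in> I \<Longrightarrow> (t = 0 \<longrightarrow> d t = (\<alpha>, \<gamma>, a)) \<and> Conc t (fst (d t)) (fst (snd (d t))) (snd (snd (d t)))"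
    by blast
  have "d 0 = (\<alpha>, \<gamma>, a)" using d[OF I0] by blast
  then have "fst (d 0) = \<alpha> \<and> fst (snd (d 0)) = \<gamma> \<and> snd (snd (d 0)) = a" by simp
  then show "\<exists>\<alpha>t \<gamma>t a_t. \<alpha>t 0 = \<alpha> \<and> \<gamma>t 0 = \<gamma> \<and> a_t 0 = a \<and>
              (\<forall>t\<in>I.
                 quadrature_identity (deriv (F t)) l r (\<alpha>t t) (\<gamma>t t) c
                   (n(0 := max 2 (n 0))) (a_t t) \<and>
                 \<alpha>t t 0 = 0 \<and>
                 a_t t 0 1 = a 0 1 + complex_of_real (2 * source_total q t) \<and>
                 (pole_location (deriv (F 0)) l r \<alpha> \<gamma> n \<longrightarrow>
                    pole_location (deriv (F t)) l r (\<alpha>t t) (\<gamma>t t) (n(0 := max 2 (n 0)))))"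
    using d unfolding Conc_def
    by (intro exI[of _ "\<lambda>t. fst (d t)"] exI[of _ "\<lambda>t. fst (snd (d t))"] exI[of _ "\<lambda>t. snd (snd (d t))"]) blast
qed

end
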